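(* Let $d_{\mathrm{av}}=0$. Let $h:[0,\infty)\to\mathbb{R}$ be continuous on $[0,\infty)$ and continuously differentiable on $(0,\infty)$ with $\lim_{a\to 0}h'(a)a=0$, and suppose there exist $0\le p\le 4$ and a constant $C_h<\infty$ such that $|h(a)|\le C_h(1+a^p)$ for all $a\ge 0$ and $|h'(a)|\le C_h(a^{-1}+a^{p-1})$ for all $a>0$. Let $0\le\psi\in L^1(\mathbb{R})\cap L^{\frac{4}{4-p}}(\mathbb{R})$ (with $\frac{4}{4-p}=\infty$ if $p=4$), and let $P(z)=h(|z|)z$ for $z\in\mathbb{C}$. Then the Cauchy problem $$i\partial_t u+\int_{\mathbb{R}}T_r^{-1}\big(P(T_ru)\big)\psi(r)\,dr=0,\qquad u(\cdot,0)=u_0,$$ is globally well-posed in $L^2(\mathbb{R})$, and the mass is conserved: $\|u(t)\|_{L^2}^2=\|u_0\|_{L^2}^2$ for all $t\in\mathbb{R}$.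
   Context: $u=u(x,t)$ is complex-valued, $x,t\in\mathbb{R}$, and $u(t)=u(\cdot,t)$. $T_r=e^{ir\partial_x^2}$, $r\in\mathbb{R}$, is the free Schrödinger group in one space dimension: $w(x,r)=(T_rf)(x)$ solves $i\partial_rw+\partial_x^2w=0$, $w(x,0)=f(x)$. Put $Q(f)=\int_{\mathbb{R}}T_r^{-1}(P(T_rf))\psi(r)\,dr$. A strong solution on $[-M_-,M_+]$ ($M_\pm>0$) with initial datum $u_0\in L^2(\mathbb{R})$ is $u\in\mathcal{C}([-M_-,M_+],L^2(\mathbb{R}))\cap\mathcal{C}^1((-M_-,M_+),L^2(\mathbb{R}))$ satisfying $i\partial_tu+Q(u)=0$ and $u(0)=u_0$; equivalently, $u\in\mathcal{C}([-M_-,M_+],L^2(\mathbb{R}))$ satisfies $u(t)=u_0+i\int_0^tQ(u(t'))\,dt'$ for all $t\in[-M_-,M_+]$. The problem is locally well-posed in $L^2(\mathbb{R})$ if for every $u_0\in L^2(\mathbb{R})$ there exist $M_\pm>0$ and a ball $B\subset L^2(\mathbb{R})$ containing $u_0$ such that for each $\phi\in B$ there is a unique strong solution $u\in\mathcal{C}([-M_-,M_+],L^2(\mathbb{R}))$ with initial datum $\phi$, and the map $\phi\mapsto u$ is continuous from $B$ to $\mathcal{C}([-M_-,M_+],L^2(\mathbb{R}))$. It is globally well-posed if $M_\pm$ can be taken arbitrarily large. *)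

theory Defs
  imports "HOL-Analysis.Analysis"
begin

section \<open>The Hilbert space \<open>L\<^sup>2(\<real>)\<close> of complex-valued functions\<close>

definition square_integrable :: "(real \<Rightarrow> complex) \<Rightarrow> bool" where
  "square_integrable f \<longleftrightarrow>
     f \<in> borel_measurable lborel \<and> integrable lborel (\<lambda>x. (cmod (f x))\<^sup>2)"

lemma square_integrable_measurable [measurable_dest]:
  "square_integrable f \<Longrightarrow> f \<in> borel_measurable borel"
  by (simp add: square_integrable_def)

lemma square_integrable_0 [simp]: "square_integrable (\<lambda>x. 0)"
  by (simp add: square_integrable_def)

lemma square_integrable_cmult:
  assumes "square_integrable f" shows "square_integrable (\<lambda>x. c * f x)"
  using assms by (auto simp: square_integrable_def norm_mult power_mult_distrib)

lemma square_integrable_scaleR: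
  assumes "square_integrable f" shows "square_integrable (\<lambda>x. r *\<^sub>R f x)"
  using assms by (auto simp: square_integrable_def power_mult_distrib)

lemma square_integrable_uminus:
  assumes "square_integrable f" shows "square_integrable (\<lambda>x. - f x)"
  using assms by (auto simp: square_integrable_def)

lemma norm_add_sq_le: "(norm (a + b))\<^sup>2 \<le> 2 * (norm a)\<^sup>2 + 2 * (norm (b::'a::real_normed_vector))\<^sup>2"
proof -
  have "(norm (a + b))\<^sup>2 \<le> (norm a + norm b)\<^sup>2"
    by (intro power_mono norm_triangle_ineq) auto
  also have "\<dots> \<le> 2 * (norm a)\<^sup>2 + 2 * (norm b)\<^sup>2"
    using sum_squares_bound[of "norm a" "norm b"] by (simp add: power2_sum)
  finally show ?thesis .
qed

lemma square_integrable_add: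
  assumes f: "square_integrable f" and g: "square_integrable g"
  shows "square_integrable (\<lambda>x. f x + g x)"
proof -
  have [measurable]: "f \<in> borel_measurable borel" "g \<in> borel_measurable borel"
    using f g by (auto simp: square_integrable_def)
  have "integrable lborel (\<lambda>x. (cmod (f x + g x))\<^sup>2)"
  proof (rule Bochner_Integration.integrable_bound)
    show "integrable lborel (\<lambda>x. 2 * (cmod (f x))\<^sup>2 + 2 * (cmod (g x))\<^sup>2)"
      using f g by (auto simp: square_integrable_def)
    show "AE x in lborel. norm ((cmod (f x + g x))\<^sup>2)
        \<le> norm (2 * (cmod (f x))\<^sup>2 + 2 * (cmod (g x))\<^sup>2)"
      using norm_add_sq_le by (auto simp: abs_of_nonneg)
  qed measurable
  then show ?thesis by (simp add: square_integrable_def)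
qed

lemma square_integrable_diff:
  assumes "square_integrable f" "square_integrable g"
  shows "square_integrable (\<lambda>x. f x - g x)"
  using square_integrable_add[OF assms(1) square_integrable_uminus[OF assms(2)]] by simp

lemma square_integrable_bound:
  assumes "square_integrable g" "f \<in> borel_measurable borel" "\<And>x. cmod (f x) \<le> c * cmod (g x)"
  shows "square_integrable f"
proof -
  have [measurable]: "f \<in> borel_measurable borel" "g \<in> borel_measurable borel"
    using assms by (auto simp: square_integrable_def)
  have "integrable lborel (\<lambda>x. (cmod (f x))\<^sup>2)"
  proof (rule Bochner_Integration.integrable_bound)
    show "integrable lborel (\<lambda>x. c\<^sup>2 * (cmod (g x))\<^sup>2)"
      using assms by (auto simp: square_integrable_def)
    have "(cmod (f x))\<^sup>2 \<le> c\<^sup>2 * (cmod (g x))\<^sup>2" for x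
      using power_mono[OF assms(3)[of x], of 2] by (simp add: power_mult_distrib)
    then show "AE x in lborel. norm ((cmod (f x))\<^sup>2) \<le> norm (c\<^sup>2 * (cmod (g x))\<^sup>2)"
      by auto
  qed measurable
  then show ?thesis using assms by (simp add: square_integrable_def)
qed

lemma square_integrable_inner:
  assumes f: "square_integrable f" and g: "square_integrable g"
  shows "integrable lborel (\<lambda>x. inner (f x) (g x))"
proof (rule Bochner_Integration.integrable_bound)
  have [measurable]: "f \<in> borel_measurable borel" "g \<in> borel_measurable borel"
    using f g by (auto simp: square_integrable_def)
  show "integrable lborel (\<lambda>x. (cmod (f x))\<^sup>2 + (cmod (g x))\<^sup>2)"
    using f g by (auto simp: square_integrable_def)
  have "\<bar>inner (f x) (g x)\<bar> \<le> (cmod (f x))\<^sup>2 + (cmod (g x))\<^sup>2" for x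
  proof -
    have "\<bar>inner (f x) (g x)\<bar> \<le> cmod (f x) * cmod (g x)" by (rule Cauchy_Schwarz_ineq2)
    moreover have "2 * (cmod (f x) * cmod (g x)) \<le> (cmod (f x))\<^sup>2 + (cmod (g x))\<^sup>2"
      using sum_squares_bound[of "cmod (f x)" "cmod (g x)"] by simp
    moreover have "0 \<le> cmod (f x) * cmod (g x)" by simp
    ultimately show ?thesis by linarith
  qed
  then show "AE x in lborel. norm (inner (f x) (g x)) \<le> norm ((cmod (f x))\<^sup>2 + (cmod (g x))\<^sup>2)"
    by auto
  show "(\<lambda>x. inner (f x) (g x)) \<in> borel_measurable lborel" by measurable
qed

definition L2_rel :: "(real \<Rightarrow> complex) \<Rightarrow> (real \<Rightarrow> complex) \<Rightarrow> bool" where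
  "L2_rel f g \<longleftrightarrow> square_integrable f \<and> square_integrable g \<and> (AE x in lborel. f x = g x)"

lemma part_equivp_L2_rel: "part_equivp L2_rel"
proof (rule part_equivpI)
  show "\<exists>f. L2_rel f f" by (rule exI[of _ "\<lambda>x. 0"]) (simp add: L2_rel_def)
  show "symp L2_rel" by (auto simp: symp_def L2_rel_def)
  show "transp L2_rel" by (auto simp: transp_def L2_rel_def)
qed

quotient_type L2 = "real \<Rightarrow> complex" / partial: L2_rel
  by (rule part_equivp_L2_rel)

lemma L2_rel_self: "L2_rel f f \<longleftrightarrow> square_integrable f"
  by (simp add: L2_rel_def)

lemma square_integrable_rep [simp]: "square_integrable (rep_L2 f)"
  using Quotient_rep_reflp[OF Quotient_L2] by (simp add: L2_rel_self)

lemma rep_L2_measurable [measurable]: "rep_L2 f \<in> borel_measurable borel"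
  using square_integrable_rep[of f] by (simp add: square_integrable_def)

lemma abs_rep_L2 [simp]: "abs_L2 (rep_L2 f) = f"
  using Quotient_abs_rep[OF Quotient_L2] by blast

lemma rep_abs_L2:
  assumes "square_integrable f" shows "AE x in lborel. rep_L2 (abs_L2 f) x = f x"
proof -
  have "L2_rel (rep_L2 (abs_L2 f)) f"
    using Quotient_rep_abs[OF Quotient_L2] assms by (simp add: L2_rel_self)
  then show ?thesis by (simp add: L2_rel_def)
qed

lemma L2_eqI: "(AE x in lborel. rep_L2 f x = rep_L2 g x) \<Longrightarrow> f = g"
  using Quotient_rel_rep[OF Quotient_L2, of f g] by (simp add: L2_rel_def)

lemma L2_cases: obtains F where "square_integrable F" "f = abs_L2 F"
  by (metis abs_rep_L2 square_integrable_rep)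

text \<open>The inner product of the real Hilbert space underlying \<open>L\<^sup>2(\<real>)\<close> is \<open>Re \<integral> f cnj g\<close>, because
  \<open>inner a b = Re (a * cnj b)\<close> on \<^typ>\<open>complex\<close>; it induces the usual norm.\<close>

instantiation L2 :: real_inner
begin

lift_definition zero_L2 :: L2 is "\<lambda>x. 0"
  by (simp add: L2_rel_def)

lift_definition plus_L2 :: "L2 \<Rightarrow> L2 \<Rightarrow> L2" is "\<lambda>f g x. f x + g x"
  by (auto simp: L2_rel_def square_integrable_add)

lift_definition minus_L2 :: "L2 \<Rightarrow> L2 \<Rightarrow> L2" is "\<lambda>f g x. f x - g x"
  by (auto simp: L2_rel_def square_integrable_diff)

lift_definition uminus_L2 :: "L2 \<Rightarrow> L2" is "\<lambda>f x. - f x"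
  by (auto simp: L2_rel_def square_integrable_uminus)

lift_definition scaleR_L2 :: "real \<Rightarrow> L2 \<Rightarrow> L2" is "\<lambda>r f x. r *\<^sub>R f x"
  by (auto simp: L2_rel_def square_integrable_scaleR)

lift_definition inner_L2 :: "L2 \<Rightarrow> L2 \<Rightarrow> real" is "\<lambda>f g. \<integral>x. inner (f x) (g x) \<partial>lborel"
  by (rule integral_cong_AE) (auto simp: L2_rel_def square_integrable_def)

lift_definition norm_L2 :: "L2 \<Rightarrow> real" is "\<lambda>f. sqrt (\<integral>x. (cmod (f x))\<^sup>2 \<partial>lborel)"
  by (rule arg_cong[where f = sqrt], rule integral_cong_AE)
     (auto simp: L2_rel_def square_integrable_def)

definition sgn_L2 :: "L2 \<Rightarrow> L2" where "sgn_L2 f = inverse (norm f) *\<^sub>R f"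

definition dist_L2 :: "L2 \<Rightarrow> L2 \<Rightarrow> real" where "dist_L2 f g = norm (f - g)"

definition uniformity_L2 :: "(L2 \<times> L2) filter" where
  "uniformity_L2 = (INF e\<in>{0<..}. principal {(f, g). dist f g < e})"

definition open_L2 :: "L2 set \<Rightarrow> bool" where
  "open_L2 U \<longleftrightarrow> (\<forall>f\<in>U. \<forall>\<^sub>F (f', g) in uniformity. f' = f \<longrightarrow> g \<in> U)"

instance
proof
  fix f g h :: L2 and r s :: real
  show "f + g + h = f + (g + h)"
    by transfer (auto simp: L2_rel_def add.assoc intro!: square_integrable_add)
  show "f + g = g + f"
    by transfer (auto simp: L2_rel_def add.commute intro!: square_integrable_add)
  show "0 + f = f"
    by transfer (auto simp: L2_rel_def)
  show "- f + f = 0"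
    by transfer (auto simp: L2_rel_def)
  show "f - g = f + - g"
    by transfer (auto simp: L2_rel_def intro!: square_integrable_add square_integrable_uminus
      square_integrable_diff)
  show "r *\<^sub>R (f + g) = r *\<^sub>R f + r *\<^sub>R g"
    by transfer (auto simp: L2_rel_def scaleR_add_right
      intro!: square_integrable_add square_integrable_scaleR)
  show "(r + s) *\<^sub>R f = r *\<^sub>R f + s *\<^sub>R f"
    by transfer (auto simp: L2_rel_def scaleR_add_left
      intro!: square_integrable_add square_integrable_scaleR)
  show "r *\<^sub>R s *\<^sub>R f = (r * s) *\<^sub>R f"
    by transfer (auto simp: L2_rel_def intro!: square_integrable_scaleR)
  show "1 *\<^sub>R f = f"
    by transfer (auto simp: L2_rel_def)
  show "sgn f = inverse (norm f) *\<^sub>R f" by (rule sgn_L2_def)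
  show "dist f g = norm (f - g)" by (rule dist_L2_def)
  show "uniformity = (INF e\<in>{0<..}. principal {(f, g). dist (f::L2) g < e})"
    by (rule uniformity_L2_def)
  show "open U \<longleftrightarrow> (\<forall>f\<in>U. \<forall>\<^sub>F (f', g) in uniformity. f' = f \<longrightarrow> g \<in> U)" for U :: "L2 set"
    by (rule open_L2_def)
  show "inner f g = inner g f"
    by transfer (simp add: inner_commute)
  show "inner (f + g) h = inner f h + inner g h"
    by transfer (simp add: L2_rel_self inner_add_left square_integrable_inner)
  show "inner (r *\<^sub>R f) g = r * inner f g"
    by transfer simp
  show "0 \<le> inner f f"
    by transfer simp
  show "inner f f = 0 \<longleftrightarrow> f = 0"
  proof transfer
    fix f assume "L2_rel f f"
    then have f: "square_integrable f" by (simp add: L2_rel_self)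
    have "(\<integral>x. inner (f x) (f x) \<partial>lborel) = 0 \<longleftrightarrow> (AE x in lborel. inner (f x) (f x) = 0)"
      by (rule integral_nonneg_eq_0_iff_AE) (auto intro: square_integrable_inner f)
    then show "((\<integral>x. inner (f x) (f x) \<partial>lborel) = 0) = L2_rel f (\<lambda>x. 0)"
      using f by (simp add: L2_rel_def)
  qed
  show "norm f = sqrt (inner f f)"
    by transfer (simp add: power2_norm_eq_inner)
qed

end

lemma norm_L2_sq: "(norm (f::L2))\<^sup>2 = (\<integral>x. (cmod (rep_L2 f x))\<^sup>2 \<partial>lborel)"
  by (simp add: norm_L2.rep_eq)

lemma norm_abs_L2_sq:
  assumes "square_integrable f" shows "(norm (abs_L2 f))\<^sup>2 = (\<integral>x. (cmod (f x))\<^sup>2 \<partial>lborel)"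
proof -
  have "norm (abs_L2 f) = sqrt (\<integral>x. (cmod (f x))\<^sup>2 \<partial>lborel)"
    using assms by (intro norm_L2.abs_eq) (simp add: L2_rel_self)
  then show ?thesis by simp
qed

lemma abs_L2_add:
  "square_integrable f \<Longrightarrow> square_integrable g \<Longrightarrow> abs_L2 f + abs_L2 g = abs_L2 (\<lambda>x. f x + g x)"
  by (rule plus_L2.abs_eq) (simp_all add: L2_rel_self)

lemma abs_L2_diff:
  "square_integrable f \<Longrightarrow> square_integrable g \<Longrightarrow> abs_L2 f - abs_L2 g = abs_L2 (\<lambda>x. f x - g x)"
  by (rule minus_L2.abs_eq) (simp_all add: L2_rel_self)

lemma abs_L2_scaleR:
  "square_integrable f \<Longrightarrow> r *\<^sub>R abs_L2 f = abs_L2 (\<lambda>x. r *\<^sub>R f x)"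
  by (rule scaleR_L2.abs_eq) (simp_all add: L2_rel_self)

lemma dist_abs_L2_sq:
  assumes "square_integrable f" "square_integrable g"
  shows "(dist (abs_L2 f) (abs_L2 g))\<^sup>2 = (\<integral>x. (cmod (f x - g x))\<^sup>2 \<partial>lborel)"
  using assms by (simp add: dist_norm abs_L2_diff norm_abs_L2_sq square_integrable_diff)

lemma dist_L2_sq_nn:
  "ennreal ((dist f (g::L2))\<^sup>2) = (\<integral>\<^sup>+x. ennreal ((cmod (rep_L2 f x - rep_L2 g x))\<^sup>2) \<partial>lborel)"
proof -
  have "(dist f g)\<^sup>2 = (\<integral>x. (cmod (rep_L2 f x - rep_L2 g x))\<^sup>2 \<partial>lborel)"
    using dist_abs_L2_sq[of "rep_L2 f" "rep_L2 g"] by simp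
  moreover have "integrable lborel (\<lambda>x. (cmod (rep_L2 f x - rep_L2 g x))\<^sup>2)"
    using square_integrable_diff[OF square_integrable_rep[of f] square_integrable_rep[of g]]
    unfolding square_integrable_def by blast
  ultimately show ?thesis
    by (simp add: nn_integral_eq_integral)
qed

subsection \<open>Completeness\<close>

lemma L2_Cauchy_subseq:
  fixes X :: "nat \<Rightarrow> L2"
  assumes "Cauchy X"
  obtains r where "strict_mono r" "\<And>k. (dist (X (r (Suc k))) (X (r k)))\<^sup>2 \<le> (1/8)^k"
proof -
  have "\<exists>N. \<forall>m\<ge>N. \<forall>n\<ge>N. dist (X m) (X n) < (1/8)^k" for k :: nat
    using assms unfolding Cauchy_def by (meson zero_less_divide_1_iff zero_less_numeral zero_less_power)
  then obtain N where N: "\<And>k m n. m \<ge> N k \<Longrightarrow> n \<ge> N k \<Longrightarrow> dist (X m) (X n) < (1/8)^k"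
    by metis
  define r where "r = rec_nat (N 0) (\<lambda>k m. max (Suc m) (N (Suc k)))"
  have r_Suc: "r (Suc k) = max (Suc (r k)) (N (Suc k))" for k by (simp add: r_def)
  have sm: "strict_mono r" by (rule strict_monoI_Suc) (simp add: r_Suc)
  have rN: "N k \<le> r k" for k by (cases k) (auto simp: r_def)
  have "(dist (X (r (Suc k))) (X (r k)))\<^sup>2 \<le> (1/8)^k" for k
  proof -
    let ?d = "dist (X (r (Suc k))) (X (r k))"
    have "r k \<le> r (Suc k)" by (simp add: r_Suc)
    then have d: "?d < (1/8)^k" using N[of k] rN[of k] by (meson order_trans order_refl)
    moreover have "(1/8::real)^k \<le> 1" by (simp add: power_le_one)
    ultimately have "?d * ?d \<le> (1/8)^k * 1" by (intro mult_mono) auto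
    then show ?thesis by (simp add: power2_eq_square)
  qed
  with sm that show thesis by blast
qed

lemma L2_subseq_AE_convergent:
  fixes Y :: "nat \<Rightarrow> L2"
  assumes Y: "\<And>k. (dist (Y (Suc k)) (Y k))\<^sup>2 \<le> (1/8)^k"
  shows "AE x in lborel. convergent (\<lambda>k. rep_L2 (Y k) x)"
proof -
  let ?d = "\<lambda>k x. (cmod (rep_L2 (Y (Suc k)) x - rep_L2 (Y k) x))\<^sup>2"
  have "(\<integral>\<^sup>+x. (\<Sum>k. ennreal (4^k * ?d k x)) \<partial>lborel) = (\<Sum>k. \<integral>\<^sup>+x. ennreal (4^k * ?d k x) \<partial>lborel)"
    by (rule nn_integral_suminf) measurable
  also have "\<dots> = (\<Sum>k. ennreal (4^k * (dist (Y (Suc k)) (Y k))\<^sup>2))"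
    by (simp add: ennreal_mult nn_integral_cmult dist_L2_sq_nn)
  also have "\<dots> \<le> (\<Sum>k. ennreal ((1/2)^k))"
  proof (rule suminf_le)
    fix k
    have "4^k * (dist (Y (Suc k)) (Y k))\<^sup>2 \<le> 4^k * (1/8)^k"
      using Y[of k] by (intro mult_left_mono) auto
    also have "\<dots> = (1/2)^k" by (simp flip: power_mult_distrib)
    finally show "ennreal (4^k * (dist (Y (Suc k)) (Y k))\<^sup>2) \<le> ennreal ((1/2)^k)"
      by (rule ennreal_leI)
  qed auto
  also have "\<dots> = ennreal (\<Sum>k. (1/2)^k)"
    by (rule suminf_ennreal2) (auto intro: summable_geometric)
  finally have "(\<integral>\<^sup>+x. (\<Sum>k. ennreal (4^k * ?d k x)) \<partial>lborel) \<noteq> \<infinity>"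
    by (auto simp: top_unique)
  then have "AE x in lborel. (\<Sum>k. ennreal (4^k * ?d k x)) \<noteq> \<infinity>"
    by (intro nn_integral_noteq_infinite) measurable
  then show ?thesis
  proof eventually_elim
    fix x assume fin: "(\<Sum>k. ennreal (4^k * ?d k x)) \<noteq> \<infinity>"
    then have sm: "summable (\<lambda>k. 4^k * ?d k x)"
      by (intro summable_suminf_not_top) auto
    define S where "S = (\<Sum>k. 4^k * ?d k x)"
    have le: "4^k * ?d k x \<le> S" for k
      unfolding S_def using sum_le_suminf[OF sm, of "{k}"] by auto
    have "cmod (rep_L2 (Y (Suc k)) x - rep_L2 (Y k) x) \<le> sqrt S * (1/2)^k" for k
    proof (rule power2_le_imp_le)
      have S0: "0 \<le> S" using le[of 0] by (rule order_trans[rotated]) simp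
      have "?d k x \<le> S * (1/4)^k" using le[of k] by (simp add: field_simps power_divide)
      also have "\<dots> = (sqrt S * (1/2)^k)\<^sup>2"
      proof -
        have "((1/2)^k)\<^sup>2 = (1/4::real)^k"
          by (simp add: power2_eq_square flip: power_mult_distrib)
        then show ?thesis using S0 by (simp add: power_mult_distrib)
      qed
      finally show "?d k x \<le> (sqrt S * (1/2)^k)\<^sup>2" .
      show "0 \<le> sqrt S * (1/2)^k" using S0 by simp
    qed
    then have "summable (\<lambda>k. rep_L2 (Y (Suc k)) x - rep_L2 (Y k) x)"
      by (intro summable_comparison_test'[OF summable_mult[OF summable_geometric]]) auto
    then have "convergent (\<lambda>n. \<Sum>k<n. rep_L2 (Y (Suc k)) x - rep_L2 (Y k) x)"
      by (simp add: summable_iff_convergent)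
    then have "convergent (\<lambda>n. rep_L2 (Y n) x - rep_L2 (Y 0) x)"
      using sum_lessThan_telescope[of "\<lambda>k. rep_L2 (Y k) x"] by simp
    from convergent_add[OF this convergent_const[of "rep_L2 (Y 0) x"]]
    show "convergent (\<lambda>n. rep_L2 (Y n) x)" by simp
  qed
qed

instance L2 :: banach
proof
  fix X :: "nat \<Rightarrow> L2"
  assume X: "Cauchy X"
  obtain r where r: "strict_mono r" "\<And>k. (dist (X (r (Suc k))) (X (r k)))\<^sup>2 \<le> (1/8)^k"
    using L2_Cauchy_subseq[OF X] by blast
  define Y where "Y = X \<circ> r"
  have CY: "Cauchy Y" unfolding Y_def using X r(1) by (rule Cauchy_subseq_Cauchy)
  define F where "F = (\<lambda>x. lim (\<lambda>k. rep_L2 (Y k) x))"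
  have F_meas [measurable]: "F \<in> borel_measurable borel"
    unfolding F_def by (rule borel_measurable_lim_metric) simp
  have lim: "AE x in lborel. (\<lambda>k. rep_L2 (Y k) x) \<longlonglongrightarrow> F x"
    using L2_subseq_AE_convergent[of Y] r(2)
    by (auto simp: Y_def F_def convergent_LIMSEQ_iff)
  have bd: "(\<integral>\<^sup>+x. ennreal ((cmod (F x - rep_L2 (Y k) x))\<^sup>2) \<partial>lborel) \<le> ennreal (e\<^sup>2)"
    if "\<And>n. n \<ge> k \<Longrightarrow> dist (Y n) (Y k) \<le> e" "0 \<le> e" for k e
  proof -
    have "(\<integral>\<^sup>+x. ennreal ((cmod (F x - rep_L2 (Y k) x))\<^sup>2) \<partial>lborel)
       = (\<integral>\<^sup>+x. liminf (\<lambda>n. ennreal ((cmod (rep_L2 (Y n) x - rep_L2 (Y k) x))\<^sup>2)) \<partial>lborel)"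
    proof (rule nn_integral_cong_AE, use lim in eventually_elim)
      fix x assume "(\<lambda>k. rep_L2 (Y k) x) \<longlonglongrightarrow> F x"
      then have "(\<lambda>n. ennreal ((cmod (rep_L2 (Y n) x - rep_L2 (Y k) x))\<^sup>2))
          \<longlonglongrightarrow> ennreal ((cmod (F x - rep_L2 (Y k) x))\<^sup>2)"
        by (intro tendsto_ennrealI tendsto_intros)
      then show "ennreal ((cmod (F x - rep_L2 (Y k) x))\<^sup>2)
          = liminf (\<lambda>n. ennreal ((cmod (rep_L2 (Y n) x - rep_L2 (Y k) x))\<^sup>2))"
        by (intro lim_imp_Liminf[symmetric]) auto
    qed
    also have "\<dots> \<le> liminf (\<lambda>n. \<integral>\<^sup>+x. ennreal ((cmod (rep_L2 (Y n) x - rep_L2 (Y k) x))\<^sup>2) \<partial>lborel)"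
      by (rule nn_integral_liminf) measurable
    also have "\<dots> = liminf (\<lambda>n. ennreal ((dist (Y n) (Y k))\<^sup>2))"
      by (simp add: dist_L2_sq_nn)
    also have "\<dots> \<le> limsup (\<lambda>n. ennreal ((dist (Y n) (Y k))\<^sup>2))"
      by (rule Liminf_le_Limsup) simp
    also have "\<dots> \<le> ennreal (e\<^sup>2)"
    proof (rule Limsup_bounded)
      show "\<forall>\<^sub>F n in sequentially. ennreal ((dist (Y n) (Y k))\<^sup>2) \<le> ennreal (e\<^sup>2)"
        using eventually_ge_at_top[of k]
        by eventually_elim (use that in \<open>auto intro!: ennreal_leI power_mono\<close>)
    qed
    finally show ?thesis .
  qed
  have sqd: "square_integrable (\<lambda>x. F x - rep_L2 (Y k) x)"
    if "\<And>n. n \<ge> k \<Longrightarrow> dist (Y n) (Y k) \<le> e" "0 \<le> e" for k e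
  proof -
    have "integrable lborel (\<lambda>x. (cmod (F x - rep_L2 (Y k) x))\<^sup>2)"
      using bd[OF that] by (intro integrableI_nonneg) (auto simp: le_less_trans)
    then show ?thesis by (simp add: square_integrable_def)
  qed
  obtain k0 where "\<And>n. n \<ge> k0 \<Longrightarrow> dist (Y n) (Y k0) \<le> 1"
    using CY unfolding Cauchy_def by (metis less_imp_le order_refl zero_less_one)
  from sqd[OF this] have "square_integrable (\<lambda>x. (F x - rep_L2 (Y k0) x) + rep_L2 (Y k0) x)"
    by (intro square_integrable_add) auto
  then have F: "square_integrable F" by simp
  have "Y \<longlonglongrightarrow> abs_L2 F"
  proof (rule metric_LIMSEQ_I)
    fix e :: real assume e: "0 < e"
    then obtain N where N: "\<And>m n. m \<ge> N \<Longrightarrow> n \<ge> N \<Longrightarrow> dist (Y m) (Y n) < e/2"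
      using CY unfolding Cauchy_def by (meson half_gt_zero)
    have "dist (Y k) (abs_L2 F) < e" if "k \<ge> N" for k
    proof -
      have le: "\<And>n. n \<ge> k \<Longrightarrow> dist (Y n) (Y k) \<le> e/2"
        using N that by (meson less_imp_le order_trans)
      have "(dist (abs_L2 F) (abs_L2 (rep_L2 (Y k))))\<^sup>2 = (\<integral>x. (cmod (F x - rep_L2 (Y k) x))\<^sup>2 \<partial>lborel)"
        using F by (intro dist_abs_L2_sq) auto
      also have "ennreal \<dots> = (\<integral>\<^sup>+x. ennreal ((cmod (F x - rep_L2 (Y k) x))\<^sup>2) \<partial>lborel)"
        using sqd[OF le] e by (subst nn_integral_eq_integral) (auto simp: square_integrable_def)
      also have "\<dots> \<le> ennreal ((e/2)\<^sup>2)"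
        using bd[OF le] e by auto
      finally have "(dist (abs_L2 F) (Y k))\<^sup>2 \<le> (e/2)\<^sup>2"
        by (simp add: ennreal_le_iff)
      then have "dist (abs_L2 F) (Y k) \<le> e/2"
        by (rule power2_le_imp_le) (use e in simp)
      then show ?thesis using e by (simp add: dist_commute)
    qed
    then show "\<exists>N. \<forall>k\<ge>N. dist (Y k) (abs_L2 F) < e" by blast
  qed
  then have "X \<longlonglongrightarrow> abs_L2 F"
    using Cauchy_converges_subseq[OF X r(1)] by (simp add: Y_def o_def)
  then show "convergent X" by (rule convergentI)
qed

subsection \<open>Separability\<close>

lemma L2_dominated_tendsto:
  assumes g: "square_integrable g" and [measurable]: "f \<in> borel_measurable borel"
    and s: "\<And>i. s i \<in> borel_measurable borel" "\<And>i x. cmod (s i x) \<le> c * cmod (g x)"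
    and lim: "\<And>x. (\<lambda>i. s i x) \<longlonglongrightarrow> f x"
  shows "square_integrable f" "(\<lambda>i. abs_L2 (s i)) \<longlonglongrightarrow> abs_L2 f"
proof -
  note [measurable] = s(1)
  have [measurable]: "g \<in> borel_measurable borel" using g by (simp add: square_integrable_def)
  have sq_s: "square_integrable (s i)" for i
    by (rule square_integrable_bound[OF g s(1) s(2)])
  have f_le: "cmod (f x) \<le> c * cmod (g x)" for x
    by (rule LIMSEQ_le_const2[OF tendsto_norm[OF lim[of x]]]) (use s(2) in blast)
  show sq_f: "square_integrable f"
    by (rule square_integrable_bound[OF g _ f_le]) measurable
  have "(\<lambda>i. \<integral>x. (cmod (s i x - f x))\<^sup>2 \<partial>lborel) \<longlonglongrightarrow> (integral\<^sup>L lborel (\<lambda>x::real. 0))"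
  proof (rule integral_dominated_convergence[where w = "\<lambda>x. (2 * c)\<^sup>2 * (cmod (g x))\<^sup>2"])
    show "integrable lborel (\<lambda>x. (2 * c)\<^sup>2 * (cmod (g x))\<^sup>2)"
      using g by (simp add: square_integrable_def)
    show "AE x in lborel. (\<lambda>i. (cmod (s i x - f x))\<^sup>2) \<longlonglongrightarrow> 0"
    proof (rule AE_I2)
      fix x
      have "(\<lambda>i. (cmod (s i x - f x))\<^sup>2) \<longlonglongrightarrow> (cmod (f x - f x))\<^sup>2"
        by (intro tendsto_intros lim)
      then show "(\<lambda>i. (cmod (s i x - f x))\<^sup>2) \<longlonglongrightarrow> 0" by simp
    qed
    show "AE x in lborel. norm ((cmod (s i x - f x))\<^sup>2) \<le> (2 * c)\<^sup>2 * (cmod (g x))\<^sup>2" for i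
    proof (rule AE_I2)
      fix x
      have "cmod (s i x - f x) \<le> cmod (s i x) + cmod (f x)" by (rule norm_triangle_ineq4)
      also have "\<dots> \<le> 2 * c * cmod (g x)" using s(2)[of i x] f_le[of x] by simp
      finally have "(cmod (s i x - f x))\<^sup>2 \<le> (2 * c * cmod (g x))\<^sup>2" by (rule power_mono) simp
      then show "norm ((cmod (s i x - f x))\<^sup>2) \<le> (2 * c)\<^sup>2 * (cmod (g x))\<^sup>2"
        by (simp add: power_mult_distrib)
    qed
  qed measurable
  then have "(\<lambda>i. (dist (abs_L2 (s i)) (abs_L2 f))\<^sup>2) \<longlonglongrightarrow> 0"
    by (simp add: dist_abs_L2_sq sq_s sq_f)
  then have "(\<lambda>i. sqrt ((dist (abs_L2 (s i)) (abs_L2 f))\<^sup>2)) \<longlonglongrightarrow> sqrt 0"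
    by (rule tendsto_real_sqrt)
  then show "(\<lambda>i. abs_L2 (s i)) \<longlonglongrightarrow> abs_L2 f"
    by (subst tendsto_dist_iff) simp
qed

definition box_union :: "(rat \<times> rat) list \<Rightarrow> real set" where
  "box_union bs = (\<Union>(a, b)\<in>set bs. {of_rat a<..<of_rat b})"

definition rat_step :: "(rat \<times> rat) \<times> (rat \<times> rat) list \<Rightarrow> L2" where
  "rat_step = (\<lambda>((p, q), bs).
     abs_L2 (\<lambda>x. Complex (of_rat p) (of_rat q) * indicator (box_union bs) x))"

definition rat_steps :: "L2 set" where
  "rat_steps = range (\<lambda>xs. sum_list (map rat_step xs))"

lemma countable_rat_steps: "countable rat_steps"
  unfolding rat_steps_def by (rule countable_image) (rule countableI_type)

lemma rat_step_in: "rat_step p \<in> rat_steps"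
  unfolding rat_steps_def by (rule range_eqI[of _ _ "[p]"]) simp

lemma zero_in_rat_steps: "0 \<in> rat_steps"
  unfolding rat_steps_def by (rule range_eqI[of _ _ "[]"]) simp

lemma add_in_rat_steps:
  assumes "f \<in> rat_steps" "g \<in> rat_steps" shows "f + g \<in> rat_steps"
proof -
  from assms obtain xs ys where "f = sum_list (map rat_step xs)" "g = sum_list (map rat_step ys)"
    by (auto simp: rat_steps_def)
  then show ?thesis unfolding rat_steps_def by (intro range_eqI[of _ _ "xs @ ys"]) simp
qed

lemma add_in_closure_rat_steps:
  assumes "f \<in> closure rat_steps" "g \<in> closure rat_steps" shows "f + g \<in> closure rat_steps"
proof -
  from assms obtain F G where "\<And>n. F n \<in> rat_steps" "F \<longlonglongrightarrow> f" "\<And>n. G n \<in> rat_steps" "G \<longlonglongrightarrow> g"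
    unfolding closure_sequential by blast
  then show ?thesis
    unfolding closure_sequential
    by (intro exI[of _ "\<lambda>n. F n + G n"]) (auto intro: tendsto_add add_in_rat_steps)
qed

lemma sum_in_closure_rat_steps:
  assumes "finite Y" "\<And>y. y \<in> Y \<Longrightarrow> f y \<in> closure rat_steps"
  shows "sum f Y \<in> closure rat_steps"
  using assms
proof (induction Y rule: finite_induct)
  case empty
  then show ?case using zero_in_rat_steps closure_subset by auto
next
  case (insert y Y)
  then show ?case by (auto intro: add_in_closure_rat_steps)
qed

lemma limit_in_closure_rat_steps:
  assumes "\<And>n. F n \<in> closure rat_steps" "F \<longlonglongrightarrow> f" shows "f \<in> closure rat_steps"
  using assms closed_sequentially[OF closed_closure] by blast

lemma square_integrable_indicator:
  assumes [measurable]: "A \<in> sets borel" and "emeasure lborel A < \<infinity>"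
  shows "square_integrable (\<lambda>x. c * indicator A x)"
proof -
  have eq: "(cmod (c * indicator A x))\<^sup>2 = (cmod c)\<^sup>2 * indicat_real A x" for x
    by (simp add: norm_mult power_mult_distrib indicator_def)
  have "integrable lborel (\<lambda>x. (cmod (c * indicator A x))\<^sup>2)"
    unfolding eq using assms by (intro integrable_mult_right integrable_real_indicator) auto
  then show ?thesis by (simp add: square_integrable_def)
qed

lemma box_union_measurable [measurable]: "box_union bs \<in> sets borel"
  unfolding box_union_def by (intro sets.finite_UN) auto

lemma emeasure_box_union: "emeasure lborel (box_union bs) < \<infinity>"
proof -
  have "emeasure lborel (box_union bs)
      \<le> (\<Sum>p\<in>set bs. emeasure lborel {real_of_rat (fst p)<..<of_rat (snd p)})"
    unfolding box_union_def case_prod_beta by (rule emeasure_subadditive_finite) auto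
  also have "\<dots> < \<infinity>"
    using emeasure_lborel_box_finite[where 'a = real] by (simp add: less_top)
  finally show ?thesis .
qed

lemma box_union_in_closure:
  "abs_L2 (\<lambda>x. c * indicator (box_union bs) x) \<in> closure rat_steps"
proof -
  have ex: "\<exists>q. \<bar>of_rat q - y\<bar> < 1 / real (Suc n)" for y :: real and n
  proof -
    obtain q where "y < of_rat q" "of_rat q < y + 1 / real (Suc n)"
      using of_rat_dense[of y "y + 1 / real (Suc n)"] by auto
    then show ?thesis by (intro exI[of _ q]) auto
  qed
  have "\<exists>Q. (\<lambda>n. real_of_rat (Q n)) \<longlonglongrightarrow> y" for y
  proof -
    obtain Q where Q: "\<And>n. \<bar>real_of_rat (Q n) - y\<bar> < 1 / real (Suc n)" using ex by metis
    have "(\<lambda>n. real_of_rat (Q n) - y) \<longlonglongrightarrow> 0"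
      by (rule Lim_null_comparison[OF always_eventually LIMSEQ_Suc[OF lim_1_over_n]])
         (use Q in \<open>simp add: less_imp_le\<close>)
    then show ?thesis by (intro exI[of _ Q]) (rule LIM_zero_cancel)
  qed
  then obtain P Q where P: "(\<lambda>n. real_of_rat (P n)) \<longlonglongrightarrow> Re c" and Q: "(\<lambda>n. real_of_rat (Q n)) \<longlonglongrightarrow> Im c"
    by metis
  let ?c = "\<lambda>n. Complex (of_rat (P n)) (of_rat (Q n))"
  have c: "?c \<longlonglongrightarrow> c"
    using tendsto_Complex[OF P Q] by simp
  then obtain K where K: "\<And>n. cmod (?c n) \<le> K"
    using convergent_imp_Bseq[OF convergentI[OF c]] unfolding Bseq_def by blast
  show ?thesis
  proof (rule limit_in_closure_rat_steps)
    show "abs_L2 (\<lambda>x. ?c n * indicator (box_union bs) x) \<in> closure rat_steps" for n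
      using rat_step_in[of "((P n, Q n), bs)"] closure_subset by (auto simp: rat_step_def)
    show "(\<lambda>n. abs_L2 (\<lambda>x. ?c n * indicator (box_union bs) x))
        \<longlonglongrightarrow> abs_L2 (\<lambda>x. c * indicator (box_union bs) x)"
    proof (rule L2_dominated_tendsto(2)[where c = K])
      show "square_integrable (\<lambda>x. 1 * indicator (box_union bs) x)"
        by (rule square_integrable_indicator[OF box_union_measurable emeasure_box_union])
      show "cmod (?c n * indicator (box_union bs) x) \<le> K * cmod (1 * indicator (box_union bs) x)"
        for n x using K[of n] by (auto simp: indicator_def)
      show "(\<lambda>n. ?c n * indicator (box_union bs) x) \<longlonglongrightarrow> c * indicator (box_union bs) x" for x
        by (intro tendsto_intros c)
    qed measurable
  qed
qed

lemma open_in_closure: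
  assumes U: "open U" "emeasure lborel U < \<infinity>"
  shows "abs_L2 (\<lambda>x. c * indicator U x) \<in> closure rat_steps"
proof -
  define W where "W n = box_union
    (filter (\<lambda>p. {real_of_rat (fst p)<..<of_rat (snd p)} \<subseteq> U) (map from_nat [0..<n]))" for n
  have W_sub: "W n \<subseteq> U" for n by (auto simp: W_def box_union_def subset_iff)
  have W_ev: "\<forall>\<^sub>F n in sequentially. x \<in> W n" if x: "x \<in> U" for x
  proof -
    obtain e where e: "e > 0" "\<And>y. dist y x < e \<Longrightarrow> y \<in> U"
      using U(1) x by (auto simp: open_dist)
    obtain a where a: "x - e < of_rat a" "of_rat a < x" using of_rat_dense[of "x - e" x] e by auto
    obtain b where b: "x < of_rat b" "of_rat b < x + e" using of_rat_dense[of x "x + e"] e by auto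
    have sub: "{real_of_rat a<..<of_rat b} \<subseteq> U"
      using a b by (auto intro!: e(2) simp: dist_real_def)
    have "x \<in> W n" if n: "n \<ge> Suc (to_nat (a, b))" for n
    proof -
      have "(a, b) \<in> set (map from_nat [0..<n])"
        using n by (auto intro!: image_eqI[of _ _ "to_nat (a, b)"])
      then show ?thesis using sub a b unfolding W_def box_union_def
        by (intro UN_I[of "(a, b)"]) auto
    qed
    then show ?thesis unfolding eventually_sequentially by blast
  qed
  have [measurable]: "U \<in> sets borel" using U by auto
  have [measurable]: "W n \<in> sets borel" for n by (simp add: W_def)
  show ?thesis
  proof (rule limit_in_closure_rat_steps)
    show "abs_L2 (\<lambda>x. c * indicator (W n) x) \<in> closure rat_steps" for n
      unfolding W_def by (rule box_union_in_closure)
    show "(\<lambda>n. abs_L2 (\<lambda>x. c * indicator (W n) x)) \<longlonglongrightarrow> abs_L2 (\<lambda>x. c * indicator U x)"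
    proof (rule L2_dominated_tendsto(2)[where c = 1])
      show "square_integrable (\<lambda>x. c * indicator U x)"
        using U by (intro square_integrable_indicator) auto
      show "cmod (c * indicator (W n) x) \<le> 1 * cmod (c * indicator U x)" for n x
        using W_sub[of n] by (auto simp: indicator_def)
      show "(\<lambda>n. c * indicator (W n) x) \<longlonglongrightarrow> c * indicator U x" for x
      proof (cases "x \<in> U")
        case True
        show ?thesis
          by (rule tendsto_eventually, use W_ev[OF True] in eventually_elim) (simp add: True)
      next
        case False
        then have "x \<notin> W n" for n using W_sub by blast
        then show ?thesis using False by simp
      qed
    qed measurable
  qed
qed

lemma finite_measure_in_closure:
  assumes A [measurable]: "A \<in> sets borel" and fin: "emeasure lborel A < \<infinity>"
  shows "abs_L2 (\<lambda>x. c * indicator A x) \<in> closure rat_steps"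
proof -
  have "\<exists>U. open U \<and> A \<subseteq> U \<and> emeasure lborel (U - A) < ennreal (1 / real (Suc n))" for n
    using outer_regular_lborel[of A "1 / real (Suc n)"] by auto
  then obtain U where U: "\<And>n. open (U n)" "\<And>n. A \<subseteq> U n"
    "\<And>n. emeasure lborel (U n - A) < ennreal (1 / real (Suc n))"
    by metis
  have [measurable]: "U n \<in> sets borel" for n using U(1) by auto
  have finU: "emeasure lborel (U n) < \<infinity>" for n
  proof -
    have "emeasure lborel (U n) \<le> emeasure lborel A + emeasure lborel (U n - A)"
      using emeasure_subadditive[of A lborel "U n - A"] U(2)[of n] by (simp add: Un_absorb1)
    also have "\<dots> < \<infinity>" using fin U(3)[of n] by (auto intro: less_trans)
    finally show ?thesis .
  qed
  show ?thesis
  proof (rule limit_in_closure_rat_steps)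
    show "abs_L2 (\<lambda>x. c * indicator (U n) x) \<in> closure rat_steps" for n
      by (intro open_in_closure U finU)
    have "(dist (abs_L2 (\<lambda>x. c * indicator (U n) x)) (abs_L2 (\<lambda>x. c * indicator A x)))\<^sup>2
        \<le> (cmod c)\<^sup>2 * (1 / real (Suc n))" for n
    proof -
      have eq: "(cmod (c * indicator (U n) x - c * indicator A x))\<^sup>2
          = (cmod c)\<^sup>2 * indicat_real (U n - A) x" for x
        using U(2)[of n] by (auto simp: indicator_def)
      have "(dist (abs_L2 (\<lambda>x. c * indicator (U n) x)) (abs_L2 (\<lambda>x. c * indicator A x)))\<^sup>2
        = (cmod c)\<^sup>2 * measure lborel (U n - A)"
        using fin finU by (subst dist_abs_L2_sq) (auto simp: square_integrable_indicator eq)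
      also have "measure lborel (U n - A) \<le> 1 / real (Suc n)"
        unfolding measure_def using U(3)[of n]
        by (intro enn2real_leI) (auto intro: less_imp_le)
      finally show ?thesis by (simp add: mult_left_mono)
    qed
    note le = this
    have "(\<lambda>n. (cmod c)\<^sup>2 * (1 / real (Suc n))) \<longlonglongrightarrow> (cmod c)\<^sup>2 * 0"
      by (intro tendsto_mult tendsto_const LIMSEQ_Suc[OF lim_1_over_n])
    then have lim: "(\<lambda>n. (cmod c)\<^sup>2 * (1 / real (Suc n))) \<longlonglongrightarrow> 0" by simp
    have "(\<lambda>n. (dist (abs_L2 (\<lambda>x. c * indicator (U n) x)) (abs_L2 (\<lambda>x. c * indicator A x)))\<^sup>2) \<longlonglongrightarrow> 0"
      by (rule tendsto_sandwich[OF _ _ tendsto_const lim]) (use le in auto)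
    then have "(\<lambda>n. sqrt ((dist (abs_L2 (\<lambda>x. c * indicator (U n) x)) (abs_L2 (\<lambda>x. c * indicator A x)))\<^sup>2)) \<longlonglongrightarrow> sqrt 0"
      by (rule tendsto_real_sqrt)
    then show "(\<lambda>n. abs_L2 (\<lambda>x. c * indicator (U n) x)) \<longlonglongrightarrow> abs_L2 (\<lambda>x. c * indicator A x)"
      by (subst tendsto_dist_iff) simp
  qed
qed

lemma abs_L2_sum:
  assumes "finite Y" "\<And>y. y \<in> Y \<Longrightarrow> square_integrable (g y)"
  shows "square_integrable (\<lambda>x. \<Sum>y\<in>Y. g y x) \<and> abs_L2 (\<lambda>x. \<Sum>y\<in>Y. g y x) = (\<Sum>y\<in>Y. abs_L2 (g y))"
  using assms
proof (induction Y rule: finite_induct)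
  case empty
  then show ?case by (simp add: zero_L2_def)
next
  case (insert y Y)
  then show ?case by (auto simp: square_integrable_add abs_L2_add[symmetric])
qed

lemma simple_in_closure:
  assumes s: "simple_function lborel s" "square_integrable s"
  shows "abs_L2 s \<in> closure rat_steps"
proof -
  define Y where "Y = s ` UNIV - {0}"
  have [measurable]: "s \<in> borel_measurable borel" using s(2) by (simp add: square_integrable_def)
  have Y: "finite Y" using s(1) by (simp add: simple_function_def Y_def)
  have lev [measurable]: "s -` {y} \<in> sets borel" for y
    using measurable_sets_borel[of s borel "{y}"] by simp
  have fin: "emeasure lborel (s -` {y}) < \<infinity>" if "y \<in> Y" for y
  proof -
    have y: "cmod y > 0" using that by (auto simp: Y_def)
    have "integrable lborel (\<lambda>x. (cmod y)\<^sup>2 * indicat_real (s -` {y}) x)"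
    proof (rule Bochner_Integration.integrable_bound)
      show "integrable lborel (\<lambda>x. (cmod (s x))\<^sup>2)" using s(2) by (simp add: square_integrable_def)
      show "AE x in lborel. norm ((cmod y)\<^sup>2 * indicat_real (s -` {y}) x) \<le> norm ((cmod (s x))\<^sup>2)"
        by (auto simp: indicator_def)
    qed measurable
    then have "integrable lborel (indicat_real (s -` {y}))"
      using y by (auto simp: integrable_mult_right_iff)
    then show ?thesis by (simp add: integrable_indicator_iff)
  qed
  have "s = (\<lambda>x. \<Sum>y\<in>Y. y * indicator (s -` {y}) x)"
  proof
    fix x
    show "s x = (\<Sum>y\<in>Y. y * indicator (s -` {y}) x)"
    proof (cases "s x = 0")
      case True
      then show ?thesis by (auto simp: Y_def indicator_def intro!: sum.neutral[symmetric])
    next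
      case False
      then have "s x \<in> Y" by (simp add: Y_def)
      then have "(\<Sum>y\<in>Y. y * indicator (s -` {y}) x) = (\<Sum>y\<in>{s x}. y * indicator (s -` {y}) x)"
        using Y by (intro sum.mono_neutral_right) (auto simp: indicator_def)
      then show ?thesis by simp
    qed
  qed
  then have "abs_L2 s = abs_L2 (\<lambda>x. \<Sum>y\<in>Y. y * indicator (s -` {y}) x)" by simp
  also have "\<dots> = (\<Sum>y\<in>Y. abs_L2 (\<lambda>x. y * indicator (s -` {y}) x))"
    using abs_L2_sum[OF Y, of "\<lambda>y x. y * indicator (s -` {y}) x"]
      square_integrable_indicator[OF lev fin] by blast
  also have "\<dots> \<in> closure rat_steps"
    by (intro sum_in_closure_rat_steps Y finite_measure_in_closure fin lev)
  finally show ?thesis .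
qed

lemma closure_rat_steps: "closure rat_steps = UNIV"
proof (intro set_eqI iffI UNIV_I)
  fix f :: L2
  have "rep_L2 f \<in> borel_measurable lborel" by simp
  from borel_measurable_implies_sequence_metric[OF this, of 0]
  obtain S where S: "\<And>i. simple_function lborel (S i)" "\<And>x. (\<lambda>i. S i x) \<longlonglongrightarrow> rep_L2 f x"
    "\<And>i x. cmod (S i x) \<le> 2 * cmod (rep_L2 f x)"
    by auto
  have [measurable]: "S i \<in> borel_measurable borel" for i
    using borel_measurable_simple_function[OF S(1)] by simp
  have sq: "square_integrable (S i)" for i
    by (rule square_integrable_bound[OF square_integrable_rep[of f] _ S(3)]) measurable
  have "(\<lambda>i. abs_L2 (S i)) \<longlonglongrightarrow> abs_L2 (rep_L2 f)"
    by (rule L2_dominated_tendsto(2)[OF square_integrable_rep[of f] _ _ S(3) S(2)]) measurable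
  then show "f \<in> closure rat_steps"
    by (intro limit_in_closure_rat_steps[OF simple_in_closure[OF S(1) sq]]) simp
qed

instance L2 :: second_countable_topology
proof
  let ?B = "(\<lambda>(f, n). ball f (1 / real (Suc n))) ` (rat_steps \<times> (UNIV :: nat set))"
  have "topological_basis ?B"
  proof (rule topological_basisI)
    fix B assume "B \<in> ?B"
    then show "open B" by auto
  next
    fix U :: "L2 set" and f assume U: "open U" "f \<in> U"
    then obtain e where e: "e > 0" "ball f e \<subseteq> U" by (meson openE)
    obtain n where n: "1 / real (Suc n) < e / 2"
      using e(1) nat_approx_posE[of "e/2"] by auto
    have "f \<in> closure rat_steps" by (simp add: closure_rat_steps)
    then obtain g where g: "g \<in> rat_steps" "dist g f < 1 / real (Suc n)"
      by (metis closure_approachable of_nat_0_less_iff zero_less_Suc zero_less_divide_1_iff)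
    have "ball g (1 / real (Suc n)) \<subseteq> ball f e"
    proof
      fix x assume "x \<in> ball g (1 / real (Suc n))"
      then have "dist g x < 1 / real (Suc n)" by simp
      moreover have "dist f x \<le> dist g f + dist g x" by (metis dist_commute dist_triangle)
      ultimately show "x \<in> ball f e" using g(2) n by simp
    qed
    then show "\<exists>B'\<in>?B. f \<in> B' \<and> B' \<subseteq> U"
      using e(2) g by (intro bexI[of _ "ball g (1 / real (Suc n))"]) (auto simp: dist_commute)
  qed
  moreover have "countable ?B"
    by (intro countable_image countable_SIGMA countable_rat_steps countableI_type)
  ultimately show "\<exists>B :: L2 set set. countable B \<and> open = generate_topology B"
    using topological_basis_imp_subbasis by blast
qed

subsection \<open>Operations on \<open>L\<^sup>2(\<real>)\<close>\<close>

lift_definition scaleC_L2 :: "complex \<Rightarrow> L2 \<Rightarrow> L2" is "\<lambda>c f x. c * f x"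
  by (auto simp: L2_rel_def square_integrable_cmult)

text \<open>The class of \<open>f\<close>; outside the square integrable functions the value \<open>0\<close> is a dummy.\<close>

definition to_L2 :: "(real \<Rightarrow> complex) \<Rightarrow> L2" where
  "to_L2 f = (if square_integrable f then abs_L2 f else 0)"

text \<open>The unitary Fourier--Plancherel transform and its inverse, as \<open>L\<^sup>2\<close>-limits of the transforms
  of the truncated functions.\<close>

definition fourier_L2 :: "L2 \<Rightarrow> L2" where
  "fourier_L2 f = lim (\<lambda>n::nat. to_L2 (\<lambda>\<xi>.
     1 / sqrt (2 * pi) * (LINT x:{- real n..real n}|lborel. cis (- (\<xi> * x)) * rep_L2 f x)))"

definition inverse_fourier_L2 :: "L2 \<Rightarrow> L2" where
  "inverse_fourier_L2 g = lim (\<lambda>n::nat. to_L2 (\<lambda>x.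
     1 / sqrt (2 * pi) * (LINT \<xi>:{- real n..real n}|lborel. cis (\<xi> * x) * rep_L2 g \<xi>)))"


section \<open>The averaged equation\<close>

text \<open>\<open>T\<^sub>r = e\<^bsup>ir\<partial>\<^sub>x\<^sup>2\<^esup>\<close> is the Fourier multiplier with symbol \<open>e\<^bsup>-ir\<xi>\<^sup>2\<^esup>\<close>.\<close>

definition free_schroedinger :: "real \<Rightarrow> L2 \<Rightarrow> L2" where
  "free_schroedinger r f =
     inverse_fourier_L2 (to_L2 (\<lambda>\<xi>. cis (- (r * \<xi>\<^sup>2)) * rep_L2 (fourier_L2 f) \<xi>))"

text \<open>\<open>Q(f) = \<integral> T\<^sub>r\<^sup>-\<^sup>1(P(T\<^sub>r f)) \<psi>(r) dr\<close>, a Bochner integral in \<open>L\<^sup>2(\<real>)\<close>. For \<open>f \<in> L\<^sup>2(\<real>)\<close> the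
  function \<open>P(T\<^sub>r f)\<close> need be square integrable only for almost every \<open>r\<close>.\<close>

definition averaged_nonlinearity ::
    "(complex \<Rightarrow> complex) \<Rightarrow> (real \<Rightarrow> real) \<Rightarrow> L2 \<Rightarrow> L2" where
  "averaged_nonlinearity P \<psi> f =
     (LINT r|lborel. \<psi> r *\<^sub>R
        inv (free_schroedinger r) (to_L2 (\<lambda>x. P (rep_L2 (free_schroedinger r f) x))))"

text \<open>Strong solutions of \<open>i \<partial>\<^sub>t u + Q(u) = 0\<close> on \<open>[-M1, M2]\<close>; values of \<open>u\<close> outside this interval
  are irrelevant.\<close>

definition strong_solution ::
    "(L2 \<Rightarrow> L2) \<Rightarrow> real \<Rightarrow> real \<Rightarrow> L2 \<Rightarrow> (real \<Rightarrow> L2) \<Rightarrow> bool" where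
  "strong_solution Q M1 M2 u0 u \<longleftrightarrow>
     continuous_on {- M1..M2} u \<and>
     (\<exists>u'. continuous_on {- M1<..<M2} u' \<and>
        (\<forall>t\<in>{- M1<..<M2}. (u has_vector_derivative u' t) (at t) \<and>
           scaleC_L2 \<i> (u' t) + Q (u t) = 0)) \<and>
     u 0 = u0"

text \<open>\<open>S\<close> is the solution map \<open>\<phi> \<mapsto> u\<close>; its continuity from \<open>B = ball c \<rho>\<close> into the space
  \<open>C([-M1, M2], L\<^sup>2)\<close> with the supremum norm is uniform convergence on \<open>[-M1, M2]\<close>.\<close>

definition well_posed_near :: "(L2 \<Rightarrow> L2) \<Rightarrow> real \<Rightarrow> real \<Rightarrow> L2 \<Rightarrow> bool" where
  "well_posed_near Q M1 M2 u0 \<longleftrightarrow>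
     (\<exists>c \<rho>. u0 \<in> ball c \<rho> \<and>
       (\<exists>S. (\<forall>\<phi>\<in>ball c \<rho>. strong_solution Q M1 M2 \<phi> (S \<phi>) \<and>
               (\<forall>v. strong_solution Q M1 M2 \<phi> v \<longrightarrow> (\<forall>t\<in>{- M1..M2}. v t = S \<phi> t))) \<and>
            (\<forall>\<phi>\<in>ball c \<rho>. uniform_limit {- M1..M2} S (S \<phi>) (at \<phi> within ball c \<rho>))))"

definition locally_well_posed :: "(L2 \<Rightarrow> L2) \<Rightarrow> bool" where
  "locally_well_posed Q \<longleftrightarrow> (\<forall>u0. \<exists>M1>0. \<exists>M2>0. well_posed_near Q M1 M2 u0)"

definition globally_well_posed :: "(L2 \<Rightarrow> L2) \<Rightarrow> bool" where
  "globally_well_posed Q \<longleftrightarrow> (\<forall>u0. \<forall>M1>0. \<forall>M2>0. well_posed_near Q M1 M2 u0)"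

definition in_Lp :: "ennreal \<Rightarrow> (real \<Rightarrow> real) \<Rightarrow> bool" where
  "in_Lp q f \<longleftrightarrow> f \<in> borel_measurable lborel \<and>
     (if q = \<infinity> then \<exists>K. AE x in lborel. \<bar>f x\<bar> \<le> K
      else integrable lborel (\<lambda>x. \<bar>f x\<bar> powr enn2real q))"

end

(*
The nonlinear term is only borderline integrable for p = 4, and the estimate that makes it so is
the endpoint Strichartz bound  int sup_x |T_r f(x)|^4 dr <= C |f|^4  in one dimension.  It follows
from the TT* argument, the kernel bound |r|^(-1/2), and fractional integration of order 1/2 from
L^(4/3) to L^4.  By Young's inequality psi(r) |P(z) - P(w)| is at most
(A(r) + K (|z|^4 + |w|^4)) |z - w| with A integrable, so Q is Lipschitz on bounded sets of L^2.
Since P(z) is a real multiple of z, Q(f) is orthogonal to i f; hence the flow preserves the norm,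
cutting Q off outside a ball does not change the solution, and the cut-off field is globally
Lipschitz.
*)
theory Submission
  imports Defs "HOL-Probability.Characteristic_Functions" "HOL-Probability.Essential_Supremum"
begin

text \<open>Elements of L^2 are classes, so a supremum over x needs an essential supremum or a
  continuous representative. The Strichartz bound is first proved for data with integrable frequency
  profile, where T_r f is an absolutely convergent integral, continuous in x. The supremum over
  rational x is then reached by measurable selections x = X(r), and TT* is applied to the scalar map
  f |-> T_r f(X(r)). The kernel bound does not see X, so the constant is the same for all
  selections. General data follow by lower semicontinuity of the essential supremum under L^2
  convergence and Fatou. A second obstacle is that the Bochner integral Q needs r |-> T_r^(-1) P(T_r
  f) to be measurable although P(T_r f) lies in L^2 only for almost every r. Truncations of P, which
  act as Lipschitz maps on L^2, provide this. Oscillatory integrals over all frequencies are handled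
  with a Gaussian weight, which is removed only at the end, by monotone convergence in Plancherel
  and by Fatou in Strichartz.\<close>

lemma abs_L2_eqI:
  assumes "square_integrable f" "square_integrable g" "AE x in lborel. f x = g x"
  shows "abs_L2 f = abs_L2 g"
proof (rule L2_eqI)
  show "AE x in lborel. rep_L2 (abs_L2 f) x = rep_L2 (abs_L2 g) x"
    using rep_abs_L2[OF assms(1)] rep_abs_L2[OF assms(2)] assms(3) by eventually_elim simp
qed

lemma to_L2_abs: "square_integrable f \<Longrightarrow> to_L2 f = abs_L2 f"
  by (simp add: to_L2_def)

lemma integrable_cmod_sq: "square_integrable f \<Longrightarrow> integrable lborel (\<lambda>x. (cmod (f x))\<^sup>2)"
  by (simp add: square_integrable_def)

lemma inner_L2_abs:
  assumes "square_integrable f" "square_integrable g"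
  shows "inner (abs_L2 f) (abs_L2 g) = (\<integral>x. inner (f x) (g x) \<partial>lborel)"
  using assms by (intro inner_L2.abs_eq) (simp_all add: L2_rel_self)

lemma scaleC_L2_abs: "square_integrable f \<Longrightarrow> scaleC_L2 c (abs_L2 f) = abs_L2 (\<lambda>x. c * f x)"
  by (rule scaleC_L2.abs_eq) (simp add: L2_rel_self)

lemma L2_tendstoI_dist_sq:
  fixes X :: "nat \<Rightarrow> L2"
  assumes "(\<lambda>n. (dist (X n) f)\<^sup>2) \<longlonglongrightarrow> 0" shows "X \<longlonglongrightarrow> f"
proof -
  have "(\<lambda>n. sqrt ((dist (X n) f)\<^sup>2)) \<longlonglongrightarrow> sqrt 0"
    using assms by (rule tendsto_real_sqrt)
  then show ?thesis by (subst tendsto_dist_iff) simp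
qed

section \<open>Translations in \<open>L\<^sup>2\<close>\<close>

lemma AE_lborel_translate:
  assumes "AE x in lborel. P (x::real)"
  shows "AE x in lborel. P (z + x)"
proof -
  have "AE x in distr lborel borel ((+) z). P x"
    using assms by (subst lborel_distr_plus)
  then show ?thesis
    by (auto dest: AE_distrD[rotated])
qed

lemma square_integrable_translate:
  assumes "square_integrable f" shows "square_integrable (\<lambda>x. f (z + x))"
  using lborel_integrable_real_affine[of "\<lambda>x. (cmod (f x))\<^sup>2" 1 z] assms
  by (auto simp: square_integrable_def)

definition translate_L2 :: "real \<Rightarrow> L2 \<Rightarrow> L2" where
  "translate_L2 z f = abs_L2 (\<lambda>x. rep_L2 f (z + x))"

lemma translate_L2_abs:
  assumes "square_integrable f"
  shows "translate_L2 z (abs_L2 f) = abs_L2 (\<lambda>x. f (z + x))"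
  unfolding translate_L2_def
  by (intro abs_L2_eqI square_integrable_translate assms square_integrable_rep
      AE_lborel_translate rep_abs_L2)

lemma translate_L2_add: "translate_L2 z (f + g) = translate_L2 z f + translate_L2 z g"
  using translate_L2_abs[of "\<lambda>x. rep_L2 f x + rep_L2 g x" z]
  by (simp add: translate_L2_def abs_L2_add square_integrable_translate square_integrable_add
      flip: abs_L2_add)

lemma translate_L2_0: "translate_L2 z 0 = 0"
  using translate_L2_abs[of "\<lambda>x. 0" z] by (simp add: zero_L2_def)

lemma dist_translate_L2: "dist (translate_L2 z f) (translate_L2 z g) = dist f g"
proof -
  have "(dist (translate_L2 z f) (translate_L2 z g))\<^sup>2 = (dist f g)\<^sup>2"
    using dist_abs_L2_sq[of "rep_L2 f" "rep_L2 g"]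
      lborel_integral_real_affine[of 1 "\<lambda>x. (cmod (rep_L2 f x - rep_L2 g x))\<^sup>2" z]
    by (simp add: translate_L2_def dist_abs_L2_sq square_integrable_translate)
  then show ?thesis by simp
qed

text \<open>Away from the finitely many endpoints, membership in each open interval is locally
  constant, so the indicator at \<open>z n + x\<close> eventually agrees with the one at
  \<open>x\<close>.\<close>

lemma AE_indicator_box_union_translate:
  assumes "z \<longlonglongrightarrow> 0"
  shows "AE x in lborel. (\<lambda>n. indicat_real (box_union bs) (z n + x)) \<longlonglongrightarrow> indicator (box_union bs) x"
proof -
  let ?E = "(real_of_rat \<circ> fst) ` set bs \<union> (real_of_rat \<circ> snd) ` set bs"
  have "AE x in lborel. x \<notin> ?E"
    by (intro AE_not_in finite_imp_null_set_lborel) auto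
  then show ?thesis
  proof eventually_elim
    fix x assume x: "x \<notin> ?E"
    have zx: "(\<lambda>n. z n + x) \<longlonglongrightarrow> x" using tendsto_add[OF assms tendsto_const[of x]] by simp
    have ev: "\<forall>\<^sub>F n in sequentially. (z n + x \<in> {real_of_rat a<..<of_rat b}) =
        (x \<in> {real_of_rat a<..<of_rat b})" if "(a, b) \<in> set bs" for a b
    proof -
      have ne: "x \<noteq> of_rat a" "x \<noteq> of_rat b" using x that by force+
      have "\<forall>\<^sub>F n in sequentially. (real_of_rat a < z n + x) = (of_rat a < x)"
      proof (cases "of_rat a < x")
        case True
        then show ?thesis by (intro eventually_mono[OF order_tendstoD(1)[OF zx True]]) (use True in simp)
      next
        case False
        then have "x < of_rat a" using ne by simp
        from order_tendstoD(2)[OF zx this] show ?thesis by (rule eventually_mono) (use False in simp)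
      qed
      moreover have "\<forall>\<^sub>F n in sequentially. (z n + x < of_rat b) = (x < of_rat b)"
      proof (cases "x < of_rat b")
        case True
        then show ?thesis by (intro eventually_mono[OF order_tendstoD(2)[OF zx True]]) (use True in simp)
      next
        case False
        then have "of_rat b < x" using ne by simp
        from order_tendstoD(1)[OF zx this] show ?thesis by (rule eventually_mono) (use False in simp)
      qed
      ultimately show ?thesis by eventually_elim simp
    qed
    have "\<forall>\<^sub>F n in sequentially. \<forall>p\<in>set bs. (z n + x \<in> {real_of_rat (fst p)<..<of_rat (snd p)}) =
        (x \<in> {real_of_rat (fst p)<..<of_rat (snd p)})"
      by (intro eventually_ball_finite ballI finite_set ev) simp
    then have "\<forall>\<^sub>F n in sequentially. indicat_real (box_union bs) (z n + x) = indicator (box_union bs) x"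
      by eventually_elim (auto simp: box_union_def indicator_def case_prod_beta)
    then show "(\<lambda>n. indicat_real (box_union bs) (z n + x)) \<longlonglongrightarrow> indicator (box_union bs) x"
      by (rule tendsto_eventually)
  qed
qed

lemma box_union_bounded: "\<exists>R. \<forall>x\<in>box_union bs. \<bar>x\<bar> \<le> R"
proof -
  have "bounded (box_union bs)"
    unfolding box_union_def by (intro bounded_UN) (auto intro: bounded_subset[OF bounded_closed_interval])
  then show ?thesis by (auto simp: bounded_real)
qed

lemma translate_rat_step_tendsto:
  assumes z: "z \<longlonglongrightarrow> 0"
  shows "(\<lambda>n. translate_L2 (z n) (rat_step p)) \<longlonglongrightarrow> rat_step p"
proof -
  obtain a b bs where p: "p = ((a, b), bs)" by (metis prod.exhaust)
  define c where "c = Complex (of_rat a) (of_rat b)"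
  define I where "I = indicat_real (box_union bs)"
  have [measurable]: "I \<in> borel_measurable borel" by (simp add: I_def)
  have cI: "c * indicator (box_union bs) x = c * of_real (I x)" for x
    by (simp add: I_def indicator_def)
  have sq: "square_integrable (\<lambda>x. c * of_real (I x))"
    using square_integrable_indicator[OF box_union_measurable emeasure_box_union, of c bs]
    by (simp add: cI)
  have rs: "rat_step p = abs_L2 (\<lambda>x. c * of_real (I x))"
    by (simp add: rat_step_def p c_def[symmetric] cI)
  obtain K where K: "\<And>n. \<bar>z n\<bar> \<le> K"
    using convergent_imp_Bseq[OF convergentI[OF z]] unfolding Bseq_def by auto
  obtain R where R: "\<And>x. x \<in> box_union bs \<Longrightarrow> \<bar>x\<bar> \<le> R" using box_union_bounded by blast
  have "(\<lambda>n. \<integral>x. (cmod (c * of_real (I (z n + x)) - c * of_real (I x)))\<^sup>2 \<partial>lborel)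
      \<longlonglongrightarrow> (integral\<^sup>L lborel (\<lambda>x::real. 0))"
  proof (rule integral_dominated_convergence
      [where w = "\<lambda>x. (cmod c)\<^sup>2 * indicator {- (R + K)..R + K} x"])
    show "integrable lborel (\<lambda>x. (cmod c)\<^sup>2 * indicat_real {- (R + K)..R + K} x)"
          by (intro integrable_mult_right integrable_real_indicator)
        (auto simp: emeasure_lborel_Icc_eq)
    show "AE x in lborel. (\<lambda>n. (cmod (c * of_real (I (z n + x)) - c * of_real (I x)))\<^sup>2) \<longlonglongrightarrow> 0"
      using AE_indicator_box_union_translate[OF z, of bs]
    proof eventually_elim
      case (elim x)
      have "(\<lambda>n. (cmod (c * of_real (I (z n + x)) - c * of_real (I x)))\<^sup>2) \<longlonglongrightarrow>
          (cmod (c * of_real (I x) - c * of_real (I x)))\<^sup>2"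
        using elim by (intro tendsto_intros) (simp add: I_def)
      then show ?case by simp
    qed
    show "AE x in lborel. norm ((cmod (c * of_real (I (z n + x)) - c * of_real (I x)))\<^sup>2)
        \<le> (cmod c)\<^sup>2 * indicator {- (R + K)..R + K} x" for n
    proof (rule AE_I2)
      fix x
      have eq: "cmod (c * of_real (I (z n + x)) - c * of_real (I x)) = cmod c * \<bar>I (z n + x) - I x\<bar>"
        by (simp add: norm_mult flip: right_diff_distrib of_real_diff)
      \<comment> \<open>\<open>R\<close> bounds the set and \<open>K\<close> bounds all shifts:
        outside the larger interval neither \<open>x\<close> nor \<open>z n + x\<close> can lie in
        the set.\<close>
      have "\<bar>I (z n + x) - I x\<bar> \<le> indicator {- (R + K)..R + K} x"
        using R[of x] R[of "z n + x"] K[of n] by (auto simp: I_def indicator_def)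
      then have "\<bar>I (z n + x) - I x\<bar>\<^sup>2 \<le> (indicator {- (R + K)..R + K} x)\<^sup>2"
        by (rule power_mono) simp
      then have "\<bar>I (z n + x) - I x\<bar>\<^sup>2 \<le> indicator {- (R + K)..R + K} x"
        by (auto simp: indicator_def)
      then show "norm ((cmod (c * of_real (I (z n + x)) - c * of_real (I x)))\<^sup>2)
          \<le> (cmod c)\<^sup>2 * indicator {- (R + K)..R + K} x"
        unfolding eq by (simp only: power_mult_distrib real_norm_def abs_mult abs_power2)
          (simp add: mult_left_mono)
    qed
  qed measurable
  then have "(\<lambda>n. (dist (translate_L2 (z n) (rat_step p)) (rat_step p))\<^sup>2) \<longlonglongrightarrow> 0"
    by (simp add: rs translate_L2_abs[OF sq] dist_abs_L2_sq sq square_integrable_translate[OF sq])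
  then show ?thesis by (rule L2_tendstoI_dist_sq)
qed

text \<open>Density argument: the rational step functions are dense, and translations are
  isometries, so the error of the approximation is not amplified. Plancherel uses this to let its
  Gaussian regularization shrink.\<close>

lemma translate_L2_tendsto:
  assumes z: "z \<longlonglongrightarrow> 0"
  shows "(\<lambda>n. translate_L2 (z n) f) \<longlonglongrightarrow> f"
proof (rule metric_LIMSEQ_I)
  fix e :: real assume e: "0 < e"
  have "f \<in> closure rat_steps" by (simp add: closure_rat_steps)
  then obtain g where g: "g \<in> rat_steps" "dist g f < e / 3"
    using e by (meson closure_approachable divide_pos_pos zero_less_numeral)
  from g(1) obtain xs where xs: "g = sum_list (map rat_step xs)" by (auto simp: rat_steps_def)
  have "(\<lambda>n. translate_L2 (z n) g) \<longlonglongrightarrow> g"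
    unfolding xs
    by (induction xs)
       (auto simp: translate_L2_add translate_L2_0 intro!: tendsto_add translate_rat_step_tendsto z)
  from metric_LIMSEQ_D[OF this, of "e/3"] e obtain N
    where N: "\<And>n. n \<ge> N \<Longrightarrow> dist (translate_L2 (z n) g) g < e / 3" by auto
  have "dist (translate_L2 (z n) f) f < e" if "n \<ge> N" for n
  proof -
    have "dist (translate_L2 (z n) f) f \<le> dist (translate_L2 (z n) f) (translate_L2 (z n) g)
        + dist (translate_L2 (z n) g) g + dist g f"
      by (metis (no_types, lifting) add.assoc add_left_mono dist_triangle order_trans)
    then show ?thesis using N[OF that] g(2) by (simp add: dist_translate_L2 dist_commute)
  qed
  then show "\<exists>N. \<forall>n\<ge>N. dist (translate_L2 (z n) f) f < e" by blast
qed

section \<open>Gaussian integrals\<close>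

text \<open>The characteristic function of the standard normal law, rescaled by
  \<open>s = sqrt (2 * a)\<close>. This is the only explicit transform on which the development
  relies.\<close>

lemma gaussian_fourier:
  assumes a: "0 < a"
  shows "integrable lborel (\<lambda>x. exp (- (a * x\<^sup>2)))"
    and "(LINT x|lborel. cis (t * x) * of_real (exp (- (a * x\<^sup>2))))
       = of_real (sqrt (pi / a) * exp (- (t\<^sup>2 / (4 * a))))"
proof -
  define s where "s = sqrt (2 * a)"
  have s: "s > 0" "s\<^sup>2 = 2 * a" using a by (simp_all add: s_def)
  have dens: "std_normal_density (s * x) = 1 / sqrt (2 * pi) * exp (- (a * x\<^sup>2))" for x
    using s(2) by (simp add: std_normal_density_def power_mult_distrib)
  have "integrable lborel (\<lambda>x. std_normal_density (0 + s * x))"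
    using s(1) by (intro lborel_integrable_real_affine) auto
  then show int: "integrable lborel (\<lambda>x. exp (- (a * x\<^sup>2)))"
    using integrable_mult_right[of "sqrt (2 * pi)" lborel "\<lambda>x. std_normal_density (0 + s * x)"]
    by (simp add: dens)
  have "of_real (exp (- ((t/s)\<^sup>2) / 2)) = char std_normal_distribution (t/s)"
    by (simp add: char_std_normal_distribution)
  also have "\<dots> = (LINT x|lborel. std_normal_density x *\<^sub>R iexp (t / s * x))"
    unfolding char_def by (subst integral_density) (auto simp: normal_density_nonneg)
  also have "\<dots> = s *\<^sub>R (LINT x|lborel. std_normal_density (s * x) *\<^sub>R iexp (t / s * (s * x)))"
    using s by (subst lborel_integral_real_affine[of s _ 0]) auto
  also have "(LINT x|lborel. std_normal_density (s * x) *\<^sub>R iexp (t / s * (s * x)))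
     = (LINT x|lborel. (1 / sqrt (2 * pi)) *\<^sub>R (cis (t * x) * of_real (exp (- (a * x\<^sup>2)))))"
    using s(1) by (intro Bochner_Integration.integral_cong)
      (auto simp: dens dens[unfolded mult.commute[of s]] cis_conv_exp scaleR_conv_of_real mult_ac)
  also have "\<dots> = (1 / sqrt (2 * pi)) *\<^sub>R (LINT x|lborel. cis (t * x) * of_real (exp (- (a * x\<^sup>2))))"
    by (rule integral_scaleR_right)
  finally have "(LINT x|lborel. cis (t * x) * of_real (exp (- (a * x\<^sup>2))))
     = (sqrt (2 * pi) / s) *\<^sub>R of_real (exp (- ((t/s)\<^sup>2) / 2))"
    using s by (simp add: field_simps)
  also have "(t/s)\<^sup>2 / 2 = t\<^sup>2 / (4 * a)" using s by (simp add: power_divide)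
  then have "- ((t/s)\<^sup>2) / 2 = - (t\<^sup>2 / (4 * a))" by linarith
  also have "sqrt (2 * pi) / s = sqrt (pi / a)"
    using a by (simp add: s_def flip: real_sqrt_divide)
  finally show "(LINT x|lborel. cis (t * x) * of_real (exp (- (a * x\<^sup>2))))
       = of_real (sqrt (pi / a) * exp (- (t\<^sup>2 / (4 * a))))"
    by (simp add: scaleR_conv_of_real)
qed

lemma gaussian_integral:
  assumes a: "0 < a" shows "(LINT x|lborel. exp (- (a * x\<^sup>2))) = sqrt (pi / a)"
proof -
  have "complex_of_real (LINT x|lborel. exp (- (a * x\<^sup>2))) = of_real (sqrt (pi / a))"
    using gaussian_fourier(2)[OF a, of 0] by (simp flip: integral_complex_of_real)
  then show ?thesis using of_real_eq_iff by blast
qed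

text \<open>A majorant that is a product of two integrable functions of one variable is the form in
  which most exchanges of integrals occur below.\<close>

lemma Fubini_bounded_by_product:
  fixes F :: "real \<Rightarrow> real \<Rightarrow> complex"
  assumes F [measurable]: "case_prod F \<in> borel_measurable (lborel \<Otimes>\<^sub>M lborel)"
    and a: "integrable lborel a" and b: "integrable lborel b"
    and le: "\<And>x y. cmod (F x y) \<le> a x * b y"
  shows "(LINT x|lborel. LINT y|lborel. F x y) = (LINT y|lborel. LINT x|lborel. F x y)"
    and "integrable lborel (\<lambda>x. LINT y|lborel. F x y)"
proof -
  have [measurable]: "a \<in> borel_measurable borel" "b \<in> borel_measurable borel" using a b by auto
  have "integrable (lborel \<Otimes>\<^sub>M lborel) (\<lambda>(x, y). a x * b y)"
  proof (rule lborel_pair.Fubini_integrable)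
    show "integrable lborel (\<lambda>x. LINT y|lborel. norm (case (x, y) of (x, y) \<Rightarrow> a x * b y))"
      using a b by (simp add: abs_mult)
  qed (use b in auto)
  then have int: "integrable (lborel \<Otimes>\<^sub>M lborel) (case_prod F)"
  proof (rule Bochner_Integration.integrable_bound)
    show "AE p in lborel \<Otimes>\<^sub>M lborel. norm (case_prod F p) \<le> norm (case p of (x, y) \<Rightarrow> a x * b y)"
      using order_trans[OF le abs_ge_self] by (intro AE_I2) (simp add: case_prod_beta)
  qed measurable
  then show "(LINT x|lborel. LINT y|lborel. F x y) = (LINT y|lborel. LINT x|lborel. F x y)"
    using lborel_pair.Fubini_integral[of F] by simp
  show "integrable lborel (\<lambda>x. LINT y|lborel. F x y)"
    using lborel_pair.integrable_fst[OF int] .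
qed

section \<open>Plancherel\<close>

lemma borel_measurable_cis [measurable (raw)]:
  "f \<in> borel_measurable M \<Longrightarrow> (\<lambda>x. cis (f x)) \<in> borel_measurable M"
  by (rule borel_measurable_continuous_on[where f = cis]) (auto intro!: continuous_intros)

lemma borel_measurable_cnj [measurable (raw)]:
  "f \<in> borel_measurable M \<Longrightarrow> (\<lambda>x. cnj (f x)) \<in> borel_measurable M"
  by (rule borel_measurable_continuous_on[where f = cnj]) (auto intro!: continuous_intros)

text \<open>The free phase lets one computation serve twice: a phase bilinear in x and \<xi> gives
  the Fourier integral for Plancherel, and \<open>X r * \<xi> - r * \<xi>\<^sup>2\<close> gives, up
  to conjugation and normalization, the adjoint map in the TT* argument.\<close>

definition oscillatory :: "(real \<Rightarrow> real \<Rightarrow> real) \<Rightarrow> (real \<Rightarrow> complex) \<Rightarrow> real \<Rightarrow> complex" where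
  "oscillatory \<theta> c \<xi> = (LINT r|lborel. c r * cis (\<theta> r \<xi>))"

lemma oscillatory_measurable [measurable]:
  assumes [measurable]: "c \<in> borel_measurable borel"
    "case_prod \<theta> \<in> borel_measurable (borel \<Otimes>\<^sub>M borel)"
  shows "oscillatory \<theta> c \<in> borel_measurable borel"
  unfolding oscillatory_def by measurable

lemma cmod_oscillatory_le: "cmod (oscillatory \<theta> c \<xi>) \<le> (LINT r|lborel. cmod (c r))"
  unfolding oscillatory_def
  by (rule order_trans[OF integral_norm_bound]) (simp add: norm_mult)

text \<open>Write the squared modulus as H times its conjugate and integrate over \<xi> first. The
  integrable weight makes every exchange absolutely convergent; what remains is a kernel in r and s
  depending only on the phase difference.\<close>

lemma weighted_oscillatory_norm:
  assumes c: "integrable lborel c"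
    and \<theta> [measurable]: "case_prod \<theta> \<in> borel_measurable (borel \<Otimes>\<^sub>M borel)"
    and w: "integrable lborel w" "\<And>\<xi>. 0 \<le> w \<xi>"
  shows "complex_of_real (LINT \<xi>|lborel. (cmod (oscillatory \<theta> c \<xi>))\<^sup>2 * w \<xi>) =
    (LINT r|lborel. c r * (LINT s|lborel. cnj (c s) *
       (LINT \<xi>|lborel. cis (\<theta> r \<xi> - \<theta> s \<xi>) * of_real (w \<xi>))))"
proof -
  let ?H = "oscillatory \<theta> c"
  define B where "B = (LINT r|lborel. cmod (c r))"
  have [measurable]: "c \<in> borel_measurable borel" "w \<in> borel_measurable borel" using c w by auto
  have sec [measurable]: "(\<lambda>\<xi>. \<theta> r \<xi>) \<in> borel_measurable borel" for r
    using measurable_compose[OF measurable_Pair1' \<theta>, of r] by simp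
  have "complex_of_real (LINT \<xi>|lborel. (cmod (?H \<xi>))\<^sup>2 * w \<xi>)
    = (LINT \<xi>|lborel. ?H \<xi> * cnj (?H \<xi>) * of_real (w \<xi>))"
    by (subst integral_complex_of_real[symmetric]) (simp add: complex_norm_square[symmetric])
  also have "\<dots> = (LINT \<xi>|lborel. LINT r|lborel. c r * cis (\<theta> r \<xi>) * (cnj (?H \<xi>) * of_real (w \<xi>)))"
  proof (intro Bochner_Integration.integral_cong refl)
    fix \<xi>
    have "(LINT r|lborel. c r * cis (\<theta> r \<xi>) * X) = ?H \<xi> * X" for X
      by (simp add: oscillatory_def)
    then show "?H \<xi> * cnj (?H \<xi>) * of_real (w \<xi>) =
        (LINT r|lborel. c r * cis (\<theta> r \<xi>) * (cnj (?H \<xi>) * of_real (w \<xi>)))"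
      by (simp only: mult.assoc)
  qed
  also have "\<dots> = (LINT r|lborel. LINT \<xi>|lborel. c r * cis (\<theta> r \<xi>) * (cnj (?H \<xi>) * of_real (w \<xi>)))"
  proof (rule Fubini_bounded_by_product(1)[symmetric])
    show "integrable lborel (\<lambda>r. cmod (c r))" "integrable lborel (\<lambda>\<xi>. B * w \<xi>)" using c w by auto
    show "cmod (c r * cis (\<theta> r \<xi>) * (cnj (?H \<xi>) * of_real (w \<xi>))) \<le> cmod (c r) * (B * w \<xi>)" for r \<xi>
      using w(2)[of \<xi>] cmod_oscillatory_le[of \<theta> c \<xi>]
      by (auto simp: norm_mult B_def intro!: mult_left_mono mult_right_mono)
  qed measurable
  also have "\<dots> = (LINT r|lborel. c r * (LINT \<xi>|lborel. cis (\<theta> r \<xi>) * (cnj (?H \<xi>) * of_real (w \<xi>))))"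
    by (simp only: mult.assoc integral_mult_right_zero)
  also have "\<dots> = (LINT r|lborel. c r * (LINT s|lborel. cnj (c s) *
       (LINT \<xi>|lborel. cis (\<theta> r \<xi> - \<theta> s \<xi>) * of_real (w \<xi>))))"
  proof (rule Bochner_Integration.integral_cong[OF refl], rule arg_cong[where f = "(*) _"])
    fix r
    have "(LINT \<xi>|lborel. cis (\<theta> r \<xi>) * (cnj (?H \<xi>) * of_real (w \<xi>)))
      = (LINT \<xi>|lborel. LINT s|lborel. (cis (\<theta> r \<xi>) * of_real (w \<xi>)) * cnj (c s * cis (\<theta> s \<xi>)))"
    proof (intro Bochner_Integration.integral_cong refl)
      fix \<xi>
      have "cnj (?H \<xi>) = (LINT s|lborel. cnj (c s * cis (\<theta> s \<xi>)))"
        unfolding oscillatory_def by (rule Bochner_Integration.integral_cnj[symmetric])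
      then show "cis (\<theta> r \<xi>) * (cnj (?H \<xi>) * of_real (w \<xi>)) =
          (LINT s|lborel. (cis (\<theta> r \<xi>) * of_real (w \<xi>)) * cnj (c s * cis (\<theta> s \<xi>)))"
        by (simp only: integral_mult_right_zero) (simp only: mult_ac)
    qed
    also have "\<dots> = (LINT s|lborel. LINT \<xi>|lborel. (cis (\<theta> r \<xi>) * of_real (w \<xi>)) * cnj (c s * cis (\<theta> s \<xi>)))"
    proof (rule Fubini_bounded_by_product(1))
      show "integrable lborel w" "integrable lborel (\<lambda>s. cmod (c s))" using c w by auto
      show "cmod ((cis (\<theta> r \<xi>) * of_real (w \<xi>)) * cnj (c s * cis (\<theta> s \<xi>))) \<le> w \<xi> * cmod (c s)" for \<xi> s
        using w(2)[of \<xi>] by (simp add: norm_mult)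
    qed measurable
    also have "\<dots> = (LINT s|lborel. LINT \<xi>|lborel. cnj (c s) * (cis (\<theta> r \<xi> - \<theta> s \<xi>) * of_real (w \<xi>)))"
    proof (intro Bochner_Integration.integral_cong refl)
      have cis_diff: "cis (a - b) = cis a * cnj (cis b)" for a b
        by (simp add: cis_cnj cis_mult)
      show "(cis (\<theta> r \<xi>) * of_real (w \<xi>)) * cnj (c s * cis (\<theta> s \<xi>))
        = cnj (c s) * (cis (\<theta> r \<xi> - \<theta> s \<xi>) * of_real (w \<xi>))" for \<xi> s
        unfolding cis_diff complex_cnj_mult by (simp only: mult_ac)
    qed
    finally show "(LINT \<xi>|lborel. cis (\<theta> r \<xi>) * (cnj (?H \<xi>) * of_real (w \<xi>)))
      = (LINT s|lborel. cnj (c s) * (LINT \<xi>|lborel. cis (\<theta> r \<xi> - \<theta> s \<xi>) * of_real (w \<xi>)))"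
      by simp
  qed
  finally show ?thesis .
qed

text \<open>The sign \<open>\<sigma>\<close> is kept as a parameter so that the transform (-1) and
  its inverse (+1) are treated together, under the hypothesis that \<sigma> squares to 1.\<close>

definition fourier_integral :: "real \<Rightarrow> (real \<Rightarrow> complex) \<Rightarrow> real \<Rightarrow> complex" where
  "fourier_integral \<sigma> g \<xi> = 1 / sqrt (2 * pi) * (LINT x|lborel. cis (\<sigma> * (\<xi> * x)) * g x)"

lemma fourier_integral_oscillatory:
  "fourier_integral \<sigma> g \<xi> = 1 / sqrt (2 * pi) * oscillatory (\<lambda>x \<xi>. \<sigma> * (\<xi> * x)) g \<xi>"
  by (simp add: fourier_integral_def oscillatory_def mult.commute)

lemma fourier_integral_measurable [measurable]:
  assumes [measurable]: "g \<in> borel_measurable borel"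
  shows "fourier_integral \<sigma> g \<in> borel_measurable borel"
  unfolding fourier_integral_def by measurable

text \<open>With this weight the kernel is 2 pi times the centred normal density of standard
  deviation \<delta> at y - x. The substitution y = x + \<delta> s takes \<delta> out of the density
  and into the translate, where strong continuity can act on it.\<close>

lemma gaussian_regularized_norm:
  assumes g: "integrable lborel g" "square_integrable g" and \<sigma>: "\<sigma>\<^sup>2 = 1" and \<delta>: "0 < \<delta>"
  defines "A \<equiv> \<lambda>s. std_normal_density s * inner (abs_L2 g) (translate_L2 (\<delta> * s) (abs_L2 g))"
  shows "(LINT \<xi>|lborel. (cmod (fourier_integral \<sigma> g \<xi>))\<^sup>2 * exp (- (\<delta>\<^sup>2 / 2 * \<xi>\<^sup>2))) = (LINT s|lborel. A s)"
    and "integrable lborel A"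
proof -
  let ?\<phi> = std_normal_density
  have [measurable]: "g \<in> borel_measurable borel" using g by auto
  define G where "G = (\<lambda>(s, x). complex_of_real (?\<phi> s) * (g x * cnj (g (\<delta> * s + x))))"
  have G_meas [measurable]: "G \<in> borel_measurable (lborel \<Otimes>\<^sub>M lborel)" unfolding G_def by measurable
  have sq: "integrable lborel (\<lambda>x. (cmod (g x))\<^sup>2)" using g(2) by (rule integrable_cmod_sq)
  have sqt: "integrable lborel (\<lambda>x. (cmod (g (z + x)))\<^sup>2)" for z
    using square_integrable_translate[OF g(2)] by (rule integrable_cmod_sq)
  have prod_le: "cmod (g x) * cmod (g (z + x)) \<le> (cmod (g x))\<^sup>2 + (cmod (g (z + x)))\<^sup>2" for x z
    using sum_squares_bound[of "cmod (g x)" "cmod (g (z + x))"]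
      mult_nonneg_nonneg[OF norm_ge_zero[of "g x"] norm_ge_zero[of "g (z + x)"]] by linarith
  have int_prod: "integrable lborel (\<lambda>x. g x * cnj (g (z + x)))" for z
    by (rule Bochner_Integration.integrable_bound[OF Bochner_Integration.integrable_add[OF sq sqt[of z]]])
       (use prod_le in \<open>auto simp: norm_mult\<close>)
  \<comment> \<open>A bound for the correlation integrals of |g| that does not depend on the shift:
    both squares in \<open>prod_le\<close> have the same integral.\<close>
  define N where "N = 2 * (LINT x|lborel. (cmod (g x))\<^sup>2)"
  have int_G: "integrable (lborel \<Otimes>\<^sub>M lborel) G"
  proof (rule lborel_pair.Fubini_integrable[OF G_meas])
    show "AE s in lborel. integrable lborel (\<lambda>x. G (s, x))"
      using int_prod by (auto simp: G_def)
    show "integrable lborel (\<lambda>s. LINT x|lborel. norm (G (s, x)))"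
    proof (rule Bochner_Integration.integrable_bound)
      show "integrable lborel (\<lambda>s. N * ?\<phi> s)" by auto
      show "AE s in lborel. norm (LINT x|lborel. norm (G (s, x))) \<le> norm (N * ?\<phi> s)"
      proof (rule AE_I2)
        fix s
        have "(LINT x|lborel. cmod (g x) * cmod (g (\<delta> * s + x)))
            \<le> (LINT x|lborel. (cmod (g x))\<^sup>2 + (cmod (g (\<delta> * s + x)))\<^sup>2)"
          using int_prod[of "\<delta> * s"] sq sqt prod_le
          by (intro integral_mono) (auto simp: norm_mult dest: integrable_norm)
        also have "\<dots> = N"
          using sq sqt lborel_integral_real_affine[of 1 "\<lambda>x. (cmod (g x))\<^sup>2" "\<delta> * s"] by (simp add: N_def)
        finally have "(LINT x|lborel. cmod (g x) * cmod (g (\<delta> * s + x))) \<le> N" .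
        then have "?\<phi> s * (LINT x|lborel. cmod (g x) * cmod (g (\<delta> * s + x))) \<le> ?\<phi> s * N"
          by (rule mult_left_mono) simp
        moreover have "(LINT x|lborel. norm (G (s, x))) = ?\<phi> s * (LINT x|lborel. cmod (g x) * cmod (g (\<delta> * s + x)))"
          by (simp add: G_def norm_mult)
        moreover have "0 \<le> (LINT x|lborel. norm (G (s, x)))"
          by (rule Bochner_Integration.integral_nonneg) simp
        ultimately show "norm (LINT x|lborel. norm (G (s, x))) \<le> norm (N * ?\<phi> s)"
          by (simp only: real_norm_def) (simp add: mult.commute)
      qed
    qed measurable
  qed
  have A_eq: "A s = Re (LINT x|lborel. G (s, x))" for s
  proof -
    have "inner (abs_L2 g) (translate_L2 (\<delta> * s) (abs_L2 g)) = (LINT x|lborel. inner (g x) (g (\<delta> * s + x)))"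
      by (simp add: translate_L2_abs g inner_L2_abs square_integrable_translate)
    also have "\<dots> = Re (LINT x|lborel. g x * cnj (g (\<delta> * s + x)))"
      using int_prod[of "\<delta> * s"] by (simp add: inner_complex_def flip: integral_Re)
    finally show ?thesis by (simp add: A_def G_def)
  qed
  have int_G': "integrable lborel (\<lambda>s. LINT x|lborel. G (s, x))"
    using lborel_pair.integrable_fst'[OF int_G] .
  then show "integrable lborel A" unfolding A_eq by simp
  define \<epsilon> where "\<epsilon> = \<delta>\<^sup>2 / 2"
  have \<epsilon>: "\<epsilon> > 0" using \<delta> by (simp add: \<epsilon>_def)
  have kernel: "(LINT \<xi>|lborel. cis (\<sigma> * (\<xi> * x) - \<sigma> * (\<xi> * y)) * of_real (exp (- (\<epsilon> * \<xi>\<^sup>2))))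
    = of_real (2 * pi / \<delta> * ?\<phi> ((y - x) / \<delta>))" for x y
  proof -
    have "(\<sigma> * (x - y))\<^sup>2 / (4 * \<epsilon>) = ((y - x) / \<delta>)\<^sup>2 / 2"
      using \<sigma> \<delta> by (simp add: \<epsilon>_def power_mult_distrib power_divide power2_commute)
    moreover have "sqrt (pi / \<epsilon>) = 2 * pi / \<delta> * (1 / sqrt (2 * pi))"
    proof -
      have "sqrt (pi / \<epsilon>) = sqrt (2 * pi) / \<delta>" using \<delta> by (simp add: \<epsilon>_def real_sqrt_divide real_sqrt_mult)
      also have "sqrt (2 * pi) = 2 * pi * (1 / sqrt (2 * pi))"
        using real_div_sqrt[of "2 * pi"] by simp
      finally show ?thesis by simp
    qed
    moreover have "cis (\<sigma> * (\<xi> * x) - \<sigma> * (\<xi> * y)) = cis (\<sigma> * (x - y) * \<xi>)" for \<xi>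
      by (simp add: algebra_simps)
    ultimately show ?thesis
      using gaussian_fourier(2)[OF \<epsilon>, of "\<sigma> * (x - y)"] by (simp add: std_normal_density_def)
  qed
  have inner_int: "(LINT y|lborel. cnj (g y) * of_real (2 * pi / \<delta> * ?\<phi> ((y - x) / \<delta>)))
    = 2 * pi * (LINT s|lborel. ?\<phi> s * cnj (g (\<delta> * s + x)))" for x
  proof -
    have "(LINT y|lborel. cnj (g y) * of_real (2 * pi / \<delta> * ?\<phi> ((y - x) / \<delta>)))
       = \<delta> *\<^sub>R (LINT s|lborel. cnj (g (x + \<delta> * s)) * of_real (2 * pi / \<delta> * ?\<phi> s))"
      using \<delta> by (subst lborel_integral_real_affine[of \<delta> _ x]) auto
    also have "\<dots> = (LINT s|lborel. 2 * pi * (?\<phi> s * cnj (g (\<delta> * s + x))))"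
    proof (subst integral_scaleR_right[symmetric], intro Bochner_Integration.integral_cong refl)
      fix s
      have "\<delta> *\<^sub>R (z * complex_of_real (2 * pi / \<delta> * q)) = 2 * pi * (q * z)" for z :: complex and q
        using \<delta> by (simp add: scaleR_conv_of_real field_simps)
      then show "\<delta> *\<^sub>R (cnj (g (x + \<delta> * s)) * complex_of_real (2 * pi / \<delta> * ?\<phi> s))
          = 2 * pi * (?\<phi> s * cnj (g (\<delta> * s + x)))"
        by (simp only: add.commute)
    qed
    finally show ?thesis by simp
  qed
  have "complex_of_real (LINT \<xi>|lborel. (cmod (oscillatory (\<lambda>x \<xi>. \<sigma> * (\<xi> * x)) g \<xi>))\<^sup>2 * exp (- (\<epsilon> * \<xi>\<^sup>2)))
    = (LINT x|lborel. g x * (LINT y|lborel. cnj (g y) * of_real (2 * pi / \<delta> * ?\<phi> ((y - x) / \<delta>))))"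
    unfolding kernel[symmetric]
    by (rule weighted_oscillatory_norm[OF g(1) _ gaussian_fourier(1)[OF \<epsilon>]]) auto
  also have "\<dots> = 2 * pi * (LINT x|lborel. LINT s|lborel. G (s, x))"
  proof -
    define I where "I x = (LINT s|lborel. ?\<phi> s * cnj (g (\<delta> * s + x)))" for x
    have "(LINT s|lborel. G (s, x)) = (LINT s|lborel. g x * (?\<phi> s * cnj (g (\<delta> * s + x))))" for x
      by (simp only: G_def prod.case mult.left_commute)
    then have G_int: "(LINT s|lborel. G (s, x)) = g x * I x" for x
      by (simp only: integral_mult_right_zero I_def)
    have "(LINT x|lborel. g x * (2 * pi * I x)) = (LINT x|lborel. 2 * pi * (g x * I x))"
      by (simp only: mult.left_commute)
    then show ?thesis
      unfolding inner_int G_int I_def[symmetric] by (simp only: integral_mult_right_zero)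
  qed
  also have "(LINT x|lborel. LINT s|lborel. G (s, x)) = (LINT s|lborel. LINT x|lborel. G (s, x))"
    using lborel_pair.Fubini_integral[of "\<lambda>s x. G (s, x)"] int_G by simp
  finally have osc: "complex_of_real (LINT \<xi>|lborel. (cmod (oscillatory (\<lambda>x \<xi>. \<sigma> * (\<xi> * x)) g \<xi>))\<^sup>2 * exp (- (\<epsilon> * \<xi>\<^sup>2)))
     = 2 * pi * (LINT s|lborel. LINT x|lborel. G (s, x))" .
  have "(LINT \<xi>|lborel. (cmod (oscillatory (\<lambda>x \<xi>. \<sigma> * (\<xi> * x)) g \<xi>))\<^sup>2 * exp (- (\<epsilon> * \<xi>\<^sup>2)))
     = Re (2 * pi * (LINT s|lborel. LINT x|lborel. G (s, x)))"
    using arg_cong[OF osc, of Re] by (simp only: Re_complex_of_real)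
  also have "\<dots> = 2 * pi * (LINT s|lborel. A s)"
    using int_G' unfolding A_eq by simp
  finally have osc': "(LINT \<xi>|lborel. (cmod (oscillatory (\<lambda>x \<xi>. \<sigma> * (\<xi> * x)) g \<xi>))\<^sup>2 * exp (- (\<epsilon> * \<xi>\<^sup>2)))
      = 2 * pi * (LINT s|lborel. A s)" .
  show "(LINT \<xi>|lborel. (cmod (fourier_integral \<sigma> g \<xi>))\<^sup>2 * exp (- (\<delta>\<^sup>2 / 2 * \<xi>\<^sup>2))) = (LINT s|lborel. A s)"
  proof -
    have "(cmod (fourier_integral \<sigma> g \<xi>))\<^sup>2 * exp (- (\<delta>\<^sup>2 / 2 * \<xi>\<^sup>2)) =
      1 / (2 * pi) * ((cmod (oscillatory (\<lambda>x \<xi>. \<sigma> * (\<xi> * x)) g \<xi>))\<^sup>2 * exp (- (\<epsilon> * \<xi>\<^sup>2)))" for \<xi>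
    proof -
      have "cmod (fourier_integral \<sigma> g \<xi>) = 1 / sqrt (2 * pi) * cmod (oscillatory (\<lambda>x \<xi>. \<sigma> * (\<xi> * x)) g \<xi>)"
        unfolding fourier_integral_oscillatory norm_mult by (simp add: norm_divide del: of_real_mult)
      then show ?thesis
        by (simp add: power_mult_distrib power_divide \<epsilon>_def)
    qed
    moreover have "(LINT \<xi>|lborel. (cmod (oscillatory (\<lambda>x \<xi>. \<sigma> * (\<xi> * x)) g \<xi>))\<^sup>2 * exp (- (\<epsilon> * \<xi>\<^sup>2)))
      = 2 * pi * (LINT s|lborel. A s)" by (rule osc')
    ultimately show ?thesis by (simp only: integral_mult_right_zero) simp
  qed
qed

lemma norm_translate_L2: "norm (translate_L2 z f) = norm f"
  using dist_translate_L2[of z f 0] by (simp add: translate_L2_0)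

text \<open>As \<delta> decreases to 0, the weights on the frequency side increase to 1, so monotone
  convergence yields integrability and value at once. On the other side the translates converge to
  g, with Cauchy-Schwarz as the dominating bound.\<close>

lemma plancherel_L1_L2:
  assumes g: "integrable lborel g" "square_integrable g" and \<sigma>: "\<sigma>\<^sup>2 = 1"
  shows "square_integrable (fourier_integral \<sigma> g)"
    and "norm (abs_L2 (fourier_integral \<sigma> g)) = norm (abs_L2 g)"
proof -
  have [measurable]: "g \<in> borel_measurable borel" using g by auto
  define \<delta> where "\<delta> n = 1 / real (Suc n)" for n
  have \<delta>: "\<delta> n > 0" for n by (simp add: \<delta>_def)
  have \<delta>0: "\<delta> \<longlonglongrightarrow> 0" unfolding \<delta>_def by (rule LIMSEQ_Suc[OF lim_1_over_n])
  define f where "f n \<xi> = (cmod (fourier_integral \<sigma> g \<xi>))\<^sup>2 * exp (- ((\<delta> n)\<^sup>2 / 2 * \<xi>\<^sup>2))" for n \<xi>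
  define A where "A n s = std_normal_density s * inner (abs_L2 g) (translate_L2 (\<delta> n * s) (abs_L2 g))" for n s
  note reg = gaussian_regularized_norm[OF g \<sigma> \<delta>, folded A_def f_def]
  have "(\<lambda>n. LINT s|lborel. A n s) \<longlonglongrightarrow> (LINT s|lborel. std_normal_density s * (norm (abs_L2 g))\<^sup>2)"
  proof (rule integral_dominated_convergence[where w = "\<lambda>s. std_normal_density s * (norm (abs_L2 g))\<^sup>2"])
    show "A n \<in> borel_measurable lborel" for n using reg(2)[of n] by auto
    show "AE s in lborel. (\<lambda>n. A n s) \<longlonglongrightarrow> std_normal_density s * (norm (abs_L2 g))\<^sup>2"
    proof (rule AE_I2)
      fix s
      have "(\<lambda>n. \<delta> n * s) \<longlonglongrightarrow> 0" using tendsto_mult_left_zero[OF \<delta>0] .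
      then have "(\<lambda>n. A n s) \<longlonglongrightarrow> std_normal_density s * inner (abs_L2 g) (abs_L2 g)"
        unfolding A_def by (intro tendsto_intros translate_L2_tendsto)
      then show "(\<lambda>n. A n s) \<longlonglongrightarrow> std_normal_density s * (norm (abs_L2 g))\<^sup>2"
        by (simp add: power2_norm_eq_inner)
    qed
    show "AE s in lborel. norm (A n s) \<le> std_normal_density s * (norm (abs_L2 g))\<^sup>2" for n
    proof (rule AE_I2)
      fix s
      have "\<bar>inner (abs_L2 g) (translate_L2 (\<delta> n * s) (abs_L2 g))\<bar> \<le> (norm (abs_L2 g))\<^sup>2"
        using Cauchy_Schwarz_ineq2[of "abs_L2 g" "translate_L2 (\<delta> n * s) (abs_L2 g)"]
        by (simp add: norm_translate_L2 power2_eq_square)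
      then show "norm (A n s) \<le> std_normal_density s * (norm (abs_L2 g))\<^sup>2"
        by (simp add: A_def abs_mult mult_left_mono)
    qed
  qed auto
  then have lim: "(\<lambda>n. LINT \<xi>|lborel. f n \<xi>) \<longlonglongrightarrow> (norm (abs_L2 g))\<^sup>2"
    by (simp add: reg(1))
  have fm [measurable]: "f n \<in> borel_measurable borel" for n unfolding f_def by measurable
  have int_f: "integrable lborel (f n)" for n
  proof (rule Bochner_Integration.integrable_bound)
    show "integrable lborel (\<lambda>\<xi>. (1 / sqrt (2 * pi) * (LINT x|lborel. cmod (g x)))\<^sup>2 * exp (- ((\<delta> n)\<^sup>2 / 2 * \<xi>\<^sup>2)))"
      using \<delta>[of n] by (intro integrable_mult_right gaussian_fourier(1)) simp
    have "cmod (fourier_integral \<sigma> g \<xi>) \<le> 1 / sqrt (2 * pi) * (LINT x|lborel. cmod (g x))" for \<xi>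
      using cmod_oscillatory_le[of _ g \<xi>]
      by (simp add: fourier_integral_oscillatory norm_mult norm_divide divide_right_mono)
    then show "AE \<xi> in lborel. norm (f n \<xi>) \<le> norm ((1 / sqrt (2 * pi) * (LINT x|lborel. cmod (g x)))\<^sup>2 * exp (- ((\<delta> n)\<^sup>2 / 2 * \<xi>\<^sup>2)))"
      by (intro AE_I2) (simp only: f_def real_norm_def abs_mult abs_power2 abs_exp_cancel,
        intro mult_right_mono power_mono, auto)
  qed measurable
  have mono: "mono (\<lambda>n. f n \<xi>)" for \<xi>
  proof (rule incseq_SucI)
    fix n
    have "(\<delta> (Suc n))\<^sup>2 \<le> (\<delta> n)\<^sup>2" by (intro power_mono) (auto simp: \<delta>_def field_simps)
    then show "f n \<xi> \<le> f (Suc n) \<xi>"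
      by (auto simp: f_def intro!: mult_left_mono mult_right_mono divide_right_mono)
  qed
  have ptw: "(\<lambda>n. f n \<xi>) \<longlonglongrightarrow> (cmod (fourier_integral \<sigma> g \<xi>))\<^sup>2" for \<xi>
  proof -
    have "(\<lambda>n. f n \<xi>) \<longlonglongrightarrow> (cmod (fourier_integral \<sigma> g \<xi>))\<^sup>2 * exp (- (0\<^sup>2 / 2 * \<xi>\<^sup>2))"
      unfolding f_def by (intro tendsto_intros \<delta>0) auto
    then show ?thesis by simp
  qed
  have int: "integrable lborel (\<lambda>\<xi>. (cmod (fourier_integral \<sigma> g \<xi>))\<^sup>2)"
    by (rule integrable_monotone_convergence[OF int_f AE_I2[OF mono] AE_I2[OF ptw] lim]) measurable
  have val: "(LINT \<xi>|lborel. (cmod (fourier_integral \<sigma> g \<xi>))\<^sup>2) = (norm (abs_L2 g))\<^sup>2"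
    by (rule integral_monotone_convergence[OF int_f AE_I2[OF mono] AE_I2[OF ptw] lim]) measurable
  show sq: "square_integrable (fourier_integral \<sigma> g)"
    using int by (simp add: square_integrable_def)
  show "norm (abs_L2 (fourier_integral \<sigma> g)) = norm (abs_L2 g)"
    using val norm_abs_L2_sq[OF sq] by (simp add: power2_eq_iff_nonneg)
qed

text \<open>The real inner product is the real part of the Hermitian one, so this is Fubini followed
  by \<open>Re\<close>; conjugating the exponential reverses the sign.\<close>

lemma fourier_integral_adjoint:
  assumes g: "integrable lborel g" and k: "integrable lborel k"
  shows "(LINT \<xi>|lborel. inner (fourier_integral \<sigma> g \<xi>) (k \<xi>)) =
    (LINT x|lborel. inner (g x) (fourier_integral (- \<sigma>) k x))"
proof -
  let ?F = "\<lambda>\<xi> x. complex_of_real (1 / sqrt (2 * pi)) * (cis (\<sigma> * (\<xi> * x)) * g x * cnj (k \<xi>))"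
  have [measurable]: "g \<in> borel_measurable borel" "k \<in> borel_measurable borel" using g k by auto
  have eq1: "(LINT x|lborel. ?F \<xi> x) = fourier_integral \<sigma> g \<xi> * cnj (k \<xi>)" for \<xi>
    by (simp add: fourier_integral_def)
  have eq2: "(LINT \<xi>|lborel. ?F \<xi> x) = g x * cnj (fourier_integral (- \<sigma>) k x)" for x
  proof -
    have "cnj (LINT \<xi>|lborel. cis (- \<sigma> * (x * \<xi>)) * k \<xi>) = (LINT \<xi>|lborel. cis (\<sigma> * (\<xi> * x)) * cnj (k \<xi>))"
      by (subst Bochner_Integration.integral_cnj[symmetric]) (simp add: cis_cnj mult_ac)
    then have "g x * cnj (fourier_integral (- \<sigma>) k x) =
        g x * (complex_of_real (1 / sqrt (2 * pi)) * (LINT \<xi>|lborel. cis (\<sigma> * (\<xi> * x)) * cnj (k \<xi>)))"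
      by (simp add: fourier_integral_def)
    also have "\<dots> = (LINT \<xi>|lborel. g x * (complex_of_real (1 / sqrt (2 * pi)) * (cis (\<sigma> * (\<xi> * x)) * cnj (k \<xi>))))"
      by simp
    finally show ?thesis by (simp add: mult_ac)
  qed
  have le: "cmod (?F \<xi> x) \<le> cmod (k \<xi>) * cmod (g x)" for \<xi> x
  proof -
    have "1 / sqrt (2 * pi) \<le> 1" using pi_gt3 by (simp add: field_simps)
    then have "1 / sqrt (2 * pi) * (cmod (k \<xi>) * cmod (g x)) \<le> 1 * (cmod (k \<xi>) * cmod (g x))"
      by (intro mult_right_mono) auto
    then show ?thesis by (simp add: norm_mult norm_divide mult_ac)
  qed
  have "(\<lambda>(\<xi>, x). ?F \<xi> x) \<in> borel_measurable (lborel \<Otimes>\<^sub>M lborel)" by measurable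
  note fub = Fubini_bounded_by_product[OF this integrable_norm[OF k] integrable_norm[OF g] le]
  have "(\<lambda>(x, \<xi>). ?F \<xi> x) \<in> borel_measurable (lborel \<Otimes>\<^sub>M lborel)" by measurable
  note fub2 = Fubini_bounded_by_product(2)[OF this integrable_norm[OF g] integrable_norm[OF k]
    le[unfolded mult.commute[of "cmod (k _)"]]]
  have "(LINT \<xi>|lborel. inner (fourier_integral \<sigma> g \<xi>) (k \<xi>)) = Re (LINT \<xi>|lborel. LINT x|lborel. ?F \<xi> x)"
    using fub(2) unfolding eq1 by (simp add: inner_complex_def flip: integral_Re)
  also have "\<dots> = Re (LINT x|lborel. LINT \<xi>|lborel. ?F \<xi> x)" by (simp only: fub(1))
  also have "\<dots> = (LINT x|lborel. inner (g x) (fourier_integral (- \<sigma>) k x))"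
    using fub2 unfolding eq2 by (simp add: inner_complex_def flip: integral_Re)
  finally show ?thesis .
qed

section \<open>The Fourier transform on \<open>L\<^sup>2\<close>\<close>

definition cutoff :: "nat \<Rightarrow> L2 \<Rightarrow> real \<Rightarrow> complex" where
  "cutoff n f x = indicator {- real n..real n} x *\<^sub>R rep_L2 f x"

text \<open>On a bounded interval the majorant 1 + |f|^2 of |f| is integrable. Hence truncated
  functions have a genuine Fourier integral.\<close>

lemma integrable_of_square_integrable_bounded:
  assumes f: "square_integrable f"
  shows "integrable lborel (\<lambda>x. indicator {a..b::real} x *\<^sub>R f x)"
proof (rule Bochner_Integration.integrable_bound)
  have [measurable]: "f \<in> borel_measurable borel" using f by (simp add: square_integrable_def)
  show "integrable lborel (\<lambda>x. indicat_real {a..b} x + (cmod (f x))\<^sup>2)"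
    by (intro Bochner_Integration.integrable_add integrable_cmod_sq f integrable_real_indicator)
       (auto simp: emeasure_lborel_Icc_eq)
  have "cmod (f x) \<le> 1 + (cmod (f x))\<^sup>2" for x
    using sum_squares_bound[of "cmod (f x)" 1] by (simp add: power2_eq_square) (smt (verit) norm_ge_zero)
  then show "AE x in lborel. norm (indicator {a..b} x *\<^sub>R f x) \<le> norm (indicat_real {a..b} x + (cmod (f x))\<^sup>2)"
    by (auto simp: indicator_def)
  show "(\<lambda>x. indicator {a..b} x *\<^sub>R f x) \<in> borel_measurable lborel" by measurable
qed

lemma integrable_cutoff: "integrable lborel (cutoff n f)"
  unfolding cutoff_def by (rule integrable_of_square_integrable_bounded) simp

lemma cutoff_le: "cmod (cutoff n f x) \<le> 1 * cmod (rep_L2 f x)"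
  by (simp add: cutoff_def indicator_def)

lemma cutoff_measurable [measurable]: "cutoff n f \<in> borel_measurable borel"
  unfolding cutoff_def by measurable

lemma square_integrable_cutoff [simp]: "square_integrable (cutoff n f)"
  by (rule square_integrable_bound[OF square_integrable_rep[of f] _ cutoff_le]) measurable

lemma cutoff_tendsto: "(\<lambda>n. abs_L2 (cutoff n f)) \<longlonglongrightarrow> f"
proof -
  have "(\<lambda>n. abs_L2 (cutoff n f)) \<longlonglongrightarrow> abs_L2 (rep_L2 f)"
  proof (rule L2_dominated_tendsto(2)[OF square_integrable_rep[of f] _ _ cutoff_le])
    fix x
    obtain N :: nat where "\<bar>x\<bar> \<le> real N" using real_arch_simple by blast
    then have "\<forall>n\<ge>N. cutoff n f x = rep_L2 f x" by (auto simp: cutoff_def indicator_def)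
    then show "(\<lambda>n. cutoff n f x) \<longlonglongrightarrow> rep_L2 f x"
      by (intro tendsto_eventually) (auto simp: eventually_sequentially)
  qed measurable
  then show ?thesis by simp
qed

definition fourier_op :: "real \<Rightarrow> L2 \<Rightarrow> L2" where
  "fourier_op \<sigma> f = lim (\<lambda>n. to_L2 (fourier_integral \<sigma> (cutoff n f)))"

lemma fourier_L2_op: "fourier_L2 = fourier_op (- 1)"
  by (simp add: fun_eq_iff fourier_L2_def fourier_op_def fourier_integral_def[abs_def] cutoff_def
      set_lebesgue_integral_def)

lemma inverse_fourier_L2_op: "inverse_fourier_L2 = fourier_op 1"
  by (simp add: fun_eq_iff inverse_fourier_L2_def fourier_op_def fourier_integral_def[abs_def] cutoff_def
      set_lebesgue_integral_def mult_ac)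

lemma fourier_integral_diff:
  assumes "integrable lborel g" "integrable lborel k"
  shows "fourier_integral \<sigma> (\<lambda>x. g x - k x) = (\<lambda>\<xi>. fourier_integral \<sigma> g \<xi> - fourier_integral \<sigma> k \<xi>)"
proof
  fix \<xi>
  have int: "integrable lborel (\<lambda>x. cis (\<sigma> * (\<xi> * x)) * f x)" if "integrable lborel f" for f
    by (rule Bochner_Integration.integrable_bound[OF that]) (use that in \<open>auto simp: norm_mult\<close>)
  show "fourier_integral \<sigma> (\<lambda>x. g x - k x) \<xi> = fourier_integral \<sigma> g \<xi> - fourier_integral \<sigma> k \<xi>"
    using int[OF assms(1)] int[OF assms(2)]
    by (simp add: fourier_integral_def right_diff_distrib)
qed

lemma dist_fourier_integral:
  assumes g: "integrable lborel g" "square_integrable g"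
    and k: "integrable lborel k" "square_integrable k" and \<sigma>: "\<sigma>\<^sup>2 = 1"
  shows "dist (abs_L2 (fourier_integral \<sigma> g)) (abs_L2 (fourier_integral \<sigma> k)) = dist (abs_L2 g) (abs_L2 k)"
proof -
  have d: "integrable lborel (\<lambda>x. g x - k x)" "square_integrable (\<lambda>x. g x - k x)"
    using g k by (auto intro: square_integrable_diff)
  show ?thesis
    using plancherel_L1_L2[OF d \<sigma>] plancherel_L1_L2(1)[OF g \<sigma>] plancherel_L1_L2(1)[OF k \<sigma>]
    by (simp add: dist_norm abs_L2_diff g k fourier_integral_diff)
qed

text \<open>Plancherel carries the Cauchy property of the truncations over to their transforms. It
  also shows that \<open>to_L2\<close> never returns its dummy value in the definition.\<close>

lemma fourier_op_lim:
  assumes \<sigma>: "\<sigma>\<^sup>2 = 1"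
  shows "(\<lambda>n. abs_L2 (fourier_integral \<sigma> (cutoff n f))) \<longlonglongrightarrow> fourier_op \<sigma> f"
proof -
  have "Cauchy (\<lambda>n. abs_L2 (cutoff n f))"
    using cutoff_tendsto by (rule LIMSEQ_imp_Cauchy)
  then have "Cauchy (\<lambda>n. abs_L2 (fourier_integral \<sigma> (cutoff n f)))"
    by (simp add: Cauchy_def dist_fourier_integral integrable_cutoff \<sigma>)
  then show ?thesis
    by (simp add: fourier_op_def to_L2_abs plancherel_L1_L2(1) integrable_cutoff \<sigma>
        Cauchy_convergent_iff convergent_LIMSEQ_iff)
qed

lemma fourier_op_abs:
  assumes g: "integrable lborel g" "square_integrable g" and \<sigma>: "\<sigma>\<^sup>2 = 1"
  shows "fourier_op \<sigma> (abs_L2 g) = abs_L2 (fourier_integral \<sigma> g)"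
proof (rule LIMSEQ_unique[OF fourier_op_lim[OF \<sigma>]])
  have "(\<lambda>n. dist (abs_L2 (cutoff n (abs_L2 g))) (abs_L2 g)) \<longlonglongrightarrow> 0"
    using cutoff_tendsto[of "abs_L2 g"] by (subst (asm) tendsto_dist_iff)
  then show "(\<lambda>n. abs_L2 (fourier_integral \<sigma> (cutoff n (abs_L2 g)))) \<longlonglongrightarrow> abs_L2 (fourier_integral \<sigma> g)"
    by (subst tendsto_dist_iff) (simp add: dist_fourier_integral g integrable_cutoff \<sigma>)
qed

lemma dist_fourier_op:
  assumes \<sigma>: "\<sigma>\<^sup>2 = 1" shows "dist (fourier_op \<sigma> f) (fourier_op \<sigma> g) = dist f g"
proof (rule LIMSEQ_unique)
  show "(\<lambda>n. dist (abs_L2 (fourier_integral \<sigma> (cutoff n f))) (abs_L2 (fourier_integral \<sigma> (cutoff n g))))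
      \<longlonglongrightarrow> dist (fourier_op \<sigma> f) (fourier_op \<sigma> g)"
    by (intro tendsto_dist fourier_op_lim \<sigma>)
  show "(\<lambda>n. dist (abs_L2 (fourier_integral \<sigma> (cutoff n f))) (abs_L2 (fourier_integral \<sigma> (cutoff n g))))
      \<longlonglongrightarrow> dist f g"
    by (simp add: dist_fourier_integral integrable_cutoff \<sigma> tendsto_dist cutoff_tendsto)
qed

text \<open>\<open>L2\<close> is a real vector space, so compatibility with complex scalars is a
  separate fact. Mass conservation needs it for the scalar i. It is checked on truncations and
  extended by continuity.\<close>

lemma fourier_op_scaleC:
  assumes \<sigma>: "\<sigma>\<^sup>2 = 1" shows "fourier_op \<sigma> (scaleC_L2 c f) = scaleC_L2 c (fourier_op \<sigma> f)"
proof -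
  have dist_scaleC: "dist (scaleC_L2 c a) (scaleC_L2 c b) = cmod c * dist a b" for a b
  proof -
    have "(dist (scaleC_L2 c a) (scaleC_L2 c b))\<^sup>2 = (cmod c * dist a b)\<^sup>2"
      using dist_abs_L2_sq[of "\<lambda>x. c * rep_L2 a x" "\<lambda>x. c * rep_L2 b x"]
        dist_abs_L2_sq[of "rep_L2 a" "rep_L2 b"] scaleC_L2_abs[of "rep_L2 a" c] scaleC_L2_abs[of "rep_L2 b" c]
      by (simp add: square_integrable_cmult norm_mult power_mult_distrib flip: right_diff_distrib)
    then show ?thesis by (simp add: power2_eq_iff_nonneg)
  qed
  have scaleC_tendsto: "(\<lambda>n. scaleC_L2 c (X n)) \<longlonglongrightarrow> scaleC_L2 c a" if "X \<longlonglongrightarrow> a" for X :: "nat \<Rightarrow> L2" and a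
    using that tendsto_mult_right_zero[of "\<lambda>n. dist (X n) a" sequentially "cmod c"]
    by (subst tendsto_dist_iff) (simp add: dist_scaleC tendsto_dist_iff[of X])
  have "fourier_op \<sigma> (scaleC_L2 c (abs_L2 (cutoff n f))) = scaleC_L2 c (fourier_op \<sigma> (abs_L2 (cutoff n f)))" for n
  proof -
    have "fourier_integral \<sigma> (\<lambda>x. c * cutoff n f x) = (\<lambda>\<xi>. c * fourier_integral \<sigma> (cutoff n f) \<xi>)"
      by (simp add: fun_eq_iff fourier_integral_def mult.left_commute[of _ c])
    then show ?thesis
      by (simp add: scaleC_L2_abs fourier_op_abs integrable_cutoff \<sigma> plancherel_L1_L2(1) square_integrable_cmult)
  qed
  note eq = this
  have cont: "(\<lambda>n. fourier_op \<sigma> (X n)) \<longlonglongrightarrow> fourier_op \<sigma> a" if "X \<longlonglongrightarrow> a" for X :: "nat \<Rightarrow> L2" and a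
    using that by (simp add: tendsto_dist_iff[of _ a] tendsto_dist_iff[of _ "fourier_op \<sigma> a"] dist_fourier_op \<sigma>)
  show ?thesis
  proof (rule LIMSEQ_unique)
    show "(\<lambda>n. fourier_op \<sigma> (scaleC_L2 c (abs_L2 (cutoff n f)))) \<longlonglongrightarrow> fourier_op \<sigma> (scaleC_L2 c f)"
      by (intro cont scaleC_tendsto cutoff_tendsto)
    show "(\<lambda>n. fourier_op \<sigma> (scaleC_L2 c (abs_L2 (cutoff n f)))) \<longlonglongrightarrow> scaleC_L2 c (fourier_op \<sigma> f)"
      unfolding eq by (intro cont scaleC_tendsto cutoff_tendsto)
  qed
qed

lemma fourier_op_0: "\<sigma>\<^sup>2 = 1 \<Longrightarrow> fourier_op \<sigma> 0 = 0"
  using fourier_op_abs[of "\<lambda>x. 0" \<sigma>] by (simp add: zero_L2_def fourier_integral_def[abs_def])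

lemma norm_fourier_op: "\<sigma>\<^sup>2 = 1 \<Longrightarrow> norm (fourier_op \<sigma> f) = norm f"
  using dist_fourier_op[of \<sigma> f 0] by (simp add: fourier_op_0)

text \<open>Polarization: a fixed origin turns distances into norms, and expanding the square of |U
  f - U g| recovers the inner product from norms.\<close>

lemma inner_isometry:
  fixes U :: "'a::real_inner \<Rightarrow> 'b::real_inner"
  assumes dist: "\<And>f g. dist (U f) (U g) = dist f g" and 0: "U 0 = 0"
  shows "inner (U f) (U g) = inner f g"
proof -
  have norm: "norm (U f) = norm f" for f
    using dist[of f 0] by (simp add: 0)
  have "(norm (U f - U g))\<^sup>2 = (norm (f - g))\<^sup>2" using dist[of f g] by (simp add: dist_norm)
  moreover have "(norm (U f))\<^sup>2 = (norm f)\<^sup>2" "(norm (U g))\<^sup>2 = (norm g)\<^sup>2" by (simp_all add: norm)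
  ultimately show ?thesis
    by (simp add: power2_norm_eq_inner inner_diff_left inner_diff_right inner_commute)
qed

lemma inner_fourier_op:
  assumes \<sigma>: "\<sigma>\<^sup>2 = 1" shows "inner (fourier_op \<sigma> f) (fourier_op \<sigma> g) = inner f g"
  by (intro inner_isometry dist_fourier_op fourier_op_0 \<sigma>)

lemma fourier_op_adjoint:
  assumes \<sigma>: "\<sigma>\<^sup>2 = 1" shows "inner (fourier_op \<sigma> f) g = inner f (fourier_op (- \<sigma>) g)"
proof (rule LIMSEQ_unique)
  have \<sigma>': "(- \<sigma>)\<^sup>2 = 1" using \<sigma> by simp
  show "(\<lambda>n. inner (abs_L2 (fourier_integral \<sigma> (cutoff n f))) (abs_L2 (cutoff n g))) \<longlonglongrightarrow> inner (fourier_op \<sigma> f) g"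
    by (intro tendsto_inner fourier_op_lim \<sigma> cutoff_tendsto)
  have "inner (abs_L2 (fourier_integral \<sigma> (cutoff n f))) (abs_L2 (cutoff n g))
    = inner (abs_L2 (cutoff n f)) (abs_L2 (fourier_integral (- \<sigma>) (cutoff n g)))" for n
    using fourier_integral_adjoint[OF integrable_cutoff[of n f] integrable_cutoff[of n g], of \<sigma>]
    by (simp add: inner_L2_abs plancherel_L1_L2(1) integrable_cutoff \<sigma> \<sigma>')
  then show "(\<lambda>n. inner (abs_L2 (fourier_integral \<sigma> (cutoff n f))) (abs_L2 (cutoff n g)))
      \<longlonglongrightarrow> inner f (fourier_op (- \<sigma>) g)"
    by (simp add: tendsto_inner fourier_op_lim[OF \<sigma>'] cutoff_tendsto)
qed

text \<open>No pointwise inversion formula is involved: if V is the adjoint of the isometry U, then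
  <V U f, h> = <U f, U h> = <f, h> for all h, so V U is the identity.\<close>

lemma fourier_op_inverse:
  assumes \<sigma>: "\<sigma>\<^sup>2 = 1" shows "fourier_op (- \<sigma>) (fourier_op \<sigma> f) = f"
proof -
  have "inner (fourier_op (- \<sigma>) (fourier_op \<sigma> f) - f) h = 0" for h
    using fourier_op_adjoint[of \<sigma> h "fourier_op \<sigma> f"] \<sigma>
    by (simp add: inner_diff_left inner_diff_right inner_fourier_op inner_commute)
  from this[of "fourier_op (- \<sigma>) (fourier_op \<sigma> f) - f"] show ?thesis by simp
qed

section \<open>The free group\<close>

definition multiplier :: "real \<Rightarrow> L2 \<Rightarrow> L2" where
  "multiplier r f = abs_L2 (\<lambda>\<xi>. cis (- (r * \<xi>\<^sup>2)) * rep_L2 f \<xi>)"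

lemma square_integrable_cis:
  assumes "square_integrable g" "\<theta> \<in> borel_measurable borel"
  shows "square_integrable (\<lambda>\<xi>. cis (\<theta> \<xi>) * g \<xi>)"
proof -
  have [measurable]: "g \<in> borel_measurable borel" "\<theta> \<in> borel_measurable borel"
    using assms by (auto simp: square_integrable_def)
  show ?thesis by (rule square_integrable_bound[OF assms(1), of _ 1]) (auto simp: norm_mult)
qed

lemma free_schroedinger_eq:
  "free_schroedinger r f = fourier_op 1 (multiplier r (fourier_op (- 1) f))"
  by (simp add: free_schroedinger_def inverse_fourier_L2_op fourier_L2_op multiplier_def to_L2_abs
      square_integrable_cis)

lemma multiplier_abs:
  assumes "square_integrable g"
  shows "multiplier r (abs_L2 g) = abs_L2 (\<lambda>\<xi>. cis (- (r * \<xi>\<^sup>2)) * g \<xi>)"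
proof -
  have "AE x in lborel. cis (- (r * x\<^sup>2)) * rep_L2 (abs_L2 g) x = cis (- (r * x\<^sup>2)) * g x"
    using rep_abs_L2[OF assms] by eventually_elim simp
  then show ?thesis
    unfolding multiplier_def by (intro abs_L2_eqI square_integrable_cis assms) auto
qed

lemma multiplier_add: "multiplier r (multiplier s f) = multiplier (r + s) f"
proof -
  have "multiplier r (multiplier s f) = abs_L2 (\<lambda>\<xi>. cis (- (r * \<xi>\<^sup>2)) * (cis (- (s * \<xi>\<^sup>2)) * rep_L2 f \<xi>))"
    unfolding multiplier_def[of s] by (intro multiplier_abs square_integrable_cis) auto
  also have "\<dots> = multiplier (r + s) f"
    unfolding multiplier_def by (simp add: cis_mult algebra_simps flip: mult.assoc)
  finally show ?thesis .
qed

lemma multiplier_0: "multiplier 0 f = f"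
  by (simp add: multiplier_def)

lemma dist_multiplier: "dist (multiplier r f) (multiplier r g) = dist f g"
proof -
  have "(dist (multiplier r f) (multiplier r g))\<^sup>2 = (dist f g)\<^sup>2"
    using dist_abs_L2_sq[of "rep_L2 f" "rep_L2 g"]
    by (simp add: multiplier_def dist_abs_L2_sq square_integrable_cis norm_mult flip: right_diff_distrib)
  then show ?thesis by simp
qed

lemma multiplier_scaleC: "multiplier r (scaleC_L2 c f) = scaleC_L2 c (multiplier r f)"
proof -
  have "multiplier r (scaleC_L2 c (abs_L2 (rep_L2 f))) = scaleC_L2 c (multiplier r f)"
    unfolding multiplier_def[of r f]
    by (simp only: scaleC_L2_abs square_integrable_rep multiplier_abs square_integrable_cmult)
       (subst scaleC_L2_abs, auto intro: square_integrable_cis simp: mult.left_commute)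
  then show ?thesis by simp
qed

lemma multiplier_tendsto:
  assumes "r \<longlonglongrightarrow> s" shows "(\<lambda>n. multiplier (r n) f) \<longlonglongrightarrow> multiplier s f"
  unfolding multiplier_def
  by (rule L2_dominated_tendsto(2)[OF square_integrable_rep[of f], where c = 1])
     (auto simp: norm_mult intro!: tendsto_intros assms)

lemma free_schroedinger_inverse: "free_schroedinger (- r) (free_schroedinger r f) = f"
  using fourier_op_inverse[of 1] fourier_op_inverse[of "- 1"]
  by (simp add: free_schroedinger_eq multiplier_add multiplier_0)

text \<open>\<open>inv\<close> is defined by choice; the two-sided inverse at time
  \<open>- r\<close> pins it down.\<close>

lemma inv_free_schroedinger: "inv (free_schroedinger r) = free_schroedinger (- r)"
  using free_schroedinger_inverse[of "- r"]
  by (intro inv_equality) (simp_all add: free_schroedinger_inverse)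

lemma dist_free_schroedinger: "dist (free_schroedinger r f) (free_schroedinger r g) = dist f g"
  by (simp add: free_schroedinger_eq dist_fourier_op dist_multiplier)

lemma free_schroedinger_0: "free_schroedinger r 0 = 0"
  using multiplier_abs[of "\<lambda>x. 0" r] by (simp add: free_schroedinger_eq fourier_op_0 zero_L2_def[symmetric])

lemma norm_free_schroedinger: "norm (free_schroedinger r f) = norm f"
  using dist_free_schroedinger[of r f 0] by (simp add: free_schroedinger_0)

lemma inner_free_schroedinger: "inner (free_schroedinger r f) (free_schroedinger r g) = inner f g"
  by (intro inner_isometry dist_free_schroedinger free_schroedinger_0)

lemma free_schroedinger_scaleC: "free_schroedinger r (scaleC_L2 c f) = scaleC_L2 c (free_schroedinger r f)"
  by (simp add: free_schroedinger_eq fourier_op_scaleC multiplier_scaleC)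

text \<open>The isometry absorbs the change of f uniformly in r, which leaves only the multiplier at
  a fixed f. Joint continuity is what makes r |-> T_r applied to an r-dependent function
  measurable.\<close>

lemma continuous_free_schroedinger: "continuous_on UNIV (\<lambda>(r, f). free_schroedinger r f)"
  unfolding continuous_on_sequentially
proof (intro allI impI ballI, elim conjE)
  fix X :: "nat \<Rightarrow> real \<times> L2" and a assume X: "X \<longlonglongrightarrow> a"
  let ?G = "\<lambda>f. fourier_op (- 1) f"
  have f: "(\<lambda>n. dist (snd (X n)) (snd a)) \<longlonglongrightarrow> 0"
    using tendsto_snd[OF X] by (subst (asm) tendsto_dist_iff)
  have m: "(\<lambda>n. dist (multiplier (fst (X n)) (?G (snd a))) (multiplier (fst a) (?G (snd a)))) \<longlonglongrightarrow> 0"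
    using multiplier_tendsto[OF tendsto_fst[OF X]] by (subst (asm) tendsto_dist_iff)
  have "dist (free_schroedinger (fst (X n)) (snd (X n))) (free_schroedinger (fst a) (snd a))
      \<le> dist (snd (X n)) (snd a) + dist (multiplier (fst (X n)) (?G (snd a))) (multiplier (fst a) (?G (snd a)))" for n
  proof -
    have "dist (free_schroedinger (fst (X n)) (snd (X n))) (free_schroedinger (fst a) (snd a))
      \<le> dist (free_schroedinger (fst (X n)) (snd (X n))) (free_schroedinger (fst (X n)) (snd a))
       + dist (free_schroedinger (fst (X n)) (snd a)) (free_schroedinger (fst a) (snd a))"
      by (rule dist_triangle)
    also have "dist (free_schroedinger (fst (X n)) (snd (X n))) (free_schroedinger (fst (X n)) (snd a))
        = dist (snd (X n)) (snd a)"
      by (rule dist_free_schroedinger)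
    also have "dist (free_schroedinger (fst (X n)) (snd a)) (free_schroedinger (fst a) (snd a))
        = dist (multiplier (fst (X n)) (?G (snd a))) (multiplier (fst a) (?G (snd a)))"
      by (simp add: free_schroedinger_eq dist_fourier_op)
    finally show ?thesis .
  qed
  then have "(\<lambda>n. dist (free_schroedinger (fst (X n)) (snd (X n))) (free_schroedinger (fst a) (snd a))) \<longlonglongrightarrow> 0"
    by (intro tendsto_sandwich[OF _ _ tendsto_const tendsto_add[OF f m, simplified]] always_eventually allI) auto
  then show "((\<lambda>(r, f). free_schroedinger r f) \<circ> X) \<longlonglongrightarrow> (\<lambda>(r, f). free_schroedinger r f) a"
    by (subst tendsto_dist_iff) (simp add: case_prod_beta)
qed

lemma measurable_free_schroedinger:
  assumes [measurable]: "G \<in> borel_measurable lborel" "\<rho> \<in> borel_measurable lborel"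
  shows "(\<lambda>r. free_schroedinger (\<rho> r) (G r)) \<in> borel_measurable lborel"
proof -
  have "(\<lambda>r. (\<rho> r, G r)) \<in> borel_measurable lborel" by (rule borel_measurable_Pair) auto
  from borel_measurable_continuous_on[OF continuous_free_schroedinger this] show ?thesis by simp
qed

text \<open>For compactly supported frequency data the group has a concrete representative with
  values at points.\<close>

lemma free_schroedinger_cutoff:
  "free_schroedinger r (fourier_op 1 (abs_L2 (cutoff n g))) =
     abs_L2 (\<lambda>x. fourier_integral 1 (\<lambda>\<xi>. cis (- (r * \<xi>\<^sup>2)) * cutoff n g \<xi>) x)"
proof -
  have "integrable lborel (\<lambda>\<xi>. cis (- (r * \<xi>\<^sup>2)) * cutoff n g \<xi>)"
    by (rule Bochner_Integration.integrable_bound[OF integrable_cutoff[of n g]]) (auto simp: norm_mult)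
  then show ?thesis
    using fourier_op_inverse[of 1]
    by (simp add: free_schroedinger_eq multiplier_abs fourier_op_abs square_integrable_cis)
qed

section \<open>The dispersive estimate\<close>

text \<open>The least eigenvalue of the form on the right is (3 - sqrt 5) / 2, which exceeds 1/3.
  The bound separates the variables in a product of two shifted Gaussians, as Fubini
  requires.\<close>

lemma quadratic_form_lower_bound: "(u\<^sup>2 + v\<^sup>2) / 3 \<le> (u + v)\<^sup>2 + (v::real)\<^sup>2"
proof -
  have "(u + v)\<^sup>2 + v\<^sup>2 - (u\<^sup>2 + v\<^sup>2) / 3 = 2/3 * (u + 3/2 * v)\<^sup>2 + 1/6 * v\<^sup>2"
    by (simp add: power2_eq_square field_simps)
  also have "\<dots> \<ge> 0" by simp
  finally show ?thesis by simp
qed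

text \<open>Squaring the integral and passing to the variables \<open>u = \<xi> - \<eta>\<close>, \<open>\<eta>\<close> makes the phase linear
  in \<open>\<eta>\<close>, so that only the Fourier transform of a real Gaussian is needed.\<close>

lemma dispersive_estimate:
  fixes a y \<epsilon> :: real
  assumes \<epsilon>: "0 < \<epsilon>" and a: "a \<noteq> 0"
  shows "cmod (LINT \<xi>|lborel. cis (y * \<xi> - a * \<xi>\<^sup>2) * of_real (exp (- (\<epsilon> * \<xi>\<^sup>2)))) \<le> sqrt pi / sqrt \<bar>a\<bar>"
proof -
  define f where "f \<xi> = cis (y * \<xi> - a * \<xi>\<^sup>2) * of_real (exp (- (\<epsilon> * \<xi>\<^sup>2)))" for \<xi>
  define I where "I = (LINT \<xi>|lborel. f \<xi>)"
  have [measurable]: "f \<in> borel_measurable borel" unfolding f_def by measurable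
  have "cnj I = (LINT \<eta>|lborel. cnj (f \<eta>))"
    unfolding I_def by (rule Bochner_Integration.integral_cnj[symmetric])
  then have "I * cnj I = (LINT \<eta>|lborel. I * cnj (f \<eta>))" by (simp only: integral_mult_right_zero)
  also have "\<dots> = (LINT \<eta>|lborel. LINT u|lborel. f (\<eta> + u) * cnj (f \<eta>))"
  proof (intro Bochner_Integration.integral_cong refl)
    fix \<eta>
    have "I = (LINT u|lborel. f (\<eta> + u))"
      using lborel_integral_real_affine[of 1 f \<eta>] by (simp add: I_def)
    then show "I * cnj (f \<eta>) = (LINT u|lborel. f (\<eta> + u) * cnj (f \<eta>))"
      by (simp only: integral_mult_left_zero)
  qed
  also have "\<dots> = (LINT u|lborel. LINT \<eta>|lborel. f (\<eta> + u) * cnj (f \<eta>))"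
  proof (rule Fubini_bounded_by_product(1))
    show "integrable lborel (\<lambda>x. exp (- (\<epsilon> / 3 * x\<^sup>2)))" "integrable lborel (\<lambda>x. exp (- (\<epsilon> / 3 * x\<^sup>2)))"
      using gaussian_fourier(1)[of "\<epsilon> / 3"] \<epsilon> by auto
    show "cmod (f (\<eta> + u) * cnj (f \<eta>)) \<le> exp (- (\<epsilon> / 3 * \<eta>\<^sup>2)) * exp (- (\<epsilon> / 3 * u\<^sup>2))" for \<eta> u
      using mult_left_mono[OF quadratic_form_lower_bound[of u \<eta>] less_imp_le[OF \<epsilon>]]
      by (simp add: f_def norm_mult field_simps flip: exp_add)
  qed measurable
  finally have "(cmod I)\<^sup>2 = cmod (LINT u|lborel. LINT \<eta>|lborel. f (\<eta> + u) * cnj (f \<eta>))"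
    by (metis complex_mod_mult_cnj norm_mult complex_mod_cnj power2_eq_square)
  also have "\<dots> \<le> (LINT u|lborel. cmod (LINT \<eta>|lborel. f (\<eta> + u) * cnj (f \<eta>)))"
    by (rule integral_norm_bound)
  also have "\<dots> \<le> (LINT u|lborel. sqrt (pi / (2 * \<epsilon>)) * exp (- (a\<^sup>2 / (2 * \<epsilon>) * u\<^sup>2)))"
  proof (rule integral_mono')
    show "integrable lborel (\<lambda>u. sqrt (pi / (2 * \<epsilon>)) * exp (- (a\<^sup>2 / (2 * \<epsilon>) * u\<^sup>2)))"
      using \<epsilon> a by (intro integrable_mult_right gaussian_fourier(1)) simp
    show "0 \<le> sqrt (pi / (2 * \<epsilon>)) * exp (- (a\<^sup>2 / (2 * \<epsilon>) * u\<^sup>2))" for u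
      using \<epsilon> by simp
    show "cmod (LINT \<eta>|lborel. f (\<eta> + u) * cnj (f \<eta>)) \<le> sqrt (pi / (2 * \<epsilon>)) * exp (- (a\<^sup>2 / (2 * \<epsilon>) * u\<^sup>2))" for u
    proof -
      \<comment> \<open>With \<eta> = s - u/2 the two arguments become s + u/2 and s - u/2. The
        quadratic phases then differ by 2 a u s, and the Gaussian factors split into one in u and
        one in s.\<close>
      define z where "z = cis (y * u) * complex_of_real (exp (- (\<epsilon> * u\<^sup>2 / 2)))"
      have ptw: "f (- u / 2 + s + u) * cnj (f (- u / 2 + s)) = z * (cis (- (2 * a * u) * s) * of_real (exp (- ((2 * \<epsilon>) * s\<^sup>2))))" for s
      proof -
        have "y * (- u / 2 + s + u) - a * (- u / 2 + s + u)\<^sup>2 - (y * (- u / 2 + s) - a * (- u / 2 + s)\<^sup>2)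
            = y * u + - (2 * a * u) * s"
          by (simp add: power2_eq_square field_simps)
        moreover have "- (\<epsilon> * (- u / 2 + s + u)\<^sup>2) + - (\<epsilon> * (- u / 2 + s)\<^sup>2) = - (\<epsilon> * u\<^sup>2 / 2) + - ((2 * \<epsilon>) * s\<^sup>2)"
          by (simp add: power2_eq_square field_simps)
        moreover have "cis p * of_real (exp q) * cnj (cis p' * of_real (exp q')) = cis (p - p') * of_real (exp (q + q'))" for p q p' q'
          by (simp add: cis_cnj exp_add cis_divide[symmetric] cis_mult[symmetric] mult_ac divide_inverse flip: cis_inverse)
        moreover have "cis (p + p') * of_real (exp (q + q')) = (cis p * of_real (exp q)) * (cis p' * of_real (exp q'))" for p q p' q'
          by (simp add: exp_add cis_mult[symmetric])
        ultimately show ?thesis unfolding f_def z_def by presburger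
      qed
      have "(LINT \<eta>|lborel. f (\<eta> + u) * cnj (f \<eta>)) = (LINT s|lborel. f (- u / 2 + s + u) * cnj (f (- u / 2 + s)))"
        by (subst lborel_integral_real_affine[of 1 _ "- u / 2"]) auto
      also have "\<dots> = z * (LINT s|lborel. cis (- (2 * a * u) * s) * of_real (exp (- ((2 * \<epsilon>) * s\<^sup>2))))"
        unfolding ptw by (rule integral_mult_right_zero)
      also have "\<dots> = z * of_real (sqrt (pi / (2 * \<epsilon>)) * exp (- ((- (2 * a * u))\<^sup>2 / (4 * (2 * \<epsilon>)))))"
        using \<epsilon> by (subst gaussian_fourier(2)) simp_all
      finally have "cmod (LINT \<eta>|lborel. f (\<eta> + u) * cnj (f \<eta>))
          = exp (- (\<epsilon> * u\<^sup>2 / 2)) * (sqrt (pi / (2 * \<epsilon>)) * exp (- ((- (2 * a * u))\<^sup>2 / (4 * (2 * \<epsilon>)))))"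
        using \<epsilon> by (simp add: z_def norm_mult del: of_real_mult)
      also have "(- (2 * a * u))\<^sup>2 / (4 * (2 * \<epsilon>)) = a\<^sup>2 / (2 * \<epsilon>) * u\<^sup>2"
        by (simp add: power_mult_distrib)
      \<comment> \<open>Discarding this factor is harmless: the remaining Gaussian in u has total
        mass pi / |a|, independent of \<epsilon>.\<close>
      also have "exp (- (\<epsilon> * u\<^sup>2 / 2)) * (sqrt (pi / (2 * \<epsilon>)) * exp (- (a\<^sup>2 / (2 * \<epsilon>) * u\<^sup>2)))
          \<le> 1 * (sqrt (pi / (2 * \<epsilon>)) * exp (- (a\<^sup>2 / (2 * \<epsilon>) * u\<^sup>2)))"
        using \<epsilon> by (intro mult_right_mono) auto
      finally show ?thesis by simp
    qed
  qed
  also have "\<dots> = sqrt (pi / (2 * \<epsilon>)) * sqrt (pi / (a\<^sup>2 / (2 * \<epsilon>)))"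
    using \<epsilon> a by (subst integral_mult_right_zero, subst gaussian_integral) simp_all
  also have "\<dots> = pi / \<bar>a\<bar>"
  proof -
    have "pi / (2 * \<epsilon>) * (pi / (a\<^sup>2 / (2 * \<epsilon>))) = (pi / \<bar>a\<bar>)\<^sup>2"
      using \<epsilon> a by (simp add: power2_eq_square field_simps)
    then show ?thesis by (metis abs_ge_zero divide_nonneg_nonneg pi_ge_zero real_sqrt_mult real_sqrt_unique)
  qed
  also have "\<dots> = (sqrt pi / sqrt \<bar>a\<bar>)\<^sup>2" by (simp add: power_divide)
  finally have "cmod I \<le> sqrt pi / sqrt \<bar>a\<bar>"
    by (rule power2_le_imp_le) simp
  then show ?thesis by (simp add: I_def f_def)
qed

section \<open>Fractional integration\<close>

lemma nn_integral_even_bound: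
  fixes F :: "real \<Rightarrow> ennreal"
  assumes [measurable]: "F \<in> borel_measurable borel" and F: "\<And>t. F (- t) = F t"
  shows "(\<integral>\<^sup>+t. F t \<partial>lborel) \<le> 2 * (\<integral>\<^sup>+t. F t * indicator {0..} t \<partial>lborel)"
proof -
  have "(\<integral>\<^sup>+t. F t \<partial>lborel) \<le> (\<integral>\<^sup>+t. F t * indicator {0..} t + F (- t) * indicator {0..} (- t) \<partial>lborel)"
    by (intro nn_integral_mono) (auto simp: indicator_def F)
  also have "\<dots> = (\<integral>\<^sup>+t. F t * indicator {0..} t \<partial>lborel) + (\<integral>\<^sup>+t. F (- t) * indicator {0..} (- t) \<partial>lborel)"
    by (rule nn_integral_add) measurable
  also have "(\<integral>\<^sup>+t. F (- t) * indicator {0..} (- t) \<partial>lborel) = (\<integral>\<^sup>+t. F t * indicator {0..} t \<partial>lborel)"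
    by (subst (2) nn_integral_real_affine[of _ "- 1" 0]) auto
  finally show ?thesis by (simp add: mult_2)
qed

lemma nn_integral_inverse_sqrt:
  assumes \<delta>: "0 < \<delta>"
  shows "(\<integral>\<^sup>+t. ennreal (1 / sqrt \<bar>t\<bar>) * indicator {- \<delta>..\<delta>} t \<partial>lborel) \<le> ennreal (4 * sqrt \<delta>)"
proof -
  have "(\<integral>\<^sup>+t. ennreal (1 / sqrt \<bar>t\<bar>) * indicator {- \<delta>..\<delta>} t \<partial>lborel)
      \<le> 2 * (\<integral>\<^sup>+t. ennreal (1 / sqrt \<bar>t\<bar>) * indicator {- \<delta>..\<delta>} t * indicator {0..} t \<partial>lborel)"
    by (rule nn_integral_even_bound) (auto simp: indicator_def)
  \<comment> \<open>At t = 0 both integrands are 0 by the conventions for division and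
    \<open>powr\<close>.\<close>
  also have "(\<integral>\<^sup>+t. ennreal (1 / sqrt \<bar>t\<bar>) * indicator {- \<delta>..\<delta>} t * indicator {0..} t \<partial>lborel)
      = (\<integral>\<^sup>+t. ennreal (t powr (- 1 / 2)) * indicator {0..\<delta>} t \<partial>lborel)"
    using \<delta> by (intro nn_integral_cong)
      (auto simp: indicator_def powr_minus_divide powr_half_sqrt)
  also have "\<dots> = ennreal (\<delta> powr (- 1 / 2 + 1) / (- 1 / 2 + 1))"
    using \<delta> by (intro nn_integral_has_integral_lebesgue' has_integral_powr_from_0) auto
  also have "\<delta> powr (- 1 / 2 + 1) / (- 1 / 2 + 1) = 2 * sqrt \<delta>"
    using \<delta> by (simp add: powr_half_sqrt)
  also have "2 * ennreal (2 * sqrt \<delta>) = ennreal (4 * sqrt \<delta>)"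
    using \<delta> ennreal_mult[of 2 "2 * sqrt \<delta>"] by simp
  finally show ?thesis .
qed

lemma nn_integral_inverse_square:
  assumes \<delta>: "0 < \<delta>"
  shows "(\<integral>\<^sup>+t. ennreal (1 / t\<^sup>2) * indicator {t. \<delta> \<le> \<bar>t\<bar>} t \<partial>lborel) \<le> ennreal (2 / \<delta>)"
proof -
  have "(\<integral>\<^sup>+t. ennreal (1 / t\<^sup>2) * indicator {t. \<delta> \<le> \<bar>t\<bar>} t \<partial>lborel)
      \<le> 2 * (\<integral>\<^sup>+t. ennreal (1 / t\<^sup>2) * indicator {t. \<delta> \<le> \<bar>t\<bar>} t * indicator {0..} t \<partial>lborel)"
    by (rule nn_integral_even_bound) (auto simp: indicator_def)
  also have "(\<integral>\<^sup>+t. ennreal (1 / t\<^sup>2) * indicator {t. \<delta> \<le> \<bar>t\<bar>} t * indicator {0..} t \<partial>lborel)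
      = (\<integral>\<^sup>+t. ennreal (1 / t\<^sup>2) * indicator {\<delta>..} t \<partial>lborel)"
    using \<delta> by (intro nn_integral_cong) (auto simp: indicator_def)
  also have "\<dots> = ennreal (1 / (real (2 - 1) * \<delta> ^ (2 - 1)))"
    using \<delta> by (intro nn_integral_has_integral_lebesgue' has_integral_inverse_power_to_inf) auto
  also have "2 * \<dots> = ennreal (2 / \<delta>)"
    using \<delta> ennreal_mult[of 2 "1 / \<delta>"] by simp
  finally show ?thesis .
qed

lemma nn_integral_shift:
  fixes F :: "real \<Rightarrow> ennreal"
  assumes [measurable]: "F \<in> borel_measurable borel"
  shows "(\<integral>\<^sup>+t. F (t - s) \<partial>lborel) = (\<integral>\<^sup>+t. F t \<partial>lborel)"
  using nn_integral_real_affine[of F 1 "- s"] by simp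

text \<open>Young's inequality with exponents 4/3 and 4 and a free weight l. Comparing k with l g
  shows that one of the two terms alone already dominates.\<close>

lemma cube_mult_le:
  fixes g l k :: real assumes "0 \<le> g" "0 < l" "0 \<le> k"
  shows "g ^ 3 * k \<le> l * g ^ 4 + (1 / l ^ 3) * k ^ 4"
proof (cases "k \<le> l * g")
  case True
  then have "g ^ 3 * k \<le> g ^ 3 * (l * g)" using assms by (intro mult_left_mono) auto
  also have "\<dots> = l * g ^ 4" by (simp add: power_numeral_reduce)
  finally show ?thesis using assms by (simp add: add_increasing2)
next
  case False
  then have "g \<le> k / l" using assms by (simp add: field_simps)
  then have "g ^ 3 * k \<le> (k / l) ^ 3 * k" using assms by (intro mult_right_mono power_mono) auto
  also have "\<dots> = (1 / l ^ 3) * k ^ 4" by (simp add: power_divide power_numeral_reduce)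
  finally show ?thesis using assms by (simp add: add_increasing)
qed

text \<open>The splitting radius \<open>\<delta> = N\<^sup>4 / b\<^sup>4\<close> and the weight \<open>l = b / N\<^sup>2\<close> balance the near part,
  where \<open>min (G t) b \<le> b\<close>, against the far part, where \<open>cube_mult_le\<close> is used.\<close>

lemma truncated_fractional_integral:
  fixes G :: "real \<Rightarrow> real"
  assumes [measurable]: "G \<in> borel_measurable borel" and G: "\<And>t. 0 \<le> G t"
    and N: "0 < N" "(\<integral>\<^sup>+t. ennreal (G t ^ 4) \<partial>lborel) \<le> ennreal (N ^ 4)" and b: "0 < b"
  shows "(\<integral>\<^sup>+t. ennreal (min (G t) b ^ 3 / sqrt \<bar>t - s\<bar>) \<partial>lborel) \<le> ennreal (7 * b * N\<^sup>2)"
proof -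
  define \<delta> where "\<delta> = N ^ 4 / b ^ 4"
  define l where "l = b / N\<^sup>2"
  have pos: "0 < \<delta>" "0 < l" using N b by (auto simp: \<delta>_def l_def)
  define A where "A t = ennreal (1 / sqrt \<bar>t\<bar>) * indicator {- \<delta>..\<delta>} t" for t
  define B where "B t = ennreal (1 / t\<^sup>2) * indicator {t. \<delta> \<le> \<bar>t\<bar>} t" for t
  have [measurable]: "A \<in> borel_measurable borel" "B \<in> borel_measurable borel"
    unfolding A_def B_def by measurable
  have ptw: "ennreal (min (G t) b ^ 3 / sqrt \<bar>t - s\<bar>)
    \<le> ennreal (b ^ 3) * A (t - s) + (ennreal l * ennreal (G t ^ 4) + ennreal (1 / l ^ 3) * B (t - s))" for t
  proof (cases "\<bar>t - s\<bar> < \<delta>")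
    case True
    have "ennreal (min (G t) b ^ 3 / sqrt \<bar>t - s\<bar>) \<le> ennreal (b ^ 3 * (1 / sqrt \<bar>t - s\<bar>))"
      using G[of t] b by (auto intro!: ennreal_leI divide_right_mono power_mono)
    also have "\<dots> = ennreal (b ^ 3) * A (t - s)"
      using abs_le_D1[OF less_imp_le[OF True]] abs_le_D2[OF less_imp_le[OF True]] b
      by (simp add: A_def indicator_def flip: ennreal_mult)
    finally show ?thesis by (simp add: add_increasing2)
  next
    case False
    \<comment> \<open>Away from s the truncation is dropped: the fourth power of this kernel is the
      inverse square, which is integrable at infinity.\<close>
    define k where "k = 1 / sqrt \<bar>t - s\<bar>"
    have "k ^ 4 = (k\<^sup>2)\<^sup>2" by simp
    also have "\<dots> = 1 / (t - s)\<^sup>2" by (simp add: k_def power_divide)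
    finally have k4: "k ^ 4 = 1 / (t - s)\<^sup>2" .
    have "min (G t) b ^ 3 * k \<le> G t ^ 3 * k"
      using G[of t] b by (intro mult_right_mono power_mono) (auto simp: k_def)
    also have "\<dots> \<le> l * G t ^ 4 + (1 / l ^ 3) * k ^ 4"
      using G[of t] pos by (intro cube_mult_le) (auto simp: k_def)
    finally have "ennreal (min (G t) b ^ 3 * k) \<le> ennreal (l * G t ^ 4 + (1 / l ^ 3) * (1 / (t - s)\<^sup>2))"
      unfolding k4 by (rule ennreal_leI)
    also have "\<dots> = ennreal l * ennreal (G t ^ 4) + ennreal (1 / l ^ 3) * B (t - s)"
      using False pos G[of t] by (simp add: B_def indicator_def ennreal_mult' flip: ennreal_plus ennreal_mult')
    finally show ?thesis by (simp add: k_def add_increasing)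
  qed
  have "(\<integral>\<^sup>+t. ennreal (min (G t) b ^ 3 / sqrt \<bar>t - s\<bar>) \<partial>lborel)
    \<le> (\<integral>\<^sup>+t. ennreal (b ^ 3) * A (t - s) + (ennreal l * ennreal (G t ^ 4) + ennreal (1 / l ^ 3) * B (t - s)) \<partial>lborel)"
    by (intro nn_integral_mono ptw)
  also have "\<dots> = ennreal (b ^ 3) * (\<integral>\<^sup>+t. A t \<partial>lborel) + (ennreal l * (\<integral>\<^sup>+t. ennreal (G t ^ 4) \<partial>lborel)
      + ennreal (1 / l ^ 3) * (\<integral>\<^sup>+t. B t \<partial>lborel))"
    by (simp add: nn_integral_add nn_integral_cmult nn_integral_shift)
  also have "\<dots> \<le> ennreal (b ^ 3) * ennreal (4 * sqrt \<delta>) + (ennreal l * ennreal (N ^ 4) + ennreal (1 / l ^ 3) * ennreal (2 / \<delta>))"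
    unfolding A_def B_def
    by (intro add_mono mult_left_mono N nn_integral_inverse_sqrt nn_integral_inverse_square pos) auto
  also have "\<dots> = ennreal (b ^ 3 * (4 * sqrt \<delta>) + (l * N ^ 4 + 1 / l ^ 3 * (2 / \<delta>)))"
  proof -
    have "ennreal x * ennreal y + (ennreal z * ennreal v + ennreal p * ennreal q) = ennreal (x * y + (z * v + p * q))"
      if "0 \<le> x" "0 \<le> y" "0 \<le> z" "0 \<le> v" "0 \<le> p" "0 \<le> q" for x y z v p q
      using that by (simp add: ennreal_mult)
    then show ?thesis using pos b N by auto
  qed
  also have "sqrt \<delta> = N\<^sup>2 / b\<^sup>2"
    unfolding \<delta>_def by (rule real_sqrt_unique) (auto simp: power_divide)
  \<comment> \<open>The near part, the fourth-power term and the kernel tail contribute 4, 1 and 2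
    times \<open>b * N\<^sup>2\<close>.\<close>
  also have "b ^ 3 * (4 * (N\<^sup>2 / b\<^sup>2)) + (l * N ^ 4 + 1 / l ^ 3 * (2 / \<delta>)) = 7 * b * N\<^sup>2"
    using N b by (simp add: l_def \<delta>_def field_simps power_numeral_reduce)
  finally show ?thesis .
qed

text \<open>The bilinear Hardy-Littlewood-Sobolev inequality of order 1/2 for G^3, a function in
  L^(4/3). Each pair is charged to its larger value, say G s. The smaller value is then truncated at
  b = G s, and the previous lemma supplies a factor 7 G s N^2 that completes G s ^ 3 to an
  integrable fourth power. The two halves give 7 + 7 = 14.\<close>

lemma fractional_integration:
  fixes G :: "real \<Rightarrow> real"
  assumes Gm [measurable]: "G \<in> borel_measurable borel" and G: "\<And>t. 0 \<le> G t"
    and N: "0 < N" "(\<integral>\<^sup>+t. ennreal (G t ^ 4) \<partial>lborel) \<le> ennreal (N ^ 4)"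
  shows "(\<integral>\<^sup>+s. \<integral>\<^sup>+t. ennreal (G t ^ 3 * G s ^ 3 / sqrt \<bar>t - s\<bar>) \<partial>lborel \<partial>lborel) \<le> ennreal (14 * N ^ 6)"
proof -
  define F where "F t s = ennreal (G s ^ 3) * ennreal (min (G t) (G s) ^ 3 / sqrt \<bar>t - s\<bar>)" for t s
  have [measurable]: "case_prod F \<in> borel_measurable (borel \<Otimes>\<^sub>M borel)"
    unfolding F_def by measurable
  have F_le: "(\<integral>\<^sup>+t. F t s \<partial>lborel) \<le> ennreal (7 * N\<^sup>2) * ennreal (G s ^ 4)" for s
  proof (cases "G s = 0")
    case False
    then have b: "0 < G s" using G[of s] by simp
    have "(\<integral>\<^sup>+t. F t s \<partial>lborel) = ennreal (G s ^ 3) * (\<integral>\<^sup>+t. ennreal (min (G t) (G s) ^ 3 / sqrt \<bar>t - s\<bar>) \<partial>lborel)"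
      unfolding F_def by (rule nn_integral_cmult) measurable
    also have "\<dots> \<le> ennreal (G s ^ 3) * ennreal (7 * G s * N\<^sup>2)"
      by (intro mult_left_mono truncated_fractional_integral Gm G N b) simp
    also have "\<dots> = ennreal (7 * N\<^sup>2) * ennreal (G s ^ 4)"
      using G[of s] N by (simp flip: ennreal_mult add: power_numeral_reduce mult_ac)
    finally show ?thesis .
  qed (simp add: F_def)
  have F_int: "(\<integral>\<^sup>+s. \<integral>\<^sup>+t. F t s \<partial>lborel \<partial>lborel) \<le> ennreal (7 * N ^ 6)"
  proof -
    have "(\<integral>\<^sup>+s. \<integral>\<^sup>+t. F t s \<partial>lborel \<partial>lborel) \<le> (\<integral>\<^sup>+s. ennreal (7 * N\<^sup>2) * ennreal (G s ^ 4) \<partial>lborel)"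
      by (intro nn_integral_mono F_le)
    also have "\<dots> = ennreal (7 * N\<^sup>2) * (\<integral>\<^sup>+s. ennreal (G s ^ 4) \<partial>lborel)"
      by (rule nn_integral_cmult) measurable
    also have "\<dots> \<le> ennreal (7 * N\<^sup>2) * ennreal (N ^ 4)" by (intro mult_left_mono N) simp
    also have "\<dots> = ennreal (7 * N ^ 6)" using N by (simp flip: ennreal_mult power_add)
    finally show ?thesis .
  qed
  have ptw: "ennreal (G t ^ 3 * G s ^ 3 / sqrt \<bar>t - s\<bar>) \<le> F t s + F s t" for s t
  proof (cases "G t \<le> G s")
    case True
    then have "ennreal (G t ^ 3 * G s ^ 3 / sqrt \<bar>t - s\<bar>) = F t s"
      using G[of t] G[of s] by (simp add: F_def min_def mult_ac flip: ennreal_mult)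
    then show ?thesis by simp
  next
    case False
    then have "ennreal (G t ^ 3 * G s ^ 3 / sqrt \<bar>t - s\<bar>) = F s t"
      using G[of t] G[of s] by (simp add: F_def min_def mult_ac abs_minus_commute flip: ennreal_mult)
    then show ?thesis by simp
  qed
  have "(\<integral>\<^sup>+s. \<integral>\<^sup>+t. ennreal (G t ^ 3 * G s ^ 3 / sqrt \<bar>t - s\<bar>) \<partial>lborel \<partial>lborel)
      \<le> (\<integral>\<^sup>+s. \<integral>\<^sup>+t. F t s + F s t \<partial>lborel \<partial>lborel)"
    by (intro nn_integral_mono ptw)
  also have "\<dots> = (\<integral>\<^sup>+s. \<integral>\<^sup>+t. F t s \<partial>lborel \<partial>lborel) + (\<integral>\<^sup>+s. \<integral>\<^sup>+t. F s t \<partial>lborel \<partial>lborel)"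
    by (simp add: nn_integral_add)
  also have "(\<integral>\<^sup>+s. \<integral>\<^sup>+t. F s t \<partial>lborel \<partial>lborel) = (\<integral>\<^sup>+s. \<integral>\<^sup>+t. F t s \<partial>lborel \<partial>lborel)"
    by (rule lborel_pair.Fubini'[symmetric]) simp
  also have "(\<integral>\<^sup>+s. \<integral>\<^sup>+t. F t s \<partial>lborel \<partial>lborel) + (\<integral>\<^sup>+s. \<integral>\<^sup>+t. F t s \<partial>lborel \<partial>lborel)
      \<le> ennreal (7 * N ^ 6) + ennreal (7 * N ^ 6)"
    by (intro add_mono F_int)
  also have "\<dots> = ennreal (14 * N ^ 6)" using N by (simp flip: ennreal_plus)
  finally show ?thesis .
qed

section \<open>The Strichartz estimate\<close>

text \<open>If f is not integrable, its Bochner integral is 0 by convention. The iterated kernel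
  integrals below can therefore be estimated directly.\<close>

lemma norm_integral_le_nn_integral:
  fixes f :: "'a \<Rightarrow> 'b::{banach, second_countable_topology}"
  shows "ennreal (norm (integral\<^sup>L M f)) \<le> (\<integral>\<^sup>+x. ennreal (norm (f x)) \<partial>M)"
  by (cases "integrable M f") (auto simp: integral_norm_bound_ennreal not_integrable_integral_eq)

text \<open>X enters the phase difference only through its linear term in \<xi>, and the dispersive
  bound is uniform in that term and in the Gaussian weight. Fatou then removes the weight.\<close>

lemma oscillatory_norm_bound:
  fixes X :: "real \<Rightarrow> real"
  assumes c: "integrable lborel c" and X [measurable]: "X \<in> borel_measurable borel"
  shows "(\<integral>\<^sup>+\<xi>. ennreal ((cmod (oscillatory (\<lambda>r \<xi>. X r * \<xi> - r * \<xi>\<^sup>2) c \<xi>))\<^sup>2) \<partial>lborel)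
    \<le> ennreal (sqrt pi) * (\<integral>\<^sup>+r. \<integral>\<^sup>+s. ennreal (cmod (c s) * cmod (c r) / sqrt \<bar>s - r\<bar>) \<partial>lborel \<partial>lborel)"
proof -
  let ?\<theta> = "\<lambda>r \<xi>. X r * \<xi> - r * \<xi>\<^sup>2"
  let ?H = "oscillatory ?\<theta> c"
  let ?D = "\<integral>\<^sup>+r. \<integral>\<^sup>+s. ennreal (cmod (c s) * cmod (c r) / sqrt \<bar>s - r\<bar>) \<partial>lborel \<partial>lborel"
  have [measurable]: "c \<in> borel_measurable borel" using c by auto
  have \<theta> [measurable]: "case_prod ?\<theta> \<in> borel_measurable (borel \<Otimes>\<^sub>M borel)" by measurable
  have H [measurable]: "?H \<in> borel_measurable borel" by (rule oscillatory_measurable) measurable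
  define \<epsilon> where "\<epsilon> n = 1 / real (Suc n)" for n
  have \<epsilon>: "0 < \<epsilon> n" for n by (simp add: \<epsilon>_def)
  have \<epsilon>0: "\<epsilon> \<longlonglongrightarrow> 0" unfolding \<epsilon>_def by (rule LIMSEQ_Suc[OF lim_1_over_n])
  define w where "w n \<xi> = exp (- (\<epsilon> n * \<xi>\<^sup>2))" for n \<xi>
  have [measurable]: "w n \<in> borel_measurable borel" for n unfolding w_def by measurable
  have w: "integrable lborel (w n)" for n unfolding w_def by (rule gaussian_fourier(1)[OF \<epsilon>])
  have reg: "(\<integral>\<^sup>+\<xi>. ennreal ((cmod (?H \<xi>))\<^sup>2 * w n \<xi>) \<partial>lborel) \<le> ennreal (sqrt pi) * ?D" for n
  proof -
    let ?K = "\<lambda>r s. LINT \<xi>|lborel. cis (?\<theta> r \<xi> - ?\<theta> s \<xi>) * of_real (w n \<xi>)"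
    have K: "cmod (?K r s) \<le> sqrt pi / sqrt \<bar>s - r\<bar>" if "r \<noteq> s" for r s
    proof -
      have "?\<theta> r \<xi> - ?\<theta> s \<xi> = (X r - X s) * \<xi> - (r - s) * \<xi>\<^sup>2" for \<xi>
        by (simp add: algebra_simps)
      then show ?thesis
        using dispersive_estimate[OF \<epsilon>[of n], of "r - s" "X r - X s"] that
        by (simp add: w_def abs_minus_commute)
    qed
    have "integrable lborel (\<lambda>\<xi>. (cmod (?H \<xi>))\<^sup>2 * w n \<xi>)"
    proof (rule Bochner_Integration.integrable_bound)
      show "integrable lborel (\<lambda>\<xi>. (LINT r|lborel. cmod (c r))\<^sup>2 * w n \<xi>)" using w by simp
      show "AE \<xi> in lborel. norm ((cmod (?H \<xi>))\<^sup>2 * w n \<xi>) \<le> norm ((LINT r|lborel. cmod (c r))\<^sup>2 * w n \<xi>)"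
        by (intro AE_I2) (auto simp: abs_mult w_def intro!: mult_right_mono power_mono cmod_oscillatory_le)
    qed measurable
    then have "(\<integral>\<^sup>+\<xi>. ennreal ((cmod (?H \<xi>))\<^sup>2 * w n \<xi>) \<partial>lborel) = ennreal (LINT \<xi>|lborel. (cmod (?H \<xi>))\<^sup>2 * w n \<xi>)"
      by (rule nn_integral_eq_integral) (simp add: w_def)
    also have "\<dots> = ennreal (cmod (complex_of_real (LINT \<xi>|lborel. (cmod (?H \<xi>))\<^sup>2 * w n \<xi>)))"
      by (simp only: norm_of_real) (simp add: w_def Bochner_Integration.integral_nonneg)
    also have "complex_of_real (LINT \<xi>|lborel. (cmod (?H \<xi>))\<^sup>2 * w n \<xi>)
        = (LINT r|lborel. c r * (LINT s|lborel. cnj (c s) * ?K r s))"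
      by (rule weighted_oscillatory_norm[OF c \<theta> w]) (simp add: w_def)
    also have "ennreal (cmod \<dots>) \<le> (\<integral>\<^sup>+r. ennreal (cmod (c r * (LINT s|lborel. cnj (c s) * ?K r s))) \<partial>lborel)"
      by (rule norm_integral_le_nn_integral)
    also have "\<dots> \<le> (\<integral>\<^sup>+r. ennreal (sqrt pi) * (\<integral>\<^sup>+s. ennreal (cmod (c s) * cmod (c r) / sqrt \<bar>s - r\<bar>) \<partial>lborel) \<partial>lborel)"
    proof (rule nn_integral_mono)
      fix r
      have "ennreal (cmod (c r * (LINT s|lborel. cnj (c s) * ?K r s)))
          = ennreal (cmod (c r)) * ennreal (cmod (LINT s|lborel. cnj (c s) * ?K r s))"
        by (simp add: norm_mult ennreal_mult)
      also have "\<dots> \<le> ennreal (cmod (c r)) * (\<integral>\<^sup>+s. ennreal (cmod (cnj (c s) * ?K r s)) \<partial>lborel)"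
        by (intro mult_left_mono norm_integral_le_nn_integral) simp
      also have "\<dots> \<le> ennreal (cmod (c r)) * (\<integral>\<^sup>+s. ennreal (cmod (c s) * (sqrt pi / sqrt \<bar>s - r\<bar>)) \<partial>lborel)"
      proof (intro mult_left_mono nn_integral_mono_AE)
        \<comment> \<open>On the diagonal the majorant evaluates to 0 and the kernel bound can fail;
          the diagonal is a null set.\<close>
        have "AE s in lborel. s \<noteq> r" by (rule AE_lborel_singleton)
        then show "AE s in lborel. ennreal (cmod (cnj (c s) * ?K r s)) \<le> ennreal (cmod (c s) * (sqrt pi / sqrt \<bar>s - r\<bar>))"
        proof eventually_elim
          case (elim s)
          then show ?case
            unfolding norm_mult complex_mod_cnj by (intro ennreal_leI mult_left_mono K) auto
        qed
      qed simp
      also have "\<dots> = (\<integral>\<^sup>+s. ennreal (cmod (c r)) * ennreal (cmod (c s) * (sqrt pi / sqrt \<bar>s - r\<bar>)) \<partial>lborel)"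
        by (rule nn_integral_cmult[symmetric]) measurable
      also have "\<dots> = (\<integral>\<^sup>+s. ennreal (sqrt pi) * ennreal (cmod (c s) * cmod (c r) / sqrt \<bar>s - r\<bar>) \<partial>lborel)"
        by (intro nn_integral_cong) (simp add: mult_ac flip: ennreal_mult)
      also have "\<dots> = ennreal (sqrt pi) * (\<integral>\<^sup>+s. ennreal (cmod (c s) * cmod (c r) / sqrt \<bar>s - r\<bar>) \<partial>lborel)"
        by (rule nn_integral_cmult) measurable
      finally show "ennreal (cmod (c r * (LINT s|lborel. cnj (c s) * ?K r s)))
          \<le> ennreal (sqrt pi) * (\<integral>\<^sup>+s. ennreal (cmod (c s) * cmod (c r) / sqrt \<bar>s - r\<bar>) \<partial>lborel)" .
    qed
    also have "\<dots> = ennreal (sqrt pi) * ?D"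
      by (rule nn_integral_cmult) measurable
    finally show ?thesis .
  qed
  have "(\<integral>\<^sup>+\<xi>. ennreal ((cmod (?H \<xi>))\<^sup>2) \<partial>lborel) = (\<integral>\<^sup>+\<xi>. liminf (\<lambda>n. ennreal ((cmod (?H \<xi>))\<^sup>2 * w n \<xi>)) \<partial>lborel)"
  proof (rule nn_integral_cong)
    fix \<xi>
    have "(\<lambda>n. (cmod (?H \<xi>))\<^sup>2 * w n \<xi>) \<longlonglongrightarrow> (cmod (?H \<xi>))\<^sup>2 * exp (- (0 * \<xi>\<^sup>2))"
      unfolding w_def by (intro tendsto_intros \<epsilon>0)
    then have "(\<lambda>n. ennreal ((cmod (?H \<xi>))\<^sup>2 * w n \<xi>)) \<longlonglongrightarrow> ennreal ((cmod (?H \<xi>))\<^sup>2)"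
      by (intro tendsto_ennrealI) simp
    then show "ennreal ((cmod (?H \<xi>))\<^sup>2) = liminf (\<lambda>n. ennreal ((cmod (?H \<xi>))\<^sup>2 * w n \<xi>))"
      by (intro lim_imp_Liminf[symmetric]) auto
  qed
  also have "\<dots> \<le> liminf (\<lambda>n. \<integral>\<^sup>+\<xi>. ennreal ((cmod (?H \<xi>))\<^sup>2 * w n \<xi>) \<partial>lborel)"
    by (rule nn_integral_liminf) measurable
  also have "\<dots> \<le> ennreal (sqrt pi) * ?D"
    by (rule order_trans[OF Liminf_le_Limsup Limsup_bounded]) (simp, intro always_eventually allI reg)
  finally show ?thesis .
qed

section \<open>Waves with integrable frequency profile, evaluated at points\<close>

definition wave :: "(real \<Rightarrow> complex) \<Rightarrow> real \<Rightarrow> real \<Rightarrow> complex" where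
  "wave \<gamma> r x = fourier_integral 1 (\<lambda>\<xi>. cis (- (r * \<xi>\<^sup>2)) * \<gamma> \<xi>) x"

lemma wave_measurable [measurable]:
  assumes [measurable]: "\<gamma> \<in> borel_measurable borel"
  shows "case_prod (wave \<gamma>) \<in> borel_measurable (borel \<Otimes>\<^sub>M borel)"
  unfolding wave_def fourier_integral_def by measurable

lemma cmod_wave_le: "cmod (wave \<gamma> r x) \<le> (LINT \<xi>|lborel. cmod (\<gamma> \<xi>))"
proof -
  have "cmod (LINT \<xi>|lborel. cis (1 * (x * \<xi>)) * (cis (- (r * \<xi>\<^sup>2)) * \<gamma> \<xi>)) \<le> (LINT \<xi>|lborel. cmod (\<gamma> \<xi>))"
    by (rule order_trans[OF integral_norm_bound]) (simp add: norm_mult)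
  moreover have "1 / sqrt (2 * pi) \<le> 1" using pi_gt3 by (simp add: field_simps)
  ultimately have "1 / sqrt (2 * pi) * cmod (LINT \<xi>|lborel. cis (1 * (x * \<xi>)) * (cis (- (r * \<xi>\<^sup>2)) * \<gamma> \<xi>)) \<le> 1 * (LINT \<xi>|lborel. cmod (\<gamma> \<xi>))"
    by (intro mult_mono) auto
  then show ?thesis
    by (simp add: wave_def fourier_integral_def norm_mult norm_divide del: of_real_mult)
qed

text \<open>Dominated convergence with majorant |\<gamma>|. Continuity in x is what later reduces
  the supremum over all points to rational ones.\<close>

lemma continuous_wave:
  assumes \<gamma>: "integrable lborel \<gamma>"
  shows "continuous_on UNIV (wave \<gamma> r)"
  unfolding continuous_on_sequentially
proof (intro allI impI ballI, elim conjE)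
  fix X :: "nat \<Rightarrow> real" and x assume X: "X \<longlonglongrightarrow> x"
  have [measurable]: "\<gamma> \<in> borel_measurable borel" using \<gamma> by auto
  have "(\<lambda>n. LINT \<xi>|lborel. cis (1 * (X n * \<xi>)) * (cis (- (r * \<xi>\<^sup>2)) * \<gamma> \<xi>))
      \<longlonglongrightarrow> (LINT \<xi>|lborel. cis (1 * (x * \<xi>)) * (cis (- (r * \<xi>\<^sup>2)) * \<gamma> \<xi>))"
    by (rule integral_dominated_convergence[where w = "\<lambda>\<xi>. cmod (\<gamma> \<xi>)"])
       (use \<gamma> in \<open>auto simp: norm_mult intro!: tendsto_intros X\<close>)
  then show "(wave \<gamma> r \<circ> X) \<longlonglongrightarrow> wave \<gamma> r x"
    unfolding wave_def fourier_integral_def o_def by (rule tendsto_mult_left)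
qed

text \<open>The \<open>TT\<^sup>*\<close> argument along a measurable selection \<open>X\<close> of points; linearizing the supremum
  over \<open>x\<close> in this way avoids duality of mixed-norm spaces.\<close>

lemma strichartz_along_selection:
  assumes \<gamma>: "integrable lborel \<gamma>" "square_integrable \<gamma>" and X [measurable]: "X \<in> borel_measurable borel"
  shows "(\<integral>\<^sup>+r. ennreal ((indicator {- R..R} r * cmod (wave \<gamma> r (X r))) ^ 4) \<partial>lborel)
    \<le> ennreal (25 * norm (abs_L2 \<gamma>) ^ 4)"
proof -
  have [measurable]: "\<gamma> \<in> borel_measurable borel" using \<gamma> by auto
  define v where "v r = wave \<gamma> r (X r)" for r
  have v_meas [measurable]: "v \<in> borel_measurable borel" unfolding v_def by measurable
  define B where "B = (LINT \<xi>|lborel. cmod (\<gamma> \<xi>))"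
  have v_le: "cmod (v r) \<le> B" for r unfolding v_def B_def by (rule cmod_wave_le)
  \<comment> \<open>The time window makes M finite in advance, which the final cancellation needs;
    the resulting bound does not contain \<open>R\<close>.\<close>
  define I where "I = indicat_real {- R..R}"
  have [measurable]: "I \<in> borel_measurable borel" unfolding I_def by measurable
  have I: "I r = 0 \<or> I r = 1" for r by (simp add: I_def indicator_def)
  have int_I: "integrable lborel I"
    unfolding I_def by (intro integrable_real_indicator) (auto simp: emeasure_lborel_Icc_eq)
  define G where "G r = I r * cmod (v r)" for r
  have [measurable]: "G \<in> borel_measurable borel" unfolding G_def by measurable
  have G0: "0 \<le> G r" for r using I[of r] by (auto simp: G_def)
  have G_le: "G r ^ k \<le> B ^ k * I r" if "0 < k" for r k
    using I[of r] that v_le[of r] by (auto simp: G_def power_0_left intro!: power_mono)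
  have int_G: "integrable lborel (\<lambda>r. G r ^ k)" if "0 < k" for k
    by (rule Bochner_Integration.integrable_bound[OF integrable_mult_right[OF int_I, of "B ^ k"]])
       (use G_le[OF that] G0 in \<open>auto intro: order_trans[OF _ abs_ge_self]\<close>)
  define M where "M = (LINT r|lborel. G r ^ 4)"
  have M: "(\<integral>\<^sup>+r. ennreal (G r ^ 4) \<partial>lborel) = ennreal M"
    unfolding M_def using G0 by (intro nn_integral_eq_integral int_G) auto
  have M0: "0 \<le> M" unfolding M_def by (rule Bochner_Integration.integral_nonneg) simp
  have "M \<le> 25 * norm (abs_L2 \<gamma>) ^ 4"
  proof (cases "M = 0")
    case False
    define N where "N = root 4 M"
    have N: "0 < N" "N ^ 4 = M" using M0 False by (auto simp: N_def)
    \<comment> \<open>The dual function: it has modulus G^3 and the conjugate phase of v, so its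
      product with v is exactly G^4.\<close>
    define c where "c r = of_real (G r ^ 2 * I r) * cnj (v r)" for r
    have [measurable]: "c \<in> borel_measurable borel" unfolding c_def by measurable
    have cmod_c: "cmod (c r) = G r ^ 3" for r
      using I[of r] by (auto simp: c_def G_def norm_mult power_numeral_reduce)
    have c_v: "c r * v r = of_real (G r ^ 4)" for r
    proof -
      have "cnj (v r) * v r = (of_real (cmod (v r)))\<^sup>2"
        by (simp add: complex_norm_square mult.commute flip: of_real_power)
      then show ?thesis
        using I[of r] by (auto simp: c_def G_def power_numeral_reduce)
    qed
    have int_c: "integrable lborel c"
      by (rule Bochner_Integration.integrable_bound[OF int_G[of 3]]) (auto simp: cmod_c)
    define H where "H = oscillatory (\<lambda>r \<xi>. X r * \<xi> - r * \<xi>\<^sup>2) c"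
    have [measurable]: "H \<in> borel_measurable borel" unfolding H_def by (rule oscillatory_measurable) measurable
    have "(\<integral>\<^sup>+\<xi>. ennreal ((cmod (H \<xi>))\<^sup>2) \<partial>lborel)
        \<le> ennreal (sqrt pi) * (\<integral>\<^sup>+r. \<integral>\<^sup>+s. ennreal (cmod (c s) * cmod (c r) / sqrt \<bar>s - r\<bar>) \<partial>lborel \<partial>lborel)"
      unfolding H_def by (rule oscillatory_norm_bound[OF int_c X])
    also have "\<dots> \<le> ennreal (sqrt pi) * ennreal (14 * N ^ 6)"
      unfolding cmod_c using N G0 by (intro mult_left_mono fractional_integration) (auto simp: M)
    also have "\<dots> = ennreal (sqrt pi * (14 * N ^ 6))" using N by (simp add: ennreal_mult)
    finally have H_bd: "(\<integral>\<^sup>+\<xi>. ennreal ((cmod (H \<xi>))\<^sup>2) \<partial>lborel) \<le> ennreal (sqrt pi * (14 * N ^ 6))" .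
    have sq_H: "square_integrable (\<lambda>\<xi>. cnj (H \<xi>))"
      unfolding square_integrable_def
      by (auto intro!: integrableI_nonneg le_less_trans[OF H_bd])
    have norm_H: "(norm (abs_L2 (\<lambda>\<xi>. cnj (H \<xi>))))\<^sup>2 \<le> sqrt pi * (14 * N ^ 6)"
    proof -
      have "ennreal ((norm (abs_L2 (\<lambda>\<xi>. cnj (H \<xi>))))\<^sup>2) = (\<integral>\<^sup>+\<xi>. ennreal ((cmod (H \<xi>))\<^sup>2) \<partial>lborel)"
        using integrable_cmod_sq[OF sq_H]
        by (simp add: norm_abs_L2_sq[OF sq_H] nn_integral_eq_integral)
      then have "ennreal ((norm (abs_L2 (\<lambda>\<xi>. cnj (H \<xi>))))\<^sup>2) \<le> ennreal (sqrt pi * (14 * N ^ 6))"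
        using H_bd by simp
      then show ?thesis using N by (subst (asm) ennreal_le_iff) auto
    qed
    let ?C = "1 / sqrt (2 * pi)"
    let ?F = "\<lambda>r \<xi>. c r * (cis (X r * \<xi> - r * \<xi>\<^sup>2) * \<gamma> \<xi>)"
    have le1: "cmod (?F r \<xi>) \<le> cmod (c r) * cmod (\<gamma> \<xi>)" for r \<xi> by (simp add: norm_mult)
    have le2: "cmod (?F r \<xi>) \<le> cmod (\<gamma> \<xi>) * cmod (c r)" for r \<xi> by (simp add: norm_mult)
    have "case_prod ?F \<in> borel_measurable (lborel \<Otimes>\<^sub>M lborel)" by measurable
    note fub = Fubini_bounded_by_product(1)[OF this integrable_norm[OF int_c] integrable_norm[OF \<gamma>(1)] le1]
    have "(\<lambda>(\<xi>, r). ?F r \<xi>) \<in> borel_measurable (lborel \<Otimes>\<^sub>M lborel)" by measurable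
    note fub2 = Fubini_bounded_by_product(2)[OF this integrable_norm[OF \<gamma>(1)] integrable_norm[OF int_c] le2]
    have Hg: "(LINT r|lborel. ?F r \<xi>) = \<gamma> \<xi> * H \<xi>" for \<xi>
    proof -
      have "(LINT r|lborel. ?F r \<xi>) = (LINT r|lborel. \<gamma> \<xi> * (c r * cis (X r * \<xi> - r * \<xi>\<^sup>2)))"
        by (intro Bochner_Integration.integral_cong refl) (simp only: mult_ac)
      then show ?thesis by (simp only: integral_mult_right_zero H_def oscillatory_def)
    qed
    have vF: "c r * v r = of_real ?C * (LINT \<xi>|lborel. ?F r \<xi>)" for r
    proof -
      have eq: "cis (1 * (X r * \<xi>)) * (cis (- (r * \<xi>\<^sup>2)) * \<gamma> \<xi>) = cis (X r * \<xi> - r * \<xi>\<^sup>2) * \<gamma> \<xi>" for \<xi>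
        by (simp add: cis_mult flip: mult.assoc)
      show ?thesis
        unfolding v_def wave_def fourier_integral_def integral_mult_right_zero eq by simp
    qed
    \<comment> \<open>The duality of TT* in scalar form: moving the evaluation at X off \<gamma>
      expresses M as a pairing of \<gamma> with the synthesized function H.\<close>
    have "complex_of_real M = (LINT r|lborel. c r * v r)"
      unfolding M_def c_v by (rule integral_complex_of_real[symmetric])
    also have "\<dots> = of_real ?C * (LINT r|lborel. LINT \<xi>|lborel. ?F r \<xi>)"
      unfolding vF by (rule integral_mult_right_zero)
    also have "\<dots> = of_real ?C * (LINT \<xi>|lborel. \<gamma> \<xi> * H \<xi>)"
      unfolding fub Hg ..
    finally have M_eq: "complex_of_real M = of_real ?C * (LINT \<xi>|lborel. \<gamma> \<xi> * H \<xi>)" .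
    have "Re (of_real x * z) = x * Re z" for x z by simp
    then have "M = ?C * Re (LINT \<xi>|lborel. \<gamma> \<xi> * H \<xi>)"
      using arg_cong[OF M_eq, of Re] by (simp only: Re_complex_of_real)
    also have "Re (LINT \<xi>|lborel. \<gamma> \<xi> * H \<xi>) = (LINT \<xi>|lborel. inner (\<gamma> \<xi>) (cnj (H \<xi>)))"
      using fub2 unfolding Hg by (simp add: inner_complex_def flip: integral_Re)
    also have "\<dots> = inner (abs_L2 \<gamma>) (abs_L2 (\<lambda>\<xi>. cnj (H \<xi>)))"
      by (rule inner_L2_abs[symmetric, OF \<gamma>(2) sq_H])
    finally have "M \<le> ?C * (norm (abs_L2 \<gamma>) * norm (abs_L2 (\<lambda>\<xi>. cnj (H \<xi>))))"
      using norm_cauchy_schwarz[of "abs_L2 \<gamma>" "abs_L2 (\<lambda>\<xi>. cnj (H \<xi>))"]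
      by (simp add: divide_right_mono)
    then have "M\<^sup>2 \<le> (?C * (norm (abs_L2 \<gamma>) * norm (abs_L2 (\<lambda>\<xi>. cnj (H \<xi>)))))\<^sup>2"
      using M0 by (rule power_mono)
    also have "\<dots> = ?C\<^sup>2 * (norm (abs_L2 \<gamma>))\<^sup>2 * (norm (abs_L2 (\<lambda>\<xi>. cnj (H \<xi>))))\<^sup>2"
      by (simp only: power_mult_distrib mult.assoc)
    also have "\<dots> \<le> ?C\<^sup>2 * (norm (abs_L2 \<gamma>))\<^sup>2 * (sqrt pi * (14 * N ^ 6))"
      by (intro mult_left_mono norm_H) simp
    \<comment> \<open>Here 14 sqrt pi / (2 pi) = 7 / sqrt pi. It is rounded up to 5, whose square is
      the constant 25 of the statement.\<close>
    also have "\<dots> = (7 / sqrt pi) * ((norm (abs_L2 \<gamma>))\<^sup>2 * N ^ 6)"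
    proof -
      have "?C\<^sup>2 = 1 / (2 * pi)" by (simp add: power_divide)
      moreover have "sqrt pi / pi = 1 / sqrt pi" by (simp add: real_div_sqrt divide_simps)
      ultimately show ?thesis by (simp add: field_simps)
    qed
    also have "\<dots> \<le> 5 * ((norm (abs_L2 \<gamma>))\<^sup>2 * N ^ 6)"
    proof (intro mult_right_mono)
      have "7 / 5 \<le> sqrt pi" using pi_gt3 by (intro real_le_rsqrt) (simp add: power2_eq_square)
      then show "7 / sqrt pi \<le> 5" by (simp add: field_simps)
    qed simp
    also have "M\<^sup>2 = N\<^sup>2 * N ^ 6"
    proof -
      have "M\<^sup>2 = (N ^ 4)\<^sup>2" by (simp only: N(2))
      also have "\<dots> = N\<^sup>2 * N ^ 6" by (simp only: power_mult[symmetric] power_add[symmetric]) simp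
      finally show ?thesis .
    qed
    \<comment> \<open>The estimate bounds N^8 by a multiple of N^6; cancelling N^6 is legitimate
      because N is positive and finite.\<close>
    finally have "N\<^sup>2 * N ^ 6 \<le> (5 * (norm (abs_L2 \<gamma>))\<^sup>2) * N ^ 6"
      by (simp only: mult.assoc)
    then have "N\<^sup>2 \<le> 5 * (norm (abs_L2 \<gamma>))\<^sup>2"
      by (rule mult_right_le_imp_le) (use N(1) in simp)
    then have "(N\<^sup>2)\<^sup>2 \<le> (5 * (norm (abs_L2 \<gamma>))\<^sup>2)\<^sup>2" by (rule power_mono) simp
    also have "(N\<^sup>2)\<^sup>2 = M" using N(2) by simp
    also have "(5 * (norm (abs_L2 \<gamma>))\<^sup>2)\<^sup>2 = 25 * norm (abs_L2 \<gamma>) ^ 4"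
      by (simp add: power_mult_distrib)
    finally show ?thesis .
  qed simp
  then show ?thesis
    using M by (simp add: G_def I_def v_def ennreal_leI)
qed

section \<open>From measurable selections to the supremum over space\<close>

primrec greedy_selection :: "(real \<Rightarrow> real \<Rightarrow> complex) \<Rightarrow> (nat \<Rightarrow> real) \<Rightarrow> nat \<Rightarrow> real \<Rightarrow> real" where
  "greedy_selection w q 0 r = q 0"
| "greedy_selection w q (Suc n) r =
     (if cmod (w r (greedy_selection w q n r)) < cmod (w r (q (Suc n))) then q (Suc n)
      else greedy_selection w q n r)"

text \<open>The running maximizer among q 0, ..., q n involves only finitely many measurable
  comparisons, so no measurable selection theorem enters.\<close>

lemma greedy_selection_measurable [measurable]:
  assumes [measurable]: "case_prod w \<in> borel_measurable (borel \<Otimes>\<^sub>M borel)"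
  shows "greedy_selection w q n \<in> borel_measurable borel"
proof (induction n)
  case 0
  have "greedy_selection w q 0 = (\<lambda>r. q 0)" by (simp add: fun_eq_iff)
  then show ?case by simp
next
  case (Suc n)
  note [measurable] = Suc
  show ?case unfolding greedy_selection.simps[abs_def] by measurable
qed

lemma greedy_selection_le:
  "m \<le> n \<Longrightarrow> cmod (w r (greedy_selection w q m r)) \<le> cmod (w r (greedy_selection w q n r))"
  by (induction rule: dec_induct) auto

lemma greedy_selection_max: "cmod (w r (q n)) \<le> cmod (w r (greedy_selection w q n r))"
  by (cases n) auto

text \<open>Running maxima along an enumeration of the rationals increase to the supremum over
  rational points, which bounds all points by continuity. The constant is common to all selections,
  so monotone convergence preserves it. As a countable supremum, V is measurable.\<close>

lemma strichartz_compact_frequency: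
  assumes \<gamma>: "integrable lborel \<gamma>" "square_integrable \<gamma>"
  shows "\<exists>V. V \<in> borel_measurable borel \<and> (\<forall>r x. ennreal (cmod (wave \<gamma> r x) ^ 4) \<le> V r) \<and>
    (\<integral>\<^sup>+r. V r \<partial>lborel) \<le> ennreal (25 * norm (abs_L2 \<gamma>) ^ 4)"
proof -
  have [measurable]: "\<gamma> \<in> borel_measurable borel" using \<gamma> by auto
  define q :: "nat \<Rightarrow> real" where "q n = of_rat (from_nat n)" for n
  define X where "X = greedy_selection (wave \<gamma>) q"
  have [measurable]: "X n \<in> borel_measurable borel" for n unfolding X_def by measurable
  define G where "G n r = indicator {- real n..real n} r * cmod (wave \<gamma> r (X n r))" for n r
  have [measurable]: "G n \<in> borel_measurable borel" for n unfolding G_def by measurable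
  define V where "V r = (SUP n. ennreal (G n r ^ 4))" for r
  have mono: "G m r ^ 4 \<le> G n r ^ 4" if "m \<le> n" for m n r
  proof (rule power_mono)
    show "G m r \<le> G n r"
      unfolding G_def X_def using that greedy_selection_le[OF that, of "wave \<gamma>" r q]
      by (intro mult_mono) (auto simp: indicator_def)
    show "0 \<le> G m r" by (simp add: G_def)
  qed
  have q_le: "ennreal (cmod (wave \<gamma> r (q j)) ^ 4) \<le> V r" for r j
  proof -
    obtain n0 :: nat where n0: "\<bar>r\<bar> \<le> real n0" using real_arch_simple by blast
    \<comment> \<open>The index must put r into the time window and also be late enough for q j to
      have been compared.\<close>
    define n where "n = max n0 j"
    have "cmod (wave \<gamma> r (q j)) \<le> cmod (wave \<gamma> r (X n r))"
      unfolding X_def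
      by (rule order_trans[OF greedy_selection_max greedy_selection_le]) (simp add: n_def)
    also have "\<dots> = G n r" using n0 by (auto simp: G_def n_def indicator_def)
    finally have "ennreal (cmod (wave \<gamma> r (q j)) ^ 4) \<le> ennreal (G n r ^ 4)"
      by (intro ennreal_leI power_mono) auto
    then show ?thesis unfolding V_def by (rule SUP_upper2[OF UNIV_I])
  qed
  have all_le: "ennreal (cmod (wave \<gamma> r x) ^ 4) \<le> V r" for r x
  proof -
    define S where "S = {x. ennreal (cmod (wave \<gamma> r x) ^ 4) \<le> V r}"
    have "continuous_on UNIV (\<lambda>x. ennreal (cmod (wave \<gamma> r x) ^ 4))"
      by (intro continuous_on_ennreal continuous_intros continuous_wave \<gamma>)
    then have "closed S"
      unfolding S_def by (intro closed_Collect_le continuous_intros)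
    moreover have "\<rat> \<subseteq> S"
    proof
      fix y :: real assume "y \<in> \<rat>"
      then obtain p where "y = of_rat p" by (auto elim: Rats_cases)
      then have "y = q (to_nat p)" by (simp add: q_def)
      then show "y \<in> S" using q_le by (simp add: S_def)
    qed
    ultimately have "closure \<rat> \<subseteq> S" by (rule closure_minimal[rotated])
    then show ?thesis by (auto simp: S_def Rats_closure_real)
  qed
  have "(\<integral>\<^sup>+r. V r \<partial>lborel) = (SUP n. \<integral>\<^sup>+r. ennreal (G n r ^ 4) \<partial>lborel)"
    unfolding V_def by (rule nn_integral_monotone_convergence_SUP) (auto simp: incseq_def le_fun_def intro!: ennreal_leI mono)
  also have "\<dots> \<le> ennreal (25 * norm (abs_L2 \<gamma>) ^ 4)"
    unfolding G_def by (intro SUP_least strichartz_along_selection \<gamma>) auto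
  finally have "(\<integral>\<^sup>+r. V r \<partial>lborel) \<le> ennreal (25 * norm (abs_L2 \<gamma>) ^ 4)" .
  moreover have "V \<in> borel_measurable borel" unfolding V_def by measurable
  ultimately show ?thesis using all_le by blast
qed

section \<open>The fourth power of the essential supremum on L^2\<close>

definition sup4 :: "L2 \<Rightarrow> ennreal" where
  "sup4 f = esssup lborel (\<lambda>x. ennreal (cmod (rep_L2 f x) ^ 4))"

lemma AE_sup4: "AE x in lborel. ennreal (cmod (rep_L2 f x) ^ 4) \<le> sup4 f"
  unfolding sup4_def by (rule esssup_AE)

lemma sup4_le_iff: "sup4 f \<le> a \<longleftrightarrow> (AE x in lborel. ennreal (cmod (rep_L2 f x) ^ 4) \<le> a)"
proof
  assume "sup4 f \<le> a"
  with AE_sup4[of f] show "AE x in lborel. ennreal (cmod (rep_L2 f x) ^ 4) \<le> a"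
    by (auto elim: eventually_mono)
qed (auto simp: sup4_def intro!: esssup_I)

lemma sup4_abs_le:
  assumes "square_integrable F" "\<And>x. ennreal (cmod (F x) ^ 4) \<le> a"
  shows "sup4 (abs_L2 F) \<le> a"
  unfolding sup4_le_iff using rep_abs_L2[OF assms(1)] by eventually_elim (simp add: assms(2))

text \<open>The excess of |f| over c is at most |f - X n| almost everywhere, so its L^2 norm is
  bounded by distances tending to 0.\<close>

lemma closed_L2_bounded: "closed {f. AE x in lborel. cmod (rep_L2 f x) \<le> c}"
  unfolding closed_sequential_limits
proof (intro allI impI CollectI, elim conjE)
  fix X :: "nat \<Rightarrow> L2" and f
  assume X: "\<forall>n. X n \<in> {f. AE x in lborel. cmod (rep_L2 f x) \<le> c}" "X \<longlonglongrightarrow> f"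
  let ?E = "\<lambda>x. ennreal ((max 0 (cmod (rep_L2 f x) - c))\<^sup>2)"
  have le: "(\<integral>\<^sup>+x. ?E x \<partial>lborel) \<le> ennreal ((dist f (X n))\<^sup>2)" for n
  proof -
    have "AE x in lborel. ?E x \<le> ennreal ((cmod (rep_L2 f x - rep_L2 (X n) x))\<^sup>2)"
      using X(1)[rule_format, of n, unfolded mem_Collect_eq]
    proof eventually_elim
      case (elim x)
      have "cmod (rep_L2 f x) \<le> cmod (rep_L2 f x - rep_L2 (X n) x) + cmod (rep_L2 (X n) x)"
        by (metis diff_add_cancel norm_triangle_ineq)
      with elim show ?case by (intro ennreal_leI power_mono) auto
    qed
    then show ?thesis unfolding dist_L2_sq_nn by (rule nn_integral_mono_AE)
  qed
  have "(\<lambda>n. dist (X n) f) \<longlonglongrightarrow> 0" using X(2) by (subst (asm) tendsto_dist_iff)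
  then have "(\<lambda>n. ennreal ((dist f (X n))\<^sup>2)) \<longlonglongrightarrow> ennreal (0\<^sup>2)"
    by (intro tendsto_ennrealI tendsto_power) (simp add: dist_commute)
  then have "(\<integral>\<^sup>+x. ?E x \<partial>lborel) \<le> ennreal (0\<^sup>2)"
    by (rule LIMSEQ_le_const) (use le in blast)
  then have "(\<integral>\<^sup>+x. ?E x \<partial>lborel) = 0" by simp
  then have "AE x in lborel. ?E x = 0" by (subst (asm) nn_integral_0_iff_AE) auto
  then show "AE x in lborel. cmod (rep_L2 f x) \<le> c"
    by eventually_elim (auto simp: max_def split: if_splits)
qed

text \<open>Closed sublevel sets provide both Borel measurability and lower semicontinuity of
  \<open>sup4\<close>.\<close>

lemma closed_sup4: "closed {f. sup4 f \<le> a}"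
proof (cases a)
  case (real \<alpha>)
  have "cmod z ^ 4 \<le> \<alpha> \<longleftrightarrow> cmod z \<le> root 4 \<alpha>" for z
    using real(1) real_root_le_iff[of 4 "cmod z ^ 4" \<alpha>] by (simp add: real_root_power_cancel)
  then have "{f. sup4 f \<le> a} = {f. AE x in lborel. cmod (rep_L2 f x) \<le> root 4 \<alpha>}"
    using real by (simp add: sup4_le_iff)
  then show ?thesis by (simp add: closed_L2_bounded)
qed simp

lemma sup4_measurable [measurable]: "sup4 \<in> borel_measurable borel"
  by (rule borel_measurableI_le) (simp add: closed_sup4 borel_closed)

lemma sup4_lower_semicontinuous:
  assumes "X \<longlonglongrightarrow> f" shows "sup4 f \<le> liminf (\<lambda>n. sup4 (X n))"
  unfolding le_Liminf_iff
proof (intro allI impI)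
  fix a assume a: "a < sup4 f"
  have "open {f. a < sup4 f}" using closed_sup4[of a] by (simp add: closed_def Compl_eq not_le)
  from topological_tendstoD[OF assms this] a show "\<forall>\<^sub>F n in sequentially. a < sup4 (X n)" by simp
qed

text \<open>Truncating the Fourier transform of f puts it within reach of the pointwise estimate.
  For each r the truncated waves converge in L^2; lower semicontinuity and Fatou carry the bound to
  the limit.\<close>

theorem strichartz:
  "(\<integral>\<^sup>+r. sup4 (free_schroedinger r f) \<partial>lborel) \<le> ennreal (25 * norm f ^ 4)"
proof -
  define g where "g = fourier_op (- 1) f"
  define \<gamma> where "\<gamma> n = cutoff n g" for n
  define F where "F n = fourier_op 1 (abs_L2 (\<gamma> n))" for n
  have f: "fourier_op 1 g = f" using fourier_op_inverse[of "- 1" f] by (simp add: g_def)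
  have lim: "(\<lambda>n. abs_L2 (\<gamma> n)) \<longlonglongrightarrow> g" unfolding \<gamma>_def by (rule cutoff_tendsto)
  have "(\<lambda>n. free_schroedinger r (F n)) \<longlonglongrightarrow> free_schroedinger r f" for r
    using lim unfolding f[symmetric] F_def
    by (simp add: tendsto_dist_iff[of _ g] tendsto_dist_iff[of _ "free_schroedinger r (fourier_op 1 g)"]
        dist_fourier_op dist_free_schroedinger)
  note lsc = sup4_lower_semicontinuous[OF this]
  have meas [measurable]: "(\<lambda>r. sup4 (free_schroedinger r h)) \<in> borel_measurable lborel" for h
    using measurable_free_schroedinger[of "\<lambda>r. h" "\<lambda>r. r"]
    by (intro measurable_compose[OF _ sup4_measurable]) auto
  have bd: "(\<integral>\<^sup>+r. sup4 (free_schroedinger r (F n)) \<partial>lborel) \<le> ennreal (25 * norm (abs_L2 (\<gamma> n)) ^ 4)" for n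
  proof -
    obtain V where V: "V \<in> borel_measurable borel" "\<And>r x. ennreal (cmod (wave (\<gamma> n) r x) ^ 4) \<le> V r"
      "(\<integral>\<^sup>+r. V r \<partial>lborel) \<le> ennreal (25 * norm (abs_L2 (\<gamma> n)) ^ 4)"
      using strichartz_compact_frequency[of "\<gamma> n"] by (auto simp: \<gamma>_def integrable_cutoff)
    have "sup4 (free_schroedinger r (F n)) \<le> V r" for r
    proof -
      have int: "integrable lborel (\<lambda>\<xi>. cis (- (r * \<xi>\<^sup>2)) * \<gamma> n \<xi>)"
        unfolding \<gamma>_def
        by (rule Bochner_Integration.integrable_bound[OF integrable_cutoff[of n g]]) (auto simp: norm_mult)
      have "free_schroedinger r (F n) = abs_L2 (wave (\<gamma> n) r)"
        unfolding F_def \<gamma>_def free_schroedinger_cutoff by (simp add: wave_def[abs_def])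
      moreover have "square_integrable (wave (\<gamma> n) r)"
        unfolding wave_def[abs_def] using plancherel_L1_L2(1)[OF int square_integrable_cis, of 1]
        by (simp add: \<gamma>_def)
      ultimately show ?thesis by (simp add: sup4_abs_le V(2))
    qed
    then show ?thesis by (intro order_trans[OF nn_integral_mono V(3)])
  qed
  have "(\<integral>\<^sup>+r. sup4 (free_schroedinger r f) \<partial>lborel) \<le> (\<integral>\<^sup>+r. liminf (\<lambda>n. sup4 (free_schroedinger r (F n))) \<partial>lborel)"
    by (intro nn_integral_mono lsc)
  also have "\<dots> \<le> liminf (\<lambda>n. \<integral>\<^sup>+r. sup4 (free_schroedinger r (F n)) \<partial>lborel)"
    by (rule nn_integral_liminf) measurable
  also have "\<dots> \<le> liminf (\<lambda>n. ennreal (25 * norm (abs_L2 (\<gamma> n)) ^ 4))"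
    by (intro Liminf_mono always_eventually allI bd)
  also have "\<dots> = ennreal (25 * norm g ^ 4)"
    by (intro lim_imp_Liminf tendsto_ennrealI tendsto_intros lim) simp
  finally show ?thesis by (simp add: g_def norm_fourier_op)
qed

section \<open>The nonlinearity\<close>

text \<open>Near 0 the bound on h' allows a singularity like 1/a, but the increment of h is
  multiplied only by the smaller modulus |z|. At the mean value point a > |z|, so |h'(a)| |z| is at
  most |h'(a)| a, which the hypothesis bounds by C (1 + a^p).\<close>

lemma P_locally_lipschitz:
  fixes h h' :: "real \<Rightarrow> real" and P :: "complex \<Rightarrow> complex" and p C :: real
  assumes h_deriv: "\<And>a. a > 0 \<Longrightarrow> (h has_real_derivative h' a) (at a)"
    and p: "0 \<le> p"
    and h_bound: "\<And>a. a \<ge> 0 \<Longrightarrow> \<bar>h a\<bar> \<le> C * (1 + a powr p)"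
    and h'_bound: "\<And>a. a > 0 \<Longrightarrow> \<bar>h' a\<bar> \<le> C * (1 / a + a powr (p - 1))"
    and P: "\<And>z. P z = of_real (h (cmod z)) * z"
  shows "cmod (P z - P w) \<le> 2 * C * (1 + max (cmod z) (cmod w) powr p) * cmod (z - w)"
proof -
  have C: "0 \<le> C" using h_bound[of 0] by simp
  have main: "cmod (P z - P w) \<le> 2 * C * (1 + cmod w powr p) * cmod (z - w)" if le: "cmod z \<le> cmod w" for z w
  proof -
    have "\<bar>h (cmod w) - h (cmod z)\<bar> * cmod z \<le> C * (1 + cmod w powr p) * cmod (z - w)"
    \<comment> \<open>The mean value theorem is applied on an interval inside the positive
      half-line, where h is differentiable; in the excluded cases the left side is 0.\<close>
    proof (cases "z = 0 \<or> cmod z = cmod w")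
      case True
      then show ?thesis using C by auto
    next
      case False
      then have lt: "0 < cmod z" "cmod z < cmod w" using le by auto
      have "\<exists>a. cmod z < a \<and> a < cmod w \<and> h (cmod w) - h (cmod z) = (cmod w - cmod z) * h' a"
        by (rule MVT2[OF lt(2)]) (rule h_deriv, erule less_le_trans[OF lt(1)])
      then obtain a where a: "cmod z < a" "a < cmod w" "h (cmod w) - h (cmod z) = (cmod w - cmod z) * h' a"
        by blast
      have a0: "0 < a" using a lt by linarith
      have "\<bar>h' a\<bar> * cmod z \<le> \<bar>h' a\<bar> * a" using a by (intro mult_left_mono) auto
      also have "\<dots> \<le> C * (1 / a + a powr (p - 1)) * a"
        using a0 by (intro mult_right_mono h'_bound) auto
      also have "\<dots> = C * (1 + a powr p)"
        using a0 by (simp add: powr_diff field_simps)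
      also have "\<dots> \<le> C * (1 + cmod w powr p)"
        using a a0 C p by (intro mult_left_mono add_left_mono powr_mono2) auto
      finally have 1: "\<bar>h' a\<bar> * cmod z \<le> C * (1 + cmod w powr p)" .
      have 2: "cmod w - cmod z \<le> cmod (z - w)"
        using norm_triangle_ineq2[of w z] by (simp add: norm_minus_commute)
      have "\<bar>h (cmod w) - h (cmod z)\<bar> * cmod z = (\<bar>h' a\<bar> * cmod z) * (cmod w - cmod z)"
        using a lt by (simp add: abs_mult mult_ac)
      also have "\<dots> \<le> C * (1 + cmod w powr p) * cmod (z - w)"
        by (rule mult_mono[OF 1 2]) (use lt C in auto)
      finally show ?thesis .
    qed
    moreover have "\<bar>h (cmod w)\<bar> * cmod (z - w) \<le> C * (1 + cmod w powr p) * cmod (z - w)"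
      by (intro mult_right_mono h_bound) auto
    moreover have "P z - P w = of_real (h (cmod w)) * (z - w) - of_real (h (cmod w) - h (cmod z)) * z"
      by (simp add: P algebra_simps)
    then have "cmod (P z - P w) \<le> \<bar>h (cmod w)\<bar> * cmod (z - w) + \<bar>h (cmod w) - h (cmod z)\<bar> * cmod z"
      by (metis norm_triangle_ineq4 norm_mult norm_of_real)
    ultimately show ?thesis by simp
  qed
  show ?thesis
  proof (cases "cmod z \<le> cmod w")
    case True
    then show ?thesis using main[OF True] by (simp add: max_def)
  next
    case False
    then show ?thesis using main[of w z] by (simp add: max_def norm_minus_commute)
  qed
qed

text \<open>Young's inequality trades the weight \<open>\<psi>\<close> against the fourth power, which is what the
  Strichartz estimate controls.\<close>

lemma weight_young:
  assumes p: "0 \<le> p" "p \<le> 4"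
    and psi_L1: "in_Lp 1 \<psi>"
    and psi_Lq: "in_Lp (if p = 4 then \<infinity> else ennreal (4 / (4 - p))) \<psi>"
  obtains A K where "integrable lborel A" "\<And>r. 0 \<le> A r" "0 \<le> K"
    "AE r in lborel. \<forall>s\<ge>0. \<bar>\<psi> r\<bar> * (1 + s powr p) \<le> A r + K * s ^ 4"
proof (cases "p = 4")
  case True
  then obtain K where K: "AE r in lborel. \<bar>\<psi> r\<bar> \<le> K" using psi_Lq by (auto simp: in_Lp_def)
  have "integrable lborel (\<lambda>r. \<bar>\<psi> r\<bar>)" using psi_L1 by (simp add: in_Lp_def)
  moreover have "AE r in lborel. \<forall>s\<ge>0. \<bar>\<psi> r\<bar> * (1 + s powr p) \<le> \<bar>\<psi> r\<bar> + max 0 K * s ^ 4"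
    using K
  proof (eventually_elim, intro allI impI)
    fix r s :: real assume "\<bar>\<psi> r\<bar> \<le> K" "0 \<le> s"
    have "s powr 4 = s ^ 4" using \<open>0 \<le> s\<close> by (cases "s = 0") (auto simp: powr_numeral)
    moreover have "\<bar>\<psi> r\<bar> * s ^ 4 \<le> max 0 K * s ^ 4"
      using \<open>\<bar>\<psi> r\<bar> \<le> K\<close> by (intro mult_right_mono) auto
    ultimately show "\<bar>\<psi> r\<bar> * (1 + s powr p) \<le> \<bar>\<psi> r\<bar> + max 0 K * s ^ 4"
      using True by (simp add: distrib_left)
  qed
  ultimately show ?thesis by (intro that[of "\<lambda>r. \<bar>\<psi> r\<bar>" "max 0 K"]) auto
next
  case False
  then have p4: "p < 4" using p by simp
  let ?q = "4 / (4 - p)"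
  have "integrable lborel (\<lambda>r. \<bar>\<psi> r\<bar>)" "integrable lborel (\<lambda>r. \<bar>\<psi> r\<bar> powr ?q)"
    using psi_L1 psi_Lq False p4 by (auto simp: in_Lp_def)
  then have "integrable lborel (\<lambda>r. \<bar>\<psi> r\<bar> + \<bar>\<psi> r\<bar> powr ?q)" by simp
  moreover have "\<bar>\<psi> r\<bar> * (1 + s powr p) \<le> \<bar>\<psi> r\<bar> + \<bar>\<psi> r\<bar> powr ?q + 1 * s ^ 4" if s: "0 \<le> s" for r s
  proof -
    have "\<bar>\<psi> r\<bar> * s powr p \<le> \<bar>\<psi> r\<bar> powr ?q + s ^ 4"
    proof (cases "s = 0")
      case False
      then have s0: "0 < s" using s by simp
      show ?thesis
      \<comment> \<open>Below this threshold the product is at most s^4. Above it, s is at most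
        |\<psi>|^(1/(4-p)), and 1 + p/(4-p) = 4/(4-p) is the given exponent.\<close>
      proof (cases "\<bar>\<psi> r\<bar> \<le> s powr (4 - p)")
        case True
        then have "\<bar>\<psi> r\<bar> * s powr p \<le> s powr (4 - p) * s powr p" by (intro mult_right_mono) auto
        also have "\<dots> = s ^ 4" using s0 by (simp add: powr_numeral flip: powr_add)
        finally show ?thesis by (simp add: add_increasing)
      next
        case False
        then have gt: "s powr (4 - p) < \<bar>\<psi> r\<bar>" by simp
        then have pos: "0 < \<bar>\<psi> r\<bar>" by (meson le_less_trans powr_ge_zero)
        have "s = (s powr (4 - p)) powr (1 / (4 - p))" using p4 s0 by (simp add: powr_powr)
        also have "\<dots> \<le> \<bar>\<psi> r\<bar> powr (1 / (4 - p))" using gt p4 by (intro powr_mono2) auto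
        finally have "s powr p \<le> (\<bar>\<psi> r\<bar> powr (1 / (4 - p))) powr p"
          using p s0 by (intro powr_mono2) auto
        then have "\<bar>\<psi> r\<bar> * s powr p \<le> \<bar>\<psi> r\<bar> powr 1 * \<bar>\<psi> r\<bar> powr (1 / (4 - p) * p)"
          using pos by (simp add: powr_powr)
        also have "\<dots> = \<bar>\<psi> r\<bar> powr (1 + 1 / (4 - p) * p)" by (simp only: powr_add)
        also have "1 + 1 / (4 - p) * p = ?q" using p4 by (simp add: field_simps)
        finally show ?thesis using s by (simp add: add_increasing2)
      qed
    qed simp
    then show ?thesis by (simp add: distrib_left)
  qed
  ultimately show ?thesis by (intro that[of "\<lambda>r. \<bar>\<psi> r\<bar> + \<bar>\<psi> r\<bar> powr ?q" 1]) auto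
qed

section \<open>Radial truncation, for P on the plane and for the vector field on L^2\<close>

definition radial_cut :: "real \<Rightarrow> 'a::real_normed_vector \<Rightarrow> real" where
  "radial_cut R x = max 0 (min 1 (R - norm x))"

lemma radial_cut_bounds: "0 \<le> radial_cut R x" "radial_cut R x \<le> 1"
  by (auto simp: radial_cut_def)

text \<open>In the product rule the cut at the outer point multiplies the difference of F, and the
  difference of cuts multiplies F at the inner point. Hence F is only compared inside the ball, and
  F 0 = 0 bounds it there by L R.\<close>

lemma radial_cut_lipschitz:
  fixes F :: "'a::real_normed_vector \<Rightarrow> 'b::real_normed_vector"
  assumes F0: "F 0 = 0" and L0: "0 \<le> L" and R: "0 \<le> R"
    and L: "\<And>x y. norm x \<le> R \<Longrightarrow> norm y \<le> R \<Longrightarrow> norm (F x - F y) \<le> L * norm (x - y)"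
  shows "norm (radial_cut R x *\<^sub>R F x - radial_cut R y *\<^sub>R F y) \<le> (L + L * R) * norm (x - y)"
proof -
  have main: "norm (radial_cut R z *\<^sub>R F z - radial_cut R w *\<^sub>R F w) \<le> (L + L * R) * norm (z - w)"
    if le: "norm z \<le> norm w" for z w
  proof -
    have 1: "radial_cut R w * norm (F z - F w) \<le> L * norm (z - w)"
    proof (cases "norm w \<le> R")
      case True
      then have "radial_cut R w * norm (F z - F w) \<le> 1 * (L * norm (z - w))"
        using le by (intro mult_mono L radial_cut_bounds) auto
      then show ?thesis by simp
    qed (simp add: radial_cut_def L0)
    have 2: "\<bar>radial_cut R z - radial_cut R w\<bar> * norm (F z) \<le> L * R * norm (z - w)"
    proof (cases "norm z \<le> R")
      case True
      have "\<bar>radial_cut R z - radial_cut R w\<bar> \<le> \<bar>norm z - norm w\<bar>" by (auto simp: radial_cut_def)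
      also have "\<dots> \<le> norm (z - w)" by (rule norm_triangle_ineq3)
      finally have d: "\<bar>radial_cut R z - radial_cut R w\<bar> \<le> norm (z - w)" .
      have "norm (F z) \<le> L * norm z" using L[OF True, of 0] R by (simp add: F0)
      also have "\<dots> \<le> L * R" using True L0 by (intro mult_left_mono) auto
      finally have "\<bar>radial_cut R z - radial_cut R w\<bar> * norm (F z) \<le> norm (z - w) * (L * R)"
        using d by (intro mult_mono) auto
      then show ?thesis by (simp add: mult_ac)
    next
      case False
      then have "radial_cut R z = 0" "radial_cut R w = 0" using le by (auto simp: radial_cut_def)
      then show ?thesis using L0 R by simp
    qed
    have "radial_cut R z *\<^sub>R F z - radial_cut R w *\<^sub>R F w =
        radial_cut R w *\<^sub>R (F z - F w) + (radial_cut R z - radial_cut R w) *\<^sub>R F z"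
      by (simp add: algebra_simps)
    then have "norm (radial_cut R z *\<^sub>R F z - radial_cut R w *\<^sub>R F w)
        \<le> radial_cut R w * norm (F z - F w) + \<bar>radial_cut R z - radial_cut R w\<bar> * norm (F z)"
      using norm_triangle_ineq[of "radial_cut R w *\<^sub>R (F z - F w)" "(radial_cut R z - radial_cut R w) *\<^sub>R F z"]
        radial_cut_bounds(1)[of R w] by simp
    with 1 2 show ?thesis by (simp add: distrib_right)
  qed
  show ?thesis
    using main[of x y] main[of y x] by (cases "norm x \<le> norm y") (auto simp: norm_minus_commute)
qed

text \<open>The interface between the hypotheses on h and the analysis in L^2: \<open>growth\<close>
  combines the weight \<psi>, the exponent p and Young's inequality into one bound adapted to
  Strichartz.\<close>

locale averaged_nls =
  fixes P :: "complex \<Rightarrow> complex" and h \<psi> A :: "real \<Rightarrow> real" and K :: real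
  assumes gauge: "\<And>z. P z = of_real (h (cmod z)) * z"
    and lip: "\<And>R. \<exists>L. \<forall>z w. cmod z \<le> R \<longrightarrow> cmod w \<le> R \<longrightarrow> cmod (P z - P w) \<le> L * cmod (z - w)"
    and psi_measurable [measurable]: "\<psi> \<in> borel_measurable borel"
    and A: "integrable lborel A" "\<And>r. 0 \<le> A r" and K: "0 \<le> K"
    and growth: "AE r in lborel. \<forall>z w. \<bar>\<psi> r\<bar> * cmod (P z - P w) \<le> (A r + K * (cmod z ^ 4 + cmod w ^ 4)) * cmod (z - w)"
begin

lemma P_0 [simp]: "P 0 = 0"
  by (simp add: gauge)

text \<open>The radius n + 1 leaves P unchanged on |z| <= n. Each truncation is globally Lipschitz,
  hence induces a Lipschitz map on L^2.\<close>

definition P_cut :: "nat \<Rightarrow> complex \<Rightarrow> complex" where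
  "P_cut n z = radial_cut (real n + 1) z *\<^sub>R P z"

lemma P_cut_lipschitz: "\<exists>L\<ge>0. \<forall>z w. cmod (P_cut n z - P_cut n w) \<le> L * cmod (z - w)"
proof -
  obtain L0 where L0: "\<And>z w. cmod z \<le> real n + 1 \<Longrightarrow> cmod w \<le> real n + 1 \<Longrightarrow> cmod (P z - P w) \<le> L0 * cmod (z - w)"
    using lip[of "real n + 1"] by auto
  have "cmod (P z - P w) \<le> max 0 L0 * cmod (z - w)" if "cmod z \<le> real n + 1" "cmod w \<le> real n + 1" for z w
    using L0[OF that] by (rule order_trans) (simp add: mult_right_mono)
  then have "cmod (P_cut n z - P_cut n w) \<le> (max 0 L0 + max 0 L0 * (real n + 1)) * cmod (z - w)" for z w
    unfolding P_cut_def by (intro radial_cut_lipschitz) auto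
  then show ?thesis by (intro exI[of _ "max 0 L0 + max 0 L0 * (real n + 1)"]) simp
qed

lemma P_cut_le: "cmod (P_cut n z) \<le> 1 * cmod (P z)"
  using radial_cut_bounds[of "real n + 1" z] by (auto simp: P_cut_def intro!: mult_left_le_one_le)

lemma P_cut_tendsto: "(\<lambda>n. P_cut n z) \<longlonglongrightarrow> P z"
proof -
  obtain N :: nat where N: "cmod z \<le> real N" using real_arch_simple by blast
  have "\<forall>n\<ge>N. P_cut n z = P z" using N by (auto simp: P_cut_def radial_cut_def)
  then show ?thesis by (intro tendsto_eventually) (auto simp: eventually_sequentially)
qed

lemma P_cut_measurable [measurable]: "P_cut n \<in> borel_measurable borel"
proof -
  obtain L where "0 \<le> L" "\<And>z w. cmod (P_cut n z - P_cut n w) \<le> L * cmod (z - w)"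
    using P_cut_lipschitz by blast
  then have "L-lipschitz_on UNIV (P_cut n)" by (intro lipschitz_onI) (auto simp: dist_norm)
  then show ?thesis by (intro borel_measurable_continuous_onI lipschitz_on_continuous_on)
qed

lemma P_measurable [measurable]: "P \<in> borel_measurable borel"
  by (rule borel_measurable_LIMSEQ_metric[OF P_cut_measurable P_cut_tendsto])

section \<open>The Nemytskii operator of P and its measurability\<close>

definition Nem :: "L2 \<Rightarrow> L2" where
  "Nem f = to_L2 (\<lambda>x. P (rep_L2 f x))"

definition Nem_cut :: "nat \<Rightarrow> L2 \<Rightarrow> L2" where
  "Nem_cut n f = abs_L2 (\<lambda>x. P_cut n (rep_L2 f x))"

lemma square_integrable_P_cut [simp]: "square_integrable (\<lambda>x. P_cut n (rep_L2 f x))"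
proof -
  obtain L where L: "0 \<le> L" "\<And>z w. cmod (P_cut n z - P_cut n w) \<le> L * cmod (z - w)"
    using P_cut_lipschitz by blast
  show ?thesis
  proof (rule square_integrable_bound[OF square_integrable_rep[of f]])
    show "cmod (P_cut n (rep_L2 f x)) \<le> L * cmod (rep_L2 f x)" for x
      using L(2)[of "rep_L2 f x" 0] by (simp add: P_cut_def)
  qed measurable
qed

lemma Nem_cut_measurable [measurable]: "Nem_cut n \<in> borel_measurable borel"
proof -
  obtain L where L: "0 \<le> L" "\<And>z w. cmod (P_cut n z - P_cut n w) \<le> L * cmod (z - w)"
    using P_cut_lipschitz by blast
  have "dist (Nem_cut n f) (Nem_cut n g) \<le> L * dist f g" for f g
  proof (rule power2_le_imp_le)
    have "(dist (Nem_cut n f) (Nem_cut n g))\<^sup>2 = (\<integral>x. (cmod (P_cut n (rep_L2 f x) - P_cut n (rep_L2 g x)))\<^sup>2 \<partial>lborel)"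
      unfolding Nem_cut_def by (rule dist_abs_L2_sq) simp_all
    also have "\<dots> \<le> (\<integral>x. L\<^sup>2 * (cmod (rep_L2 f x - rep_L2 g x))\<^sup>2 \<partial>lborel)"
    proof (rule integral_mono')
      show "integrable lborel (\<lambda>x. L\<^sup>2 * (cmod (rep_L2 f x - rep_L2 g x))\<^sup>2)"
        by (intro integrable_mult_right integrable_cmod_sq square_integrable_diff) auto
      show "(cmod (P_cut n (rep_L2 f x) - P_cut n (rep_L2 g x)))\<^sup>2 \<le> L\<^sup>2 * (cmod (rep_L2 f x - rep_L2 g x))\<^sup>2" for x
        using power_mono[OF L(2)[of "rep_L2 f x" "rep_L2 g x"], of 2] by (simp add: power_mult_distrib)
    qed simp
    also have "\<dots> = (L * dist f g)\<^sup>2"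
      using dist_abs_L2_sq[of "rep_L2 f" "rep_L2 g"] by (simp add: power_mult_distrib)
    finally show "(dist (Nem_cut n f) (Nem_cut n g))\<^sup>2 \<le> (L * dist f g)\<^sup>2" .
    show "0 \<le> L * dist f g" using L by simp
  qed
  then have "L-lipschitz_on UNIV (Nem_cut n)" using L(1) by (intro lipschitz_onI) auto
  then show ?thesis by (intro borel_measurable_continuous_onI lipschitz_on_continuous_on)
qed

text \<open>This describes the domain of \<open>Nem\<close> by countably many Borel conditions. One
  direction is domination of the truncations by P, the other is Fatou.\<close>

lemma square_integrable_P_iff:
  "square_integrable (\<lambda>x. P (rep_L2 f x)) \<longleftrightarrow> (\<exists>k::nat. \<forall>n. norm (Nem_cut n f) \<le> real k)"
proof
  assume sq: "square_integrable (\<lambda>x. P (rep_L2 f x))"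
  have "norm (Nem_cut n f) \<le> norm (abs_L2 (\<lambda>x. P (rep_L2 f x)))" for n
  proof (rule power2_le_imp_le)
    have "(norm (Nem_cut n f))\<^sup>2 = (\<integral>x. (cmod (P_cut n (rep_L2 f x)))\<^sup>2 \<partial>lborel)"
      unfolding Nem_cut_def by (rule norm_abs_L2_sq) simp
    also have "\<dots> \<le> (\<integral>x. (cmod (P (rep_L2 f x)))\<^sup>2 \<partial>lborel)"
      using P_cut_le by (intro integral_mono' integrable_cmod_sq sq power_mono) auto
    also have "\<dots> = (norm (abs_L2 (\<lambda>x. P (rep_L2 f x))))\<^sup>2" by (simp add: norm_abs_L2_sq sq)
    finally show "(norm (Nem_cut n f))\<^sup>2 \<le> (norm (abs_L2 (\<lambda>x. P (rep_L2 f x))))\<^sup>2" .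
  qed simp
  moreover obtain k :: nat where "norm (abs_L2 (\<lambda>x. P (rep_L2 f x))) \<le> real k" using real_arch_simple by blast
  ultimately show "\<exists>k::nat. \<forall>n. norm (Nem_cut n f) \<le> real k" by (meson order_trans)
next
  assume "\<exists>k::nat. \<forall>n. norm (Nem_cut n f) \<le> real k"
  then obtain k :: nat where k: "\<And>n. norm (Nem_cut n f) \<le> real k" by blast
  let ?p = "\<lambda>n x. ennreal ((cmod (P_cut n (rep_L2 f x)))\<^sup>2)"
  have "(\<integral>\<^sup>+x. ennreal ((cmod (P (rep_L2 f x)))\<^sup>2) \<partial>lborel) = (\<integral>\<^sup>+x. liminf (\<lambda>n. ?p n x) \<partial>lborel)"
    by (intro nn_integral_cong lim_imp_Liminf[symmetric] tendsto_ennrealI tendsto_intros P_cut_tendsto) simp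
  also have "\<dots> \<le> liminf (\<lambda>n. \<integral>\<^sup>+x. ?p n x \<partial>lborel)"
    by (rule nn_integral_liminf) measurable
  also have "\<dots> \<le> ennreal ((real k)\<^sup>2)"
  proof (rule order_trans[OF Liminf_le_Limsup Limsup_bounded])
    have "(\<integral>\<^sup>+x. ?p n x \<partial>lborel) = ennreal ((norm (Nem_cut n f))\<^sup>2)" for n
      by (simp add: Nem_cut_def norm_abs_L2_sq nn_integral_eq_integral integrable_cmod_sq)
    then show "\<forall>\<^sub>F n in sequentially. (\<integral>\<^sup>+x. ?p n x \<partial>lborel) \<le> ennreal ((real k)\<^sup>2)"
      using k by (intro always_eventually allI) (simp add: ennreal_leI power_mono del: of_nat_power)
  qed simp
  finally have "(\<integral>\<^sup>+x. ennreal ((cmod (P (rep_L2 f x)))\<^sup>2) \<partial>lborel) < \<infinity>"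
    by (rule le_less_trans) simp
  then show "square_integrable (\<lambda>x. P (rep_L2 f x))"
    unfolding square_integrable_def by (auto intro!: integrableI_nonneg)
qed

text \<open>On the Borel set D the truncated operators converge by dominated convergence; off D the
  constant 0 matches the dummy value of \<open>to_L2\<close>.\<close>

lemma Nem_measurable [measurable]: "Nem \<in> borel_measurable borel"
proof (rule borel_measurable_LIMSEQ_metric)
  define D where "D = {f. \<exists>k::nat. \<forall>n. norm (Nem_cut n f) \<le> real k}"
  have [measurable]: "D \<in> sets borel" unfolding D_def by measurable
  show "(\<lambda>f. if f \<in> D then Nem_cut n f else 0) \<in> borel_measurable borel" for n by measurable
  show "(\<lambda>n. if f \<in> D then Nem_cut n f else 0) \<longlonglongrightarrow> Nem f" for f
  proof (cases "f \<in> D")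
    case True
    then have sq: "square_integrable (\<lambda>x. P (rep_L2 f x))" by (simp add: D_def square_integrable_P_iff)
    have "(\<lambda>n. Nem_cut n f) \<longlonglongrightarrow> abs_L2 (\<lambda>x. P (rep_L2 f x))"
      unfolding Nem_cut_def
      by (rule L2_dominated_tendsto(2)[OF sq _ _ P_cut_le P_cut_tendsto]) measurable
    with True sq show ?thesis by (simp add: Nem_def to_L2_abs)
  next
    case False
    then have "\<not> square_integrable (\<lambda>x. P (rep_L2 f x))" by (simp add: D_def square_integrable_P_iff)
    with False show ?thesis by (simp add: Nem_def to_L2_def)
  qed
qed

text \<open>A bounded function takes its values almost everywhere in a disc on which P is Lipschitz
  and P 0 = 0, so |P(f)| is at most a multiple of |f|.\<close>

lemma square_integrable_P:
  assumes "sup4 f < \<infinity>" shows "square_integrable (\<lambda>x. P (rep_L2 f x))"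
proof -
  obtain \<alpha> where \<alpha>: "0 \<le> \<alpha>" "sup4 f = ennreal \<alpha>" using assms by (cases "sup4 f") auto
  have bd: "AE x in lborel. cmod (rep_L2 f x) \<le> root 4 \<alpha>"
    using AE_sup4[of f]
  proof eventually_elim
    case (elim x)
    then have "cmod (rep_L2 f x) ^ 4 \<le> \<alpha>" using \<alpha> by simp
    then show ?case using real_root_le_iff[of 4 "cmod (rep_L2 f x) ^ 4" \<alpha>]
      by (simp add: real_root_power_cancel)
  qed
  obtain L where L: "\<And>z w. cmod z \<le> root 4 \<alpha> \<Longrightarrow> cmod w \<le> root 4 \<alpha> \<Longrightarrow> cmod (P z - P w) \<le> L * cmod (z - w)"
    using lip[of "root 4 \<alpha>"] by auto
  have "integrable lborel (\<lambda>x. (cmod (P (rep_L2 f x)))\<^sup>2)"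
  proof (rule Bochner_Integration.integrable_bound)
    show "integrable lborel (\<lambda>x. L\<^sup>2 * (cmod (rep_L2 f x))\<^sup>2)"
      by (intro integrable_mult_right integrable_cmod_sq) simp
    show "AE x in lborel. norm ((cmod (P (rep_L2 f x)))\<^sup>2) \<le> norm (L\<^sup>2 * (cmod (rep_L2 f x))\<^sup>2)"
      using bd
    proof eventually_elim
      case (elim x)
      have "cmod (P (rep_L2 f x)) \<le> L * cmod (rep_L2 f x)"
        using L[OF elim, of 0] \<alpha> by simp
      from power_mono[OF this, of 2] show ?case by (simp add: power_mult_distrib)
    qed
  qed measurable
  then show ?thesis by (simp add: square_integrable_def)
qed

section \<open>The averaged integrand and the Lipschitz bound for Q\<close>

definition integrand :: "L2 \<Rightarrow> real \<Rightarrow> L2" where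
  "integrand f r = \<psi> r *\<^sub>R free_schroedinger (- r) (Nem (free_schroedinger r f))"

lemma averaged_nonlinearity_eq: "averaged_nonlinearity P \<psi> f = (LINT r|lborel. integrand f r)"
  by (simp add: averaged_nonlinearity_def integrand_def Nem_def inv_free_schroedinger)

lemma integrand_measurable [measurable]: "integrand f \<in> borel_measurable lborel"
proof -
  have "(\<lambda>r. free_schroedinger r f) \<in> borel_measurable lborel"
    by (rule measurable_free_schroedinger) auto
  then have "(\<lambda>r. Nem (free_schroedinger r f)) \<in> borel_measurable lborel"
    by (rule measurable_compose[OF _ Nem_measurable])
  then have "(\<lambda>r. free_schroedinger (- r) (Nem (free_schroedinger r f))) \<in> borel_measurable lborel"
    by (rule measurable_free_schroedinger) auto
  then show ?thesis unfolding integrand_def by measurable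
qed

text \<open>A real-valued version for use in Bochner integrals. Where \<open>sup4\<close> is
  infinite, \<open>enn2real\<close> returns 0; by Strichartz this happens only for a null set of
  r.\<close>

definition strich :: "L2 \<Rightarrow> real \<Rightarrow> real" where
  "strich f r = enn2real (sup4 (free_schroedinger r f))"

lemma sup4_free_measurable [measurable]: "(\<lambda>r. sup4 (free_schroedinger r f)) \<in> borel_measurable lborel"
  using measurable_free_schroedinger[of "\<lambda>r. f" "\<lambda>r. r"]
  by (intro measurable_compose[OF _ sup4_measurable]) auto

lemma AE_sup4_finite: "AE r in lborel. sup4 (free_schroedinger r f) \<noteq> \<infinity>"
  using strichartz[of f] by (intro nn_integral_noteq_infinite) (auto simp: top_unique)

lemma strich_nonneg: "0 \<le> strich f r"
  by (simp add: strich_def)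

lemma strich_integrable: "integrable lborel (strich f)"
  and strich_integral: "(LINT r|lborel. strich f r) \<le> 25 * norm f ^ 4"
proof -
  have [measurable]: "strich f \<in> borel_measurable lborel" unfolding strich_def by measurable
  have le: "(\<integral>\<^sup>+r. ennreal (strich f r) \<partial>lborel) \<le> ennreal (25 * norm f ^ 4)"
    unfolding strich_def
    by (intro order_trans[OF nn_integral_mono strichartz]) (simp add: ennreal_enn2real_if)
  show int: "integrable lborel (strich f)"
    using le by (intro integrableI_nonneg) (auto simp: strich_nonneg le_less_trans)
  have "ennreal (LINT r|lborel. strich f r) = (\<integral>\<^sup>+r. ennreal (strich f r) \<partial>lborel)"
    using int strich_nonneg by (intro nn_integral_eq_integral[symmetric]) auto
  with le have "ennreal (LINT r|lborel. strich f r) \<le> ennreal (25 * norm f ^ 4)" by simp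
  then show "(LINT r|lborel. strich f r) \<le> 25 * norm f ^ 4" by (subst (asm) ennreal_le_iff) auto
qed

text \<open>The isometry of T_{-r} reduces the claim to P(a) - P(b). The essential suprema of a and
  b turn \<open>growth\<close> into a factor depending on r alone, which leaves the integral in x;
  the isometry of T_r then restores the distance of f and g.\<close>

lemma integrand_diff:
  "AE r in lborel. norm (integrand f r - integrand g r) \<le> (A r + K * (strich f r + strich g r)) * dist f g"
  using AE_sup4_finite[of f] AE_sup4_finite[of g] growth
proof eventually_elim
  case (elim r)
  define a where "a = rep_L2 (free_schroedinger r f)"
  define b where "b = rep_L2 (free_schroedinger r g)"
  define c where "c = A r + K * (strich f r + strich g r)"
  have c0: "0 \<le> c" using A(2)[of r] K by (simp add: c_def strich_nonneg)
  have sq: "square_integrable (\<lambda>x. P (a x))" "square_integrable (\<lambda>x. P (b x))"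
    using elim(1,2) by (auto simp: a_def b_def less_top intro!: square_integrable_P)
  have a4: "AE x in lborel. cmod (a x) ^ 4 \<le> strich f r"
    using AE_sup4[of "free_schroedinger r f"] unfolding a_def
  proof eventually_elim
    case (elim x)
    then have "ennreal (cmod (rep_L2 (free_schroedinger r f) x) ^ 4) \<le> ennreal (strich f r)"
      using \<open>sup4 (free_schroedinger r f) \<noteq> \<infinity>\<close> by (simp add: strich_def less_top)
    then show ?case by (simp add: strich_nonneg)
  qed
  have b4: "AE x in lborel. cmod (b x) ^ 4 \<le> strich g r"
    using AE_sup4[of "free_schroedinger r g"] unfolding b_def
  proof eventually_elim
    case (elim x)
    then have "ennreal (cmod (rep_L2 (free_schroedinger r g) x) ^ 4) \<le> ennreal (strich g r)"
      using \<open>sup4 (free_schroedinger r g) \<noteq> \<infinity>\<close> by (simp add: strich_def less_top)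
    then show ?case by (simp add: strich_nonneg)
  qed
  have "norm (integrand f r - integrand g r) = \<bar>\<psi> r\<bar> * dist (Nem (free_schroedinger r f)) (Nem (free_schroedinger r g))"
    by (simp add: integrand_def dist_norm dist_free_schroedinger[unfolded dist_norm] flip: scaleR_diff_right)
  also have "\<dots> \<le> c * dist f g"
  proof (rule power2_le_imp_le)
    have "(\<bar>\<psi> r\<bar> * dist (Nem (free_schroedinger r f)) (Nem (free_schroedinger r g)))\<^sup>2
      = (\<integral>x. (\<bar>\<psi> r\<bar> * cmod (P (a x) - P (b x)))\<^sup>2 \<partial>lborel)"
      using sq by (simp add: Nem_def to_L2_abs power_mult_distrib dist_abs_L2_sq flip: a_def b_def)
    also have "\<dots> \<le> (\<integral>x. c\<^sup>2 * (cmod (a x - b x))\<^sup>2 \<partial>lborel)"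
    proof (rule integral_mono_AE')
      show "integrable lborel (\<lambda>x. c\<^sup>2 * (cmod (a x - b x))\<^sup>2)"
        unfolding a_def b_def by (intro integrable_mult_right integrable_cmod_sq square_integrable_diff) auto
      show "AE x in lborel. (\<bar>\<psi> r\<bar> * cmod (P (a x) - P (b x)))\<^sup>2 \<le> c\<^sup>2 * (cmod (a x - b x))\<^sup>2"
        using a4 b4
      proof eventually_elim
        case (elim x)
        have "\<bar>\<psi> r\<bar> * cmod (P (a x) - P (b x)) \<le> (A r + K * (cmod (a x) ^ 4 + cmod (b x) ^ 4)) * cmod (a x - b x)"
          using \<open>\<forall>z w. \<bar>\<psi> r\<bar> * cmod (P z - P w) \<le> (A r + K * (cmod z ^ 4 + cmod w ^ 4)) * cmod (z - w)\<close> by blast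
        also have "\<dots> \<le> c * cmod (a x - b x)"
          unfolding c_def using elim K by (intro mult_right_mono add_mono mult_left_mono) auto
        finally have "(\<bar>\<psi> r\<bar> * cmod (P (a x) - P (b x)))\<^sup>2 \<le> (c * cmod (a x - b x))\<^sup>2"
          by (intro power_mono) auto
        then show ?case by (simp only: power_mult_distrib)
      qed
    qed simp
    also have "\<dots> = (c * dist (free_schroedinger r f) (free_schroedinger r g))\<^sup>2"
      using dist_abs_L2_sq[of a b] by (simp add: a_def b_def power_mult_distrib)
    finally show "(\<bar>\<psi> r\<bar> * dist (Nem (free_schroedinger r f)) (Nem (free_schroedinger r g)))\<^sup>2 \<le> (c * dist f g)\<^sup>2"
      by (simp add: dist_free_schroedinger)
    show "0 \<le> c * dist f g" using c0 by simp
  qed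
  finally show ?case unfolding c_def .
qed

lemma Nem_0: "Nem 0 = 0"
proof -
  have "AE x in lborel. P (rep_L2 0 x) = 0"
    using rep_abs_L2[of "\<lambda>x. 0"] by (auto simp: zero_L2_def elim!: eventually_mono)
  then have "square_integrable (\<lambda>x. P (rep_L2 0 x)) \<Longrightarrow> abs_L2 (\<lambda>x. P (rep_L2 0 x)) = 0"
    unfolding zero_L2_def by (intro abs_L2_eqI) auto
  then show ?thesis by (simp add: Nem_def to_L2_def)
qed

lemma integrable_weight:
  "integrable lborel (\<lambda>r. (A r + K * (strich f r + strich g r)) * dist f g)"
  using A strich_integrable by auto

lemma integrable_integrand: "integrable lborel (integrand f)"
proof (rule Bochner_Integration.integrable_bound[OF integrable_weight[of f 0]])
  show "AE r in lborel. norm (integrand f r) \<le> norm ((A r + K * (strich f r + strich 0 r)) * dist f 0)"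
    using integrand_diff[of f 0]
    by eventually_elim (auto simp: integrand_def free_schroedinger_0 Nem_0 intro: order_trans[OF _ abs_ge_self])
qed measurable

lemma averaged_nonlinearity_0: "averaged_nonlinearity P \<psi> 0 = 0"
  by (simp add: averaged_nonlinearity_eq integrand_def free_schroedinger_0 Nem_0)

text \<open>Integrating the r-dependent factor, Strichartz contributes 25 R^4 for each of f and g,
  whence 50.\<close>

lemma averaged_nonlinearity_lipschitz:
  assumes "norm f \<le> R" "norm g \<le> R"
  shows "dist (averaged_nonlinearity P \<psi> f) (averaged_nonlinearity P \<psi> g)
    \<le> ((LINT r|lborel. A r) + 50 * K * R ^ 4) * dist f g"
proof -
  have "dist (averaged_nonlinearity P \<psi> f) (averaged_nonlinearity P \<psi> g)
      = norm (LINT r|lborel. integrand f r - integrand g r)"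
    by (simp add: averaged_nonlinearity_eq dist_norm integrable_integrand)
  also have "\<dots> \<le> (LINT r|lborel. norm (integrand f r - integrand g r))"
    by (rule integral_norm_bound)
  also have "\<dots> \<le> (LINT r|lborel. (A r + K * (strich f r + strich g r)) * dist f g)"
    using integrand_diff[of f g]
    by (intro integral_mono_AE integrable_weight integrable_norm Bochner_Integration.integrable_diff integrable_integrand) auto
  also have "\<dots> = ((LINT r|lborel. A r) + K * ((LINT r|lborel. strich f r) + (LINT r|lborel. strich g r))) * dist f g"
    using A strich_integrable by simp
  also have "\<dots> \<le> ((LINT r|lborel. A r) + K * (25 * R ^ 4 + 25 * R ^ 4)) * dist f g"
  proof (intro mult_right_mono add_left_mono mult_left_mono add_mono K)
    have "25 * norm f ^ 4 \<le> 25 * R ^ 4" "25 * norm g ^ 4 \<le> 25 * R ^ 4"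
      using assms by (auto intro!: power_mono)
    then show "(LINT r|lborel. strich f r) \<le> 25 * R ^ 4" "(LINT r|lborel. strich g r) \<le> 25 * R ^ 4"
      using strich_integral[of f] strich_integral[of g] by linarith+
  qed simp
  finally show ?thesis by (simp add: algebra_simps)
qed

text \<open>Gauge invariance: \<open>P z\<close> is a real multiple of \<open>z\<close>, hence orthogonal to \<open>i z\<close>.\<close>

lemma averaged_nonlinearity_orthogonal: "inner (averaged_nonlinearity P \<psi> f) (scaleC_L2 \<i> f) = 0"
proof -
  have 0: "inner (integrand f r) (scaleC_L2 \<i> f) = 0" for r
  proof -
    let ?g = "free_schroedinger r f"
    \<comment> \<open>Inserting T_{-r} T_r before i f lets the isometry remove T_{-r}, which leaves
      an inner product that can be computed pointwise.\<close>
    have "inner (free_schroedinger (- r) (Nem ?g)) (scaleC_L2 \<i> f)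
        = inner (free_schroedinger (- r) (Nem ?g)) (free_schroedinger (- r) (free_schroedinger r (scaleC_L2 \<i> f)))"
      by (simp add: free_schroedinger_inverse)
    also have "\<dots> = inner (Nem ?g) (scaleC_L2 \<i> ?g)"
      unfolding free_schroedinger_scaleC[of r] by (rule inner_free_schroedinger)
    also have "\<dots> = 0"
    proof (cases "square_integrable (\<lambda>x. P (rep_L2 ?g x))")
      case True
      have "scaleC_L2 \<i> ?g = abs_L2 (\<lambda>x. \<i> * rep_L2 ?g x)"
        using scaleC_L2_abs[of "rep_L2 ?g" \<i>] by simp
      moreover have "inner (P z) (\<i> * z) = 0" for z
        by (simp add: gauge inner_complex_def)
      ultimately show ?thesis
        using True by (simp add: Nem_def to_L2_abs inner_L2_abs square_integrable_cmult)
    qed (simp add: Nem_def to_L2_def)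
    finally show ?thesis by (simp add: integrand_def)
  qed
  have "inner (averaged_nonlinearity P \<psi> f) (scaleC_L2 \<i> f) = (LINT r|lborel. inner (integrand f r) (scaleC_L2 \<i> f))"
    unfolding averaged_nonlinearity_eq by (rule integral_inner_left[symmetric]) (rule integrable_integrand)
  then show ?thesis by (simp add: 0)
qed

end

section \<open>Ordinary differential equations in a Hilbert space\<close>

text \<open>The factor exp (- k t) makes the product nonincreasing. Derivatives are taken in the
  open interval only, matching the definition of a strong solution.\<close>

lemma gronwall_forward:
  fixes d :: "real \<Rightarrow> real"
  assumes cont: "continuous_on {0..M} d"
    and deriv: "\<And>t. 0 < t \<Longrightarrow> t < M \<Longrightarrow> (d has_real_derivative d' t) (at t)"
    and le: "\<And>t. 0 < t \<Longrightarrow> t < M \<Longrightarrow> d' t \<le> k * d t"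
    and t: "0 \<le> t" "t \<le> M"
  shows "d t \<le> exp (k * t) * d 0"
proof -
  have "exp (- (k * t)) * d t \<le> exp (- (k * 0)) * d 0"
  proof (rule DERIV_nonpos_imp_decreasing_open[OF t(1)])
    show "continuous_on {0..t} (\<lambda>t. exp (- (k * t)) * d t)"
      using t by (intro continuous_intros continuous_on_subset[OF cont]) auto
    fix s assume s: "0 < s" "s < t"
    have "((\<lambda>t. exp (- (k * t)) * d t) has_real_derivative exp (- (k * s)) * (d' s - k * d s)) (at s)"
      using s t by (auto intro!: derivative_eq_intros deriv simp: algebra_simps)
    moreover have "exp (- (k * s)) * (d' s - k * d s) \<le> 0"
      using le[of s] s t by (intro mult_nonneg_nonpos) auto
    ultimately show "\<exists>y. ((\<lambda>t. exp (- (k * t)) * d t) has_real_derivative y) (at s) \<and> y \<le> 0" by blast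
  qed
  then show ?thesis by (simp add: exp_minus field_simps)
qed

lemma has_derivative_norm_sq:
  fixes w :: "real \<Rightarrow> 'a::real_inner"
  assumes "(w has_vector_derivative w') (at t)"
  shows "((\<lambda>t. (norm (w t))\<^sup>2) has_real_derivative 2 * inner (w t) w') (at t)"
proof -
  have "((\<lambda>t. inner (w t) (w t)) has_derivative (\<lambda>h. inner (w t) (h *\<^sub>R w') + inner (h *\<^sub>R w') (w t))) (at t)"
    using assms unfolding has_vector_derivative_def by (intro has_derivative_inner)
  moreover have "(\<lambda>h. inner (w t) (h *\<^sub>R w') + inner (h *\<^sub>R w') (w t)) = (*) (2 * inner (w t) w')"
    by (simp add: fun_eq_iff inner_commute)
  ultimately show ?thesis
    by (simp add: has_field_derivative_def power2_norm_eq_inner)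
qed

lemma conserved_norm:
  fixes u :: "real \<Rightarrow> 'a::real_inner"
  assumes cont: "continuous_on {a..b} u"
    and deriv: "\<And>t. a < t \<Longrightarrow> t < b \<Longrightarrow> (u has_vector_derivative u' t) (at t)"
    and orth: "\<And>t. a < t \<Longrightarrow> t < b \<Longrightarrow> inner (u t) (u' t) = 0"
    and t: "a < b" "t \<in> {a..b}" "s \<in> {a..b}"
  shows "norm (u t) = norm (u s)"
proof -
  have "(norm (u r))\<^sup>2 = (norm (u a))\<^sup>2" if "r \<in> {a..b}" for r
  proof (rule DERIV_isconst2[OF t(1), of "\<lambda>t. (norm (u t))\<^sup>2"])
    show "continuous_on {a..b} (\<lambda>t. (norm (u t))\<^sup>2)" by (intro continuous_intros cont)
    show "((\<lambda>t. (norm (u t))\<^sup>2) has_real_derivative 0) (at x)" if "a < x" "x < b" for x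
      using has_derivative_norm_sq[OF deriv[OF that]] orth[OF that] by simp
  qed (use that in auto)
  from this[OF t(2)] this[OF t(3)] show ?thesis by simp
qed

text \<open>The squared distance is differentiable even where the distance vanishes, at the price of
  the rate 2 L. Negative times are reflected to positive ones, so the bound on the derivative is
  needed in absolute value.\<close>

lemma gronwall_distance:
  fixes u v :: "real \<Rightarrow> 'a::real_inner"
  assumes u: "continuous_on {- a..b} u" "\<And>t. - a < t \<Longrightarrow> t < b \<Longrightarrow> (u has_vector_derivative u' t) (at t)"
    and v: "continuous_on {- a..b} v" "\<And>t. - a < t \<Longrightarrow> t < b \<Longrightarrow> (v has_vector_derivative v' t) (at t)"
    and lip: "\<And>t. - a < t \<Longrightarrow> t < b \<Longrightarrow> norm (u' t - v' t) \<le> L * norm (u t - v t)"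
    and ab: "0 < a" "0 < b" and t: "t \<in> {- a..b}"
  shows "norm (u t - v t) \<le> exp (L * \<bar>t\<bar>) * norm (u 0 - v 0)"
proof -
  define d where "d t = (norm (u t - v t))\<^sup>2" for t
  have d_deriv: "(d has_real_derivative 2 * inner (u t - v t) (u' t - v' t)) (at t)" if "- a < t" "t < b" for t
    unfolding d_def
    by (intro has_derivative_norm_sq has_vector_derivative_diff u(2) v(2) that)
  have bd: "\<bar>2 * inner (u t - v t) (u' t - v' t)\<bar> \<le> 2 * L * d t" if "- a < t" "t < b" for t
  proof -
    have "\<bar>inner (u t - v t) (u' t - v' t)\<bar> \<le> norm (u t - v t) * norm (u' t - v' t)"
      by (rule Cauchy_Schwarz_ineq2)
    also have "\<dots> \<le> norm (u t - v t) * (L * norm (u t - v t))"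
      by (intro mult_left_mono lip that) simp
    finally show ?thesis by (simp add: d_def power2_eq_square abs_mult mult_ac)
  qed
  have d_cont: "continuous_on {- a..b} d" unfolding d_def by (intro continuous_intros u v)
  have "d t \<le> exp (2 * L * \<bar>t\<bar>) * d 0"
  proof (cases "0 \<le> t")
    case True
    have "d t \<le> exp ((2 * L) * t) * d 0"
    proof (rule gronwall_forward)
      show "continuous_on {0..b} d" by (rule continuous_on_subset[OF d_cont]) (use ab in auto)
      show "(d has_real_derivative 2 * inner (u s - v s) (u' s - v' s)) (at s)" if "0 < s" "s < b" for s
        using that ab by (intro d_deriv) auto
      show "2 * inner (u s - v s) (u' s - v' s) \<le> (2 * L) * d s" if "0 < s" "s < b" for s
        using bd[of s] that ab by auto
    qed (use t True in auto)
    then show ?thesis using True by simp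
  next
    case False
    have "d (- (- t)) \<le> exp ((2 * L) * (- t)) * d (- 0)"
    proof (rule gronwall_forward[of a "\<lambda>s. d (- s)"])
      show "continuous_on {0..a} (\<lambda>s. d (- s))"
        by (rule continuous_on_compose2[OF d_cont]) (use ab in \<open>auto intro!: continuous_intros\<close>)
      show "((\<lambda>s. d (- s)) has_real_derivative - (2 * inner (u (- s) - v (- s)) (u' (- s) - v' (- s)))) (at s)"
        if "0 < s" "s < a" for s
      proof -
        have "((\<lambda>s. d (- s)) has_real_derivative 2 * inner (u (- s) - v (- s)) (u' (- s) - v' (- s)) * - 1) (at s)"
          by (rule DERIV_chain2[where f = d and g = uminus, OF d_deriv])
             (use that ab in \<open>auto intro!: derivative_eq_intros\<close>)
        then show ?thesis by simp
      qed
      show "- (2 * inner (u (- s) - v (- s)) (u' (- s) - v' (- s))) \<le> (2 * L) * d (- s)" if "0 < s" "s < a" for s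
        using bd[of "- s"] that ab by auto
    qed (use t False in auto)
    then show ?thesis using False by simp
  qed
  also have "exp (2 * L * \<bar>t\<bar>) * d 0 = (exp (L * \<bar>t\<bar>) * norm (u 0 - v 0))\<^sup>2"
    by (simp add: d_def power_mult_distrib mult_ac flip: exp_double)
  finally show ?thesis unfolding d_def by (rule power2_le_imp_le) simp
qed

text \<open>One of the two intervals is always negligible.\<close>

definition primitive :: "(real \<Rightarrow> 'a::banach) \<Rightarrow> real \<Rightarrow> 'a" where
  "primitive g t = integral {0..t} g - integral {t..0} g"

text \<open>A base point to the left of all times considered gives a single formula on both sides of
  0, so the fundamental theorem also applies at t = 0.\<close>

lemma primitive_shift:
  assumes g: "continuous_on UNIV g" and M: "\<bar>t\<bar> \<le> M"
  shows "primitive g t = integral {- M..t} g - integral {- M..0} g"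
proof -
  have int: "g integrable_on {a..b}" for a b
    by (intro integrable_continuous_real continuous_on_subset[OF g]) auto
  show ?thesis
  proof (cases "0 \<le> t")
    case True
    have "integral {- M..0} g + integral {0..t} g = integral {- M..t} g"
      using True M by (intro Henstock_Kurzweil_Integration.integral_combine int) auto
    moreover have "integral {t..0} g = 0" using True by (cases "t = 0") auto
    ultimately show ?thesis by (simp add: primitive_def algebra_simps)
  next
    case False
    have "integral {- M..t} g + integral {t..0} g = integral {- M..0} g"
      using False M by (intro Henstock_Kurzweil_Integration.integral_combine int) auto
    then show ?thesis using False by (simp add: primitive_def algebra_simps)
  qed
qed

lemma primitive_deriv:
  assumes g: "continuous_on UNIV g"
  shows "(primitive g has_vector_derivative g t) (at t)"
proof -
  define M where "M = \<bar>t\<bar> + 1"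
  have "((\<lambda>s. integral {- M..s} g) has_vector_derivative g t) (at t within {- M..M})"
    by (rule integral_has_vector_derivative) (auto intro: continuous_on_subset[OF g] simp: M_def)
  then have "((\<lambda>s. integral {- M..s} g - integral {- M..0} g) has_vector_derivative g t) (at t within {- M..M})"
    by (auto intro!: derivative_eq_intros)
  then have "(primitive g has_vector_derivative g t) (at t within {- M..M})"
  proof (rule has_vector_derivative_transform[rotated 2])
    show "t \<in> {- M..M}" by (auto simp: M_def)
    show "primitive g s = integral {- M..s} g - integral {- M..0} g" if "s \<in> {- M..M}" for s
      using that by (intro primitive_shift[OF g]) auto
  qed
  moreover have "at t within {- M..M} = at t"
    by (rule at_within_interior) (auto simp: M_def)
  ultimately show ?thesis by simp
qed

lemma primitive_0: "primitive g 0 = 0"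
  by (simp add: primitive_def)

lemma primitive_diff:
  assumes "continuous_on UNIV g" "continuous_on UNIV f"
  shows "primitive (\<lambda>s. g s - f s) t = primitive g t - primitive f t"
proof -
  have "g integrable_on {a..b}" "f integrable_on {a..b}" for a b
    by (intro integrable_continuous_real continuous_on_subset[OF assms(1)] continuous_on_subset[OF assms(2)]; simp)+
  then show ?thesis by (simp add: primitive_def Henstock_Kurzweil_Integration.integral_diff)
qed

text \<open>Integration reproduces the exponential weight with a gain 1 / k, which is the source of
  the contraction.\<close>

lemma norm_primitive_le:
  fixes g :: "real \<Rightarrow> 'a::banach"
  assumes g: "continuous_on UNIV g" and le: "\<And>s. norm (g s) \<le> b * exp (k * \<bar>s\<bar>)"
    and k: "0 < k" and b: "0 \<le> b"
  shows "norm (primitive g t) \<le> b / k * exp (k * \<bar>t\<bar>)"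
proof -
  have int: "g integrable_on {x..y}" for x y
    by (intro integrable_continuous_real continuous_on_subset[OF g]) auto
  show ?thesis
  proof (cases "0 \<le> t")
    case True
    have hi: "((\<lambda>s. b * exp (k * s)) has_integral b / k * exp (k * t) - b / k * exp (k * 0)) {0..t}"
      using k by (intro fundamental_theorem_of_calculus[OF True])
        (auto intro!: derivative_eq_intros simp flip: has_real_derivative_iff_has_vector_derivative)
    have "integral {t..0} g = 0" using True by (cases "t = 0") auto
    then have "norm (primitive g t) = norm (integral {0..t} g)" by (simp add: primitive_def)
    also have "\<dots> \<le> integral {0..t} (\<lambda>s. b * exp (k * s))"
    proof (intro Henstock_Kurzweil_Integration.integral_norm_bound_integral int has_integral_integrable[OF hi])
      show "norm (g s) \<le> b * exp (k * s)" if "s \<in> {0..t}" for s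
        using le[of s] that by simp
    qed
    also have "\<dots> = b / k * exp (k * t) - b / k * exp (k * 0)" by (rule integral_unique[OF hi])
    also have "\<dots> \<le> b / k * exp (k * \<bar>t\<bar>)" using True b k by simp
    finally show ?thesis .
  next
    case False
    then have t: "t \<le> 0" by simp
    have hi: "((\<lambda>s. b * exp (- (k * s))) has_integral - (b / k) * exp (- (k * 0)) - - (b / k) * exp (- (k * t))) {t..0}"
      using k by (intro fundamental_theorem_of_calculus[OF t])
        (auto intro!: derivative_eq_intros simp flip: has_real_derivative_iff_has_vector_derivative)
    have "norm (primitive g t) = norm (integral {t..0} g)" using False by (simp add: primitive_def)
    also have "\<dots> \<le> integral {t..0} (\<lambda>s. b * exp (- (k * s)))"
    proof (intro Henstock_Kurzweil_Integration.integral_norm_bound_integral int has_integral_integrable[OF hi])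
      show "norm (g s) \<le> b * exp (- (k * s))" if "s \<in> {t..0}" for s
        using le[of s] that by simp
    qed
    also have "\<dots> = - (b / k) * exp (- (k * 0)) - - (b / k) * exp (- (k * t))" by (rule integral_unique[OF hi])
    also have "\<dots> \<le> b / k * exp (k * \<bar>t\<bar>)" using False b k by simp
    finally show ?thesis .
  qed
qed

text \<open>A contraction for the weighted unknown \<open>v t = exp (- 2 L \<bar>t\<bar>) u t\<close>, so that no restriction
  to short times is needed.\<close>

lemma global_flow_exists:
  fixes G :: "'a::banach \<Rightarrow> 'a"
  assumes lip: "\<And>x y. norm (G x - G y) \<le> L * norm (x - y)" and L: "0 < L" and G0: "G 0 = 0"
  shows "\<exists>u. u 0 = x \<and> (\<forall>t. (u has_vector_derivative G (u t)) (at t))"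
proof -
  \<comment> \<open>This makes L / k = 1/2 the contraction factor.\<close>
  define k where "k = 2 * L"
  have k: "0 < k" using L by (simp add: k_def)
  have G_cont: "continuous_on UNIV G"
  proof -
    have "L-lipschitz_on UNIV G" using lip L by (intro lipschitz_onI) (auto simp: dist_norm)
    then show ?thesis by (rule lipschitz_on_continuous_on)
  qed
  define g where "g v s = G (exp (k * \<bar>s\<bar>) *\<^sub>R apply_bcontfun v s)" for v :: "real \<Rightarrow>\<^sub>C 'a" and s
  have g_cont: "continuous_on UNIV (g v)" for v
    unfolding g_def by (rule continuous_on_compose2[OF G_cont]) (auto intro!: continuous_intros)
  define \<Phi> where "\<Phi> v t = exp (- (k * \<bar>t\<bar>)) *\<^sub>R (x + primitive (g v) t)" for v t
  have prim_cont: "continuous_on UNIV (primitive (g v))" for v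
    using primitive_deriv[OF g_cont] by (intro continuous_on_vector_derivative) (auto intro: has_vector_derivative_at_within)
  have g_diff: "norm (g v s - g w s) \<le> (L * dist v w) * exp (k * \<bar>s\<bar>)" for v w s
  proof -
    have "norm (g v s - g w s) \<le> L * (exp (k * \<bar>s\<bar>) * dist (apply_bcontfun v s) (apply_bcontfun w s))"
      using lip[of "exp (k * \<bar>s\<bar>) *\<^sub>R apply_bcontfun v s" "exp (k * \<bar>s\<bar>) *\<^sub>R apply_bcontfun w s"]
      by (simp add: g_def dist_norm flip: scaleR_diff_right)
    also have "\<dots> \<le> L * (exp (k * \<bar>s\<bar>) * dist v w)"
      using L by (intro mult_left_mono dist_bounded) auto
    finally show ?thesis by (simp add: mult_ac)
  qed
  \<comment> \<open>As G 0 = 0, the bound \<open>g_diff\<close> against the zero function shows that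
    g v grows at most like the weight, so the weighted primitive stays bounded.\<close>
  have \<Phi>_in: "\<Phi> v \<in> bcontfun" for v
  proof (rule bcontfun_normI)
    show "continuous_on UNIV (\<Phi> v)" unfolding \<Phi>_def by (intro continuous_intros prim_cont)
    fix t
    have "norm (primitive (g v) t) \<le> (L * dist v 0) / k * exp (k * \<bar>t\<bar>)"
      using g_diff[of v _ 0] L by (intro norm_primitive_le g_cont k) (auto simp: g_def G0)
    then have "exp (- (k * \<bar>t\<bar>)) * norm (primitive (g v) t) \<le> exp (- (k * \<bar>t\<bar>)) * ((L * dist v 0) / k * exp (k * \<bar>t\<bar>))"
      by (rule mult_left_mono) simp
    also have "\<dots> = (L * dist v 0) / k" by (simp add: exp_minus field_simps)
    finally have 1: "exp (- (k * \<bar>t\<bar>)) * norm (primitive (g v) t) \<le> (L * dist v 0) / k" .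
    have 2: "exp (- (k * \<bar>t\<bar>)) * norm x \<le> 1 * norm x" using k by (intro mult_right_mono) auto
    have "norm (\<Phi> v t) \<le> exp (- (k * \<bar>t\<bar>)) * (norm x + norm (primitive (g v) t))"
      by (simp add: \<Phi>_def norm_triangle_ineq)
    also have "\<dots> \<le> norm x + (L * dist v 0) / k" using 1 2 by (simp add: distrib_left)
    finally show "norm (\<Phi> v t) \<le> norm x + (L * dist v 0) / k" .
  qed
  have contr: "dist (Bcontfun (\<Phi> v)) (Bcontfun (\<Phi> w)) \<le> 1 / 2 * dist v w" for v w
  proof (rule dist_bound)
    fix t
    have "norm (primitive (\<lambda>s. g v s - g w s) t) \<le> (L * dist v w) / k * exp (k * \<bar>t\<bar>)"
      using L by (intro norm_primitive_le k g_diff continuous_intros g_cont) auto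
    then have "exp (- (k * \<bar>t\<bar>)) * norm (primitive (g v) t - primitive (g w) t)
        \<le> exp (- (k * \<bar>t\<bar>)) * ((L * dist v w) / k * exp (k * \<bar>t\<bar>))"
      by (intro mult_left_mono) (simp_all add: primitive_diff g_cont)
    also have "\<dots> = 1 / 2 * dist v w" using L by (simp add: exp_minus field_simps k_def)
    finally show "dist (apply_bcontfun (Bcontfun (\<Phi> v)) t) (apply_bcontfun (Bcontfun (\<Phi> w)) t) \<le> 1 / 2 * dist v w"
      by (simp add: Bcontfun_inverse \<Phi>_in dist_norm) (simp add: \<Phi>_def flip: scaleR_diff_right)
  qed
  have "\<exists>!v\<in>UNIV. Bcontfun (\<Phi> v) = v"
    by (rule Banach_fix[of UNIV "1/2"]) (use contr complete_UNIV in auto)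
  then obtain v where v: "Bcontfun (\<Phi> v) = v" by blast
  \<comment> \<open>Removing the weight turns the fixed point equation into the integral equation
    for u.\<close>
  define u where "u t = exp (k * \<bar>t\<bar>) *\<^sub>R apply_bcontfun v t" for t
  have "apply_bcontfun v = \<Phi> v" using Bcontfun_inverse[OF \<Phi>_in[of v]] v by simp
  then have "u t = (exp (k * \<bar>t\<bar>) * exp (- (k * \<bar>t\<bar>))) *\<^sub>R (x + primitive (g v) t)" for t
    by (simp add: u_def \<Phi>_def)
  then have u: "u = (\<lambda>t. x + primitive (g v) t)" by (simp add: fun_eq_iff flip: exp_add)
  have "(u has_vector_derivative G (u t)) (at t)" for t
  proof -
    have "((\<lambda>t. x + primitive (g v) t) has_vector_derivative 0 + g v t) (at t)"
      by (intro has_vector_derivative_add has_vector_derivative_const primitive_deriv g_cont)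
    moreover have "g v t = G (u t)" by (simp add: g_def u_def)
    ultimately show ?thesis by (simp flip: u)
  qed
  moreover have "u 0 = x" by (simp add: u primitive_0)
  ultimately show ?thesis by blast
qed

section \<open>The Cauchy problem\<close>

lemma scaleC_L2_add: "scaleC_L2 c (f + g) = scaleC_L2 c f + scaleC_L2 c g"
  by transfer (auto simp: L2_rel_def distrib_left intro!: square_integrable_cmult square_integrable_add)

lemma scaleC_L2_scaleC: "scaleC_L2 c (scaleC_L2 d f) = scaleC_L2 (c * d) f"
  by transfer (auto simp: L2_rel_def mult.assoc intro!: square_integrable_cmult)

lemma scaleC_L2_minus_one: "scaleC_L2 (- 1) f = - f"
  by transfer (auto simp: L2_rel_def intro!: square_integrable_uminus)

lemma scaleC_L2_ii: "scaleC_L2 \<i> (scaleC_L2 \<i> f) = - f"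
  by (simp add: scaleC_L2_scaleC scaleC_L2_minus_one)

lemma inner_scaleC_L2_ii: "inner (scaleC_L2 \<i> f) g = - inner f (scaleC_L2 \<i> g)"
proof -
  have "inner (scaleC_L2 \<i> (abs_L2 (rep_L2 f))) (abs_L2 (rep_L2 g))
      = - inner (abs_L2 (rep_L2 f)) (scaleC_L2 \<i> (abs_L2 (rep_L2 g)))"
    by (simp only: scaleC_L2_abs square_integrable_rep inner_L2_abs square_integrable_cmult)
       (simp add: inner_complex_def flip: Bochner_Integration.integral_minus)
  then show ?thesis by simp
qed

lemma norm_scaleC_L2_ii: "norm (scaleC_L2 \<i> f) = norm f"
  by (simp add: norm_eq_sqrt_inner inner_scaleC_L2_ii scaleC_L2_ii)

lemma scaleC_L2_minus: "scaleC_L2 c (- f) = - scaleC_L2 c f"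
  by transfer (auto simp: L2_rel_def intro!: square_integrable_cmult square_integrable_uminus)

lemma scaleC_L2_diff: "scaleC_L2 c (f - g) = scaleC_L2 c f - scaleC_L2 c g"
  using scaleC_L2_add[of c "f - g" g] by simp

context averaged_nls
begin

section \<open>The vector field of the averaged equation and its flow\<close>

definition vector_field :: "L2 \<Rightarrow> L2" where
  "vector_field f = scaleC_L2 \<i> (averaged_nonlinearity P \<psi> f)"

lemma vector_field_iff:
  "scaleC_L2 \<i> f' + averaged_nonlinearity P \<psi> f = 0 \<longleftrightarrow> f' = vector_field f"
proof
  assume "scaleC_L2 \<i> f' + averaged_nonlinearity P \<psi> f = 0"
  then have "averaged_nonlinearity P \<psi> f = - scaleC_L2 \<i> f'" by (simp add: add_eq_0_iff)
  then show "f' = vector_field f"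
    by (simp add: vector_field_def scaleC_L2_minus scaleC_L2_ii)
qed (simp add: vector_field_def scaleC_L2_ii)

lemma vector_field_orthogonal: "inner f (vector_field f) = 0"
  using averaged_nonlinearity_orthogonal[of f] inner_scaleC_L2_ii[of f "averaged_nonlinearity P \<psi> f"]
  by (simp add: vector_field_def inner_commute)

lemma vector_field_0: "vector_field 0 = 0"
  using scaleC_L2_diff[of \<i> 0 0] by (simp add: vector_field_def averaged_nonlinearity_0)

definition lip_const :: "real \<Rightarrow> real" where
  "lip_const R = (LINT r|lborel. A r) + 50 * K * R ^ 4"

lemma lip_const_nonneg: "0 \<le> lip_const R"
  unfolding lip_const_def using K A(2) by (intro add_nonneg_nonneg Bochner_Integration.integral_nonneg) auto

lemma vector_field_lipschitz:
  assumes "norm f \<le> R" "norm g \<le> R"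
  shows "norm (vector_field f - vector_field g) \<le> lip_const R * norm (f - g)"
  using averaged_nonlinearity_lipschitz[OF assms]
  by (simp add: vector_field_def norm_scaleC_L2_ii lip_const_def dist_norm flip: scaleC_L2_diff)

lemma strong_solution_iff:
  "strong_solution (averaged_nonlinearity P \<psi>) M1 M2 \<phi> u \<longleftrightarrow>
     continuous_on {- M1..M2} u \<and> continuous_on {- M1<..<M2} (\<lambda>t. vector_field (u t)) \<and>
     (\<forall>t. - M1 < t \<longrightarrow> t < M2 \<longrightarrow> (u has_vector_derivative vector_field (u t)) (at t)) \<and> u 0 = \<phi>"
proof -
  have "(\<exists>u'. continuous_on {- M1<..<M2} u' \<and> (\<forall>t\<in>{- M1<..<M2}.
        (u has_vector_derivative u' t) (at t) \<and> u' t = vector_field (u t)))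
    \<longleftrightarrow> continuous_on {- M1<..<M2} (\<lambda>t. vector_field (u t)) \<and>
     (\<forall>t\<in>{- M1<..<M2}. (u has_vector_derivative vector_field (u t)) (at t))"
  proof
    assume "\<exists>u'. continuous_on {- M1<..<M2} u' \<and> (\<forall>t\<in>{- M1<..<M2}.
        (u has_vector_derivative u' t) (at t) \<and> u' t = vector_field (u t))"
    then obtain u' where u': "continuous_on {- M1<..<M2} u'"
      "\<forall>t\<in>{- M1<..<M2}. (u has_vector_derivative u' t) (at t) \<and> u' t = vector_field (u t)" by blast
    have "continuous_on {- M1<..<M2} (\<lambda>t. vector_field (u t))"
      using u'(1) by (rule continuous_on_eq) (use u'(2) in auto)
    then show "continuous_on {- M1<..<M2} (\<lambda>t. vector_field (u t)) \<and>
       (\<forall>t\<in>{- M1<..<M2}. (u has_vector_derivative vector_field (u t)) (at t))" using u'(2) by auto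
  qed auto
  then show ?thesis
    unfolding strong_solution_def vector_field_iff by auto
qed

lemma mass_conservation:
  assumes M: "0 < M1" "0 < M2" and u: "strong_solution (averaged_nonlinearity P \<psi>) M1 M2 \<phi> u"
    and t: "t \<in> {- M1..M2}"
  shows "norm (u t) = norm \<phi>"
proof -
  have "norm (u t) = norm (u 0)"
    using u M t unfolding strong_solution_iff
    by (intro conserved_norm[of "- M1" M2 u "\<lambda>t. vector_field (u t)"]) (auto simp: vector_field_orthogonal)
  then show ?thesis using u by (simp add: strong_solution_iff)
qed

text \<open>The cut-off multiplies the field by a real number, so the cut field is still orthogonal
  to its argument and its flow conserves the norm. The curve remains on the sphere of its datum,
  where the cut-off is 1. One globally defined curve thus serves all intervals.\<close>

lemma strong_solution_exists: "\<exists>u. \<forall>M1 M2. strong_solution (averaged_nonlinearity P \<psi>) M1 M2 \<phi> u"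
proof -
  define R where "R = norm \<phi> + 1"
  define G where "G f = radial_cut R f *\<^sub>R vector_field f" for f
  \<comment> \<open>The summand 1 keeps L positive when both other terms vanish.\<close>
  define L where "L = lip_const R + lip_const R * R + 1"
  have R: "0 \<le> R" by (simp add: R_def)
  have G_lip0: "norm (G f - G g) \<le> (lip_const R + lip_const R * R) * norm (f - g)" for f g
    unfolding G_def
    by (rule radial_cut_lipschitz[OF vector_field_0 lip_const_nonneg R vector_field_lipschitz])
  have G_lip: "norm (G f - G g) \<le> L * norm (f - g)" for f g
    by (rule order_trans[OF G_lip0]) (simp add: L_def distrib_right)
  have L: "0 < L" using lip_const_nonneg[of R] R by (simp add: L_def add_nonneg_pos)
  have "G 0 = 0" by (simp add: G_def vector_field_0)
  from global_flow_exists[OF G_lip L this, of \<phi>] obtain u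
    where u: "u 0 = \<phi>" "\<And>t. (u has_vector_derivative G (u t)) (at t)" by blast
  have u_cont: "continuous_on S u" for S
    using u(2) by (intro continuous_on_vector_derivative) (auto intro: has_vector_derivative_at_within)
  have "norm (u t) = norm (u 0)" for t
    by (rule conserved_norm[of "- \<bar>t\<bar> - 1" "\<bar>t\<bar> + 1" u "\<lambda>t. G (u t)"])
       (use u(2) in \<open>auto simp: u_cont G_def vector_field_orthogonal\<close>)
  \<comment> \<open>The norm stays equal to R - 1, the largest value at which the cut-off is still
    1.\<close>
  then have G_eq: "G (u t) = vector_field (u t)" for t
    by (simp add: G_def radial_cut_def R_def u(1))
  have "L-lipschitz_on UNIV G" using G_lip L by (intro lipschitz_onI) (auto simp: dist_norm)
  then have "continuous_on UNIV G" by (rule lipschitz_on_continuous_on)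
  then have "continuous_on S (\<lambda>t. G (u t))" for S
    by (rule continuous_on_compose2[OF _ u_cont]) auto
  then show ?thesis
    using u u_cont unfolding strong_solution_iff G_eq by blast
qed

text \<open>Mass conservation, valid for every strong solution, keeps both curves in the ball of
  radius R, so a single Lipschitz constant governs the whole interval.\<close>

lemma strong_solution_dist:
  assumes M: "0 < M1" "0 < M2"
    and u: "strong_solution (averaged_nonlinearity P \<psi>) M1 M2 \<phi> u" "norm \<phi> \<le> R"
    and v: "strong_solution (averaged_nonlinearity P \<psi>) M1 M2 \<eta> v" "norm \<eta> \<le> R"
    and t: "t \<in> {- M1..M2}"
  shows "dist (u t) (v t) \<le> exp (lip_const R * (M1 + M2)) * dist \<phi> \<eta>"
proof -
  have "norm (u t - v t) \<le> exp (lip_const R * \<bar>t\<bar>) * norm (u 0 - v 0)"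
  proof (rule gronwall_distance[of M1 M2 u "\<lambda>t. vector_field (u t)" v "\<lambda>t. vector_field (v t)", OF _ _ _ _ _ M t])
    show "norm (vector_field (u s) - vector_field (v s)) \<le> lip_const R * norm (u s - v s)"
      if "- M1 < s" "s < M2" for s
      using that u(2) v(2) mass_conservation[OF M u(1), of s] mass_conservation[OF M v(1), of s]
      by (intro vector_field_lipschitz) auto
  qed (use u(1) v(1) in \<open>auto simp: strong_solution_iff\<close>)
  also have "\<dots> \<le> exp (lip_const R * (M1 + M2)) * norm (u 0 - v 0)"
    using t M lip_const_nonneg[of R] by (intro mult_right_mono) (auto intro!: mult_left_mono)
  finally show ?thesis using u v by (simp add: dist_norm strong_solution_iff)
qed

text \<open>The distance estimate yields uniqueness for equal data and uniform continuous dependence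
  for nearby data. Restricting to a unit ball fixes R and hence the constant E.\<close>

lemma globally_well_posed: "globally_well_posed (averaged_nonlinearity P \<psi>)"
  unfolding globally_well_posed_def well_posed_near_def
proof (intro allI impI)
  fix u0 :: L2 and M1 M2 :: real assume M: "0 < M1" "0 < M2"
  define R where "R = norm u0 + 1"
  obtain S where S: "\<And>\<phi> M1 M2. strong_solution (averaged_nonlinearity P \<psi>) M1 M2 \<phi> (S \<phi>)"
    using strong_solution_exists by metis
  have R: "norm \<phi> \<le> R" if "\<phi> \<in> ball u0 1" for \<phi>
    using that norm_triangle_ineq2[of \<phi> u0] by (simp add: R_def dist_norm norm_minus_commute)
  define E where "E = exp (lip_const R * (M1 + M2))"
  have E: "0 < E" by (simp add: E_def)
  have unique: "v t = S \<phi> t" if "\<phi> \<in> ball u0 1" "strong_solution (averaged_nonlinearity P \<psi>) M1 M2 \<phi> v"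
    "t \<in> {- M1..M2}" for \<phi> v t
    using strong_solution_dist[OF M that(2) R[OF that(1)] S R[OF that(1)] that(3)] by simp
  have cont: "uniform_limit {- M1..M2} S (S \<phi>) (at \<phi> within ball u0 1)" if \<phi>: "\<phi> \<in> ball u0 1" for \<phi>
    unfolding uniform_limit_iff
  proof (intro allI impI)
    fix e :: real assume e: "0 < e"
    have "\<forall>\<^sub>F \<eta> in at \<phi> within ball u0 1. dist \<eta> \<phi> < e / E"
      using e E by (auto simp: eventually_at intro!: exI[of _ "e / E"])
    moreover have "\<forall>\<^sub>F \<eta> in at \<phi> within ball u0 1. \<eta> \<in> ball u0 1"
      by (auto simp: eventually_at_filter)
    ultimately show "\<forall>\<^sub>F \<eta> in at \<phi> within ball u0 1. \<forall>t\<in>{- M1..M2}. dist (S \<eta> t) (S \<phi> t) < e"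
    proof eventually_elim
      case (elim \<eta>)
      show ?case
      proof
        fix t assume t: "t \<in> {- M1..M2}"
        have "dist (S \<eta> t) (S \<phi> t) \<le> E * dist \<eta> \<phi>"
          unfolding E_def by (rule strong_solution_dist[OF M S R[OF elim(2)] S R[OF \<phi>] t])
        also have "\<dots> < e" using elim(1) E by (simp add: field_simps)
        finally show "dist (S \<eta> t) (S \<phi> t) < e" .
      qed
    qed
  qed
  show "\<exists>c \<rho>. u0 \<in> ball c \<rho> \<and>
      (\<exists>S. (\<forall>\<phi>\<in>ball c \<rho>. strong_solution (averaged_nonlinearity P \<psi>) M1 M2 \<phi> (S \<phi>) \<and>
              (\<forall>v. strong_solution (averaged_nonlinearity P \<psi>) M1 M2 \<phi> v \<longrightarrow> (\<forall>t\<in>{- M1..M2}. v t = S \<phi> t))) \<and>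
           (\<forall>\<phi>\<in>ball c \<rho>. uniform_limit {- M1..M2} S (S \<phi>) (at \<phi> within ball c \<rho>)))"
  proof (rule exI[of _ u0], rule exI[of _ 1], rule conjI)
    show "\<exists>S. (\<forall>\<phi>\<in>ball u0 1. strong_solution (averaged_nonlinearity P \<psi>) M1 M2 \<phi> (S \<phi>) \<and>
              (\<forall>v. strong_solution (averaged_nonlinearity P \<psi>) M1 M2 \<phi> v \<longrightarrow> (\<forall>t\<in>{- M1..M2}. v t = S \<phi> t))) \<and>
           (\<forall>\<phi>\<in>ball u0 1. uniform_limit {- M1..M2} S (S \<phi>) (at \<phi> within ball u0 1))"
      by (rule exI[of _ S], intro conjI ballI allI impI)
         (rule S, rule unique, assumption+, rule cont, assumption)
  qed simp
qed

end

theorem theorem1p2: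
  fixes h h' \<psi> :: "real \<Rightarrow> real" and P :: "complex \<Rightarrow> complex" and p C :: real
  assumes h_cont: "continuous_on {0..} h"
    and h_deriv: "\<And>a. a > 0 \<Longrightarrow> (h has_real_derivative h' a) (at a)"
    and h'_cont: "continuous_on {0<..} h'"
    and h'_lim: "((\<lambda>a. h' a * a) \<longlongrightarrow> 0) (at_right 0)"
    and p: "0 \<le> p" "p \<le> 4"
    and h_bound: "\<And>a. a \<ge> 0 \<Longrightarrow> \<bar>h a\<bar> \<le> C * (1 + a powr p)"
    and h'_bound: "\<And>a. a > 0 \<Longrightarrow> \<bar>h' a\<bar> \<le> C * (1 / a + a powr (p - 1))"
    and psi_nonneg: "AE r in lborel. 0 \<le> \<psi> r"
    and psi_L1: "in_Lp 1 \<psi>"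
    and psi_Lq: "in_Lp (if p = 4 then \<infinity> else ennreal (4 / (4 - p))) \<psi>"
    and P: "\<And>z. P z = of_real (h (cmod z)) * z"
  shows "globally_well_posed (averaged_nonlinearity P \<psi>) \<and>
    (\<forall>M1>0. \<forall>M2>0. \<forall>u0 u. strong_solution (averaged_nonlinearity P \<psi>) M1 M2 u0 u \<longrightarrow>
       (\<forall>t\<in>{- M1..M2}. (norm (u t))\<^sup>2 = (norm u0)\<^sup>2))"
proof -
  obtain A K where A: "integrable lborel A" "\<And>r. 0 \<le> A r" and K: "0 \<le> K"
    and young: "AE r in lborel. \<forall>s\<ge>0. \<bar>\<psi> r\<bar> * (1 + s powr p) \<le> A r + K * s ^ 4"
    by (rule weight_young[OF p psi_L1 psi_Lq]) (rule that)
  have C: "0 \<le> C" using h_bound[of 0] by simp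
  have P_lip: "cmod (P z - P w) \<le> 2 * C * (1 + max (cmod z) (cmod w) powr p) * cmod (z - w)" for z w
    by (rule P_locally_lipschitz[OF h_deriv p(1) h_bound h'_bound P])
  \<comment> \<open>The factor 2 C of the pointwise Lipschitz bound is absorbed into both constants
    of the Young inequality.\<close>
  interpret averaged_nls P h \<psi> "\<lambda>r. 2 * C * A r" "2 * C * K"
  proof
    show "\<exists>L. \<forall>z w. cmod z \<le> R \<longrightarrow> cmod w \<le> R \<longrightarrow> cmod (P z - P w) \<le> L * cmod (z - w)" for R
    proof (intro exI allI impI)
      fix z w assume "cmod z \<le> R" "cmod w \<le> R"
      then have "2 * C * (1 + max (cmod z) (cmod w) powr p) * cmod (z - w) \<le> 2 * C * (1 + R powr p) * cmod (z - w)"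
        using C p by (intro mult_right_mono mult_left_mono add_left_mono powr_mono2) (auto simp: max_def)
      with P_lip show "cmod (P z - P w) \<le> 2 * C * (1 + R powr p) * cmod (z - w)"
        by (rule order_trans)
    qed
    show "\<psi> \<in> borel_measurable borel" using psi_L1 by (simp add: in_Lp_def)
    show "AE r in lborel. \<forall>z w. \<bar>\<psi> r\<bar> * cmod (P z - P w)
        \<le> (2 * C * A r + 2 * C * K * (cmod z ^ 4 + cmod w ^ 4)) * cmod (z - w)"
      using young
    proof (eventually_elim, intro allI)
      fix r z w assume y: "\<forall>s\<ge>0. \<bar>\<psi> r\<bar> * (1 + s powr p) \<le> A r + K * s ^ 4"
      define m where "m = max (cmod z) (cmod w)"
      have m: "0 \<le> m" "m ^ 4 \<le> cmod z ^ 4 + cmod w ^ 4" by (auto simp: m_def max_def)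
      have "\<bar>\<psi> r\<bar> * cmod (P z - P w) \<le> \<bar>\<psi> r\<bar> * (2 * C * (1 + m powr p) * cmod (z - w))"
        unfolding m_def by (intro mult_left_mono P_lip) simp
      also have "\<dots> = 2 * C * (\<bar>\<psi> r\<bar> * (1 + m powr p)) * cmod (z - w)" by simp
      also have "\<dots> \<le> 2 * C * (A r + K * (cmod z ^ 4 + cmod w ^ 4)) * cmod (z - w)"
      proof (intro mult_right_mono mult_left_mono)
        have "\<bar>\<psi> r\<bar> * (1 + m powr p) \<le> A r + K * m ^ 4" using y m(1) by blast
        also have "\<dots> \<le> A r + K * (cmod z ^ 4 + cmod w ^ 4)"
          by (intro add_left_mono mult_left_mono m K)
        finally show "\<bar>\<psi> r\<bar> * (1 + m powr p) \<le> A r + K * (cmod z ^ 4 + cmod w ^ 4)" .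
      qed (use C in auto)
      finally show "\<bar>\<psi> r\<bar> * cmod (P z - P w)
          \<le> (2 * C * A r + 2 * C * K * (cmod z ^ 4 + cmod w ^ 4)) * cmod (z - w)"
        by (simp add: distrib_left mult.assoc)
    qed
  qed (use A K C P in auto)
  show ?thesis using globally_well_posed mass_conservation by simp
qed

end
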